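(* Let $P\subseteq N_{\mathbb{R}}$ be a reflexive polytope, let $X=X_P$ be the toric variety of the spanning fan of $P$, let $\rho_X$ be the Picard rank of $X$, and let $\rho'=\rho'(P)$ be the facet complexity of $P$. Then \[\rho_X\leq \rho'\leq |F(P)|-1,\] where $|F(P)|$ is the number of facets of $P$.
   Context: Let $N=\mathbb{Z}^d$, $M=\operatorname{Hom}(N,\mathbb{Z})$, $N_{\mathbb{R}}=N\otimes\mathbb{R}$, $M_{\mathbb{R}}=M\otimes\mathbb{R}$. Toric varieties are over $\mathbb{C}$. A full-dimensional lattice polytope $P\subseteq N_{\mathbb{R}}$ with $0$ in its interior is reflexive if its polar $P^*=\{x\in M_{\mathbb{R}}:\langle x,y\rangle\geq -1\ \forall y\in P\}$ is also a lattice polytope. The spanning fan of $P$ is the fan of cones over the faces of $P$. $F(P)$ and $V(P)$ denote the sets of facets and vertices of $P$. Facet complexity. Let $P$ be reflexive of dimension $d$ and $m=|F(P)|$. A facet sequence over $F(P)$ is an ordering $L=(G_0,\dots,G_{m-1})$ of all the facets of $P$ without repetition. For $i\geq 0$ let $S_i=\bigcup_{j=0}^{i}V(G_j)$. For $i\geq 1$ let $w_i$ be the dimension of the affine span of $S_{i-1}\cap V(G_i)$ if this set is nonempty, and $w_i=-1$ if it is empty. Put $a_i=0$ if $w_i=d-1$, $a_i=1$ if $w_i=d-2$, and $a_i=\infty$ otherwise. Define $\rho_L=\sum_{i=1}^{m-1}a_i\in\mathbb{Z}_{\geq 0}\cup\{\infty\}$. The facet complexity $\rho'(P)$ is the minimum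 of $\rho_L$ over all facet sequences $L$ over $F(P)$. *)

theory Defs
  imports
    "HOL-Analysis.Analysis"
    "HOL-Algebra.QuotRing"
    "HOL-Library.Poly_Mapping"
    "HOL-Library.Extended_Nat"
    "HOL-Computational_Algebra.Fraction_Field"
begin

section \<open>Reflexive polytopes and facet complexity\<close>

text \<open>
  Here N is the lattice of integer vectors in \<open>real ^ 'n\<close>, with d = \<open>CARD('n)\<close>. Its dual M is
  identified with \<open>int ^ 'n\<close> (and the dual real space with \<open>real ^ 'n\<close>) by the standard pairing.
\<close>

definition lattice_points :: "(real ^ 'n) set" where
  "lattice_points = {x. \<forall>i. x $ i \<in> \<int>}"

definition lattice_polytope :: "(real ^ 'n) set \<Rightarrow> bool" where
  "lattice_polytope P \<longleftrightarrow> (\<exists>S. finite S \<and> S \<subseteq> lattice_points \<and> P = convex hull S)"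

definition polar_dual :: "(real ^ 'n) set \<Rightarrow> (real ^ 'n) set" where
  "polar_dual P = {x. \<forall>y\<in>P. x \<bullet> y \<ge> -1}"

text \<open>Full-dimensionality is implied by \<open>0 \<in> interior P\<close>, the interior being taken in \<open>real ^ 'n\<close>.\<close>

definition reflexive :: "(real ^ 'n) set \<Rightarrow> bool" where
  "reflexive P \<longleftrightarrow> lattice_polytope P \<and> 0 \<in> interior P \<and> lattice_polytope (polar_dual P)"

definition facets :: "(real ^ 'n) set \<Rightarrow> (real ^ 'n) set set" where
  "facets P = {G. G facet_of P}"

definition vertices :: "(real ^ 'n) set \<Rightarrow> (real ^ 'n) set" where
  "vertices P = {v. v extreme_point_of P}"

definition facet_sequences :: "(real ^ 'n) set \<Rightarrow> (real ^ 'n) set list set" where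
  "facet_sequences P = {L. distinct L \<and> set L = facets P}"

text \<open>\<open>aff_dim {} = -1\<close>, so the empty intersection needs no separate case.\<close>

definition seq_dim :: "(real ^ 'n) set list \<Rightarrow> nat \<Rightarrow> int" where
  "seq_dim L i = aff_dim ((\<Union>j\<le>i - 1. vertices (L ! j)) \<inter> vertices (L ! i))"

definition seq_cost :: "(real ^ 'n) set list \<Rightarrow> nat \<Rightarrow> enat" where
  "seq_cost L i =
     (if seq_dim L i = int CARD('n) - 1 then 0
      else if seq_dim L i = int CARD('n) - 2 then 1
      else \<infinity>)"

definition seq_complexity :: "(real ^ 'n) set list \<Rightarrow> enat" where
  "seq_complexity L = (\<Sum>i = 1..<length L. seq_cost L i)"

text \<open>An infimum in \<open>enat\<close> of a nonempty set is attained, hence a minimum.\<close>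

definition facet_complexity :: "(real ^ 'n) set \<Rightarrow> enat" where
  "facet_complexity P = (INF L\<in>facet_sequences P. seq_complexity L)"

text \<open>The empty face is included and gives the cone \<open>{0}\<close>, since \<open>convex_cone hull {} = {0}\<close>.\<close>

definition spanning_fan :: "(real ^ 'n) set \<Rightarrow> (real ^ 'n) set set" where
  "spanning_fan P = {convex_cone hull F | F. F face_of P \<and> F \<noteq> P}"


section \<open>The group algebra of M and the function field\<close>

text \<open>
  The library's integral domain instance for \<open>\<Rightarrow>\<^sub>0\<close> needs a linear order on the exponents that
  is compatible with addition, but the order of \<open>int ^ 'n\<close> is the componentwise one. Hence a
  copy of the type, with an instance of its own.
\<close>

typedef 'n laurent = "UNIV :: ((int ^ 'n) \<Rightarrow>\<^sub>0 complex) set"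
  morphisms laurent_coeffs Laurent ..

setup_lifting type_definition_laurent

lemma laurent_no_zero_divisors:
  fixes f g :: "(int ^ 'n) \<Rightarrow>\<^sub>0 complex"
  assumes "f \<noteq> 0" "g \<noteq> 0"
  shows "f * g \<noteq> 0"
proof -
  obtain e :: "'n \<Rightarrow> nat" where e: "inj e"
    using finite_imp_inj_to_nat_seg[of "UNIV :: 'n set"] by auto
  define \<phi> :: "int ^ 'n \<Rightarrow> (nat \<Rightarrow>\<^sub>0 int)"
    where "\<phi> m = (\<Sum>i\<in>UNIV. Poly_Mapping.single (e i) (m $ i))" for m
  have add: "\<phi> (x + y) = \<phi> x + \<phi> y" for x y
    by (simp add: \<phi>_def single_add sum.distrib)
  have look: "Poly_Mapping.lookup (\<phi> m) (e j) = m $ j" for m j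
  proof -
    have "Poly_Mapping.lookup (\<phi> m) (e j) = (\<Sum>i\<in>UNIV. if i = j then m $ i else 0)"
      unfolding \<phi>_def lookup_sum
      by (intro sum.cong) (auto simp: lookup_single when_def inj_eq[OF e])
    then show ?thesis by simp
  qed
  have inj: "x = y" if "\<phi> x = \<phi> y" for x y
    using that look by (metis vec_eq_iff)
  have max: "\<exists>a. Poly_Mapping.lookup h a \<noteq> 0 \<and> (\<forall>k. Poly_Mapping.lookup h k \<noteq> 0 \<longrightarrow> \<phi> k \<le> \<phi> a)"
    if "h \<noteq> 0" for h :: "(int ^ 'n) \<Rightarrow>\<^sub>0 complex"
  proof -
    have fin: "finite (\<phi> ` Poly_Mapping.keys h)" "\<phi> ` Poly_Mapping.keys h \<noteq> {}" using that by auto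
    then obtain a where "a \<in> Poly_Mapping.keys h" "\<phi> a = Max (\<phi> ` Poly_Mapping.keys h)"
      using Max_in[OF fin] by (metis imageE)
    with fin(1) show ?thesis by (intro exI[of _ a]) (auto simp: in_keys_iff)
  qed
  obtain a where a: "Poly_Mapping.lookup f a \<noteq> 0" "\<And>k. Poly_Mapping.lookup f k \<noteq> 0 \<Longrightarrow> \<phi> k \<le> \<phi> a"
    using max[OF assms(1)] by blast
  obtain b where b: "Poly_Mapping.lookup g b \<noteq> 0" "\<And>k. Poly_Mapping.lookup g k \<noteq> 0 \<Longrightarrow> \<phi> k \<le> \<phi> b"
    using max[OF assms(2)] by blast
  have uniq: "k = a \<and> l = b"
    if "Poly_Mapping.lookup f k \<noteq> 0" "Poly_Mapping.lookup g l \<noteq> 0" "a + b = k + l" for k l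
  proof -
    have "\<phi> k + \<phi> l = \<phi> a + \<phi> b" using that(3) add by metis
    moreover have "\<phi> k \<le> \<phi> a" "\<phi> l \<le> \<phi> b" using a(2) b(2) that by auto
    ultimately have "\<phi> k = \<phi> a" "\<phi> l = \<phi> b"
      by (metis add_le_cancel_left add_le_cancel_right antisym add_right_mono add_left_mono)+
    then show ?thesis using inj by blast
  qed
  have "Poly_Mapping.lookup (f * g) (a + b) =
      (\<Sum>(k, l). Poly_Mapping.lookup f k * Poly_Mapping.lookup g l when a + b = k + l)"
    by (simp add: times_poly_mapping.rep_eq prod_fun_unfold_prod)
  also have "\<dots> = (\<Sum>(k, l)\<in>{(a, b)}. Poly_Mapping.lookup f k * Poly_Mapping.lookup g l when a + b = k + l)"
    by (rule Sum_any.expand_superset) (use uniq in \<open>auto simp: when_def split: if_splits\<close>)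
  also have "\<dots> = Poly_Mapping.lookup f a * Poly_Mapping.lookup g b" by simp
  finally show ?thesis using a(1) b(1) by (metis lookup_zero no_zero_divisors)
qed

instantiation laurent :: (finite) idom
begin

lift_definition zero_laurent :: "'a laurent" is 0 .
lift_definition one_laurent :: "'a laurent" is 1 .
lift_definition plus_laurent :: "'a laurent \<Rightarrow> 'a laurent \<Rightarrow> 'a laurent" is "(+)" .
lift_definition minus_laurent :: "'a laurent \<Rightarrow> 'a laurent \<Rightarrow> 'a laurent" is "(-)" .
lift_definition uminus_laurent :: "'a laurent \<Rightarrow> 'a laurent" is uminus .
lift_definition times_laurent :: "'a laurent \<Rightarrow> 'a laurent \<Rightarrow> 'a laurent" is "(*)" .

instance
proof
  show "a * b \<noteq> 0" if "a \<noteq> 0" "b \<noteq> 0" for a b :: "'a laurent"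
    using that by transfer (rule laurent_no_zero_divisors)
qed (transfer; simp add: algebra_simps)+

end

type_synonym 'n function_field = "'n laurent fract"


section \<open>The toric variety of a fan\<close>

text \<open>
  The coordinate ring of the affine chart of a cone \<open>\<sigma>\<close> is the algebra of the semigroup of lattice
  points of its dual cone.
\<close>

definition dual_semigroup :: "(real ^ 'n) set \<Rightarrow> (int ^ 'n) set" where
  "dual_semigroup \<sigma> = {m. \<forall>u\<in>\<sigma>. 0 \<le> (\<Sum>i\<in>UNIV. real_of_int (m $ i) * u $ i)}"

definition coord_ring :: "(real ^ 'n) set \<Rightarrow> 'n laurent ring" where
  "coord_ring \<sigma> =
     \<lparr>carrier = {f. Poly_Mapping.keys (laurent_coeffs f) \<subseteq> dual_semigroup \<sigma>},
      mult = (*), one = 1, zero = 0, add = (+)\<rparr>"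

definition Spec :: "(real ^ 'n) set \<Rightarrow> 'n laurent set set" where
  "Spec \<sigma> = {p. primeideal p (coord_ring \<sigma>)}"

text \<open>
  The variety is the scheme obtained by gluing the charts \<open>Spec \<sigma>\<close> and \<open>Spec \<sigma>'\<close> along
  \<open>Spec (\<sigma> \<inter> \<sigma>')\<close>; the open immersions into the two charts are contraction of primes.
\<close>

type_synonym 'n chart_point = "(real ^ 'n) set \<times> 'n laurent set"

definition gluing :: "(real ^ 'n) set set \<Rightarrow> ('n chart_point \<times> 'n chart_point) set" where
  "gluing \<Sigma> =
     {((\<sigma>, p), (\<sigma>', p')) | \<sigma> p \<sigma>' p'.
        \<sigma> \<in> \<Sigma> \<and> \<sigma>' \<in> \<Sigma> \<and> p \<in> Spec \<sigma> \<and> p' \<in> Spec \<sigma>' \<and>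
        (\<exists>q\<in>Spec (\<sigma> \<inter> \<sigma>').
           p = q \<inter> carrier (coord_ring \<sigma>) \<and> p' = q \<inter> carrier (coord_ring \<sigma>'))}"

definition toric_points :: "(real ^ 'n) set set \<Rightarrow> 'n chart_point set set" where
  "toric_points \<Sigma> = (SIGMA \<sigma>:\<Sigma>. Spec \<sigma>) // gluing \<Sigma>"

text \<open>
  A set of points is open if its preimage in each chart is Zariski open, that is, the complement
  of the set of primes containing some set \<open>T\<close> of regular functions.
\<close>

definition toric_open :: "(real ^ 'n) set set \<Rightarrow> 'n chart_point set set \<Rightarrow> bool" where
  "toric_open \<Sigma> U \<longleftrightarrow> U \<subseteq> toric_points \<Sigma> \<and>
     (\<forall>\<sigma>\<in>\<Sigma>. \<exists>T \<subseteq> carrier (coord_ring \<sigma>).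
        {p \<in> Spec \<sigma>. gluing \<Sigma> `` {(\<sigma>, p)} \<in> U} = {p \<in> Spec \<sigma>. \<not> T \<subseteq> p})"

text \<open>
  The local ring of a point, as a subring of the function field. All representatives
  \<open>(\<sigma>, p)\<close> of the point give the same localization, so the union is that localization.
\<close>

definition local_ring :: "('n :: finite) chart_point set \<Rightarrow> 'n function_field set" where
  "local_ring x = (\<Union>(\<sigma>, p)\<in>x.
     {Fract a b | a b. a \<in> carrier (coord_ring \<sigma>) \<and> b \<in> carrier (coord_ring \<sigma>) - p})"

definition local_units :: "('n :: finite) chart_point set \<Rightarrow> 'n function_field set" where
  "local_units x = {u \<in> local_ring x. u \<noteq> 0 \<and> inverse u \<in> local_ring x}"


section \<open>The Picard group\<close>

text \<open>
  A Cartier divisor on an integral scheme with structure sheaf O and function field K is a global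
  section of the quotient sheaf of K* by O*: a family of cosets \<open>D x\<close> of the units of the local
  rings which, locally on the scheme, is given by a single nonzero rational function.
  The Picard group is the group of Cartier divisors modulo the principal ones.
\<close>

definition principal_divisor ::
    "(real ^ 'n) set set \<Rightarrow> 'n function_field \<Rightarrow> 'n chart_point set \<Rightarrow> 'n function_field set" where
  "principal_divisor \<Sigma> f = (\<lambda>x\<in>toric_points \<Sigma>. (*) f ` local_units x)"

definition cartier_group ::
    "(real ^ 'n) set set \<Rightarrow> ('n chart_point set \<Rightarrow> 'n function_field set) monoid" where
  "cartier_group \<Sigma> =
     \<lparr>carrier = {D \<in> extensional (toric_points \<Sigma>).
        \<forall>x\<in>toric_points \<Sigma>. \<exists>U f. toric_open \<Sigma> U \<and> x \<in> U \<and> f \<noteq> 0 \<and>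
          (\<forall>y\<in>U. D y = principal_divisor \<Sigma> f y)},
      mult = (\<lambda>D E. \<lambda>x\<in>toric_points \<Sigma>. {a * b | a b. a \<in> D x \<and> b \<in> E x}),
      one = principal_divisor \<Sigma> 1\<rparr>"

definition picard_group ::
    "(real ^ 'n) set set \<Rightarrow> ('n chart_point set \<Rightarrow> 'n function_field set) set monoid" where
  "picard_group \<Sigma> = cartier_group \<Sigma> Mod (principal_divisor \<Sigma> ` (- {0}))"

text \<open>
  The rank of an abelian group, written multiplicatively: the largest number of elements that are
  linearly independent over the integers (\<open>\<infinity>\<close> if there is no largest one).
\<close>

definition int_independent :: "('a, 'b) monoid_scheme \<Rightarrow> 'a set \<Rightarrow> bool" where
  "int_independent G B \<longleftrightarrow>
     (\<forall>c :: 'a \<Rightarrow> int. finprod G (\<lambda>b. b [^]\<^bsub>G\<^esub> c b) B = \<one>\<^bsub>G\<^esub> \<longrightarrow> (\<forall>b\<in>B. c b = 0))"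

definition group_rank :: "('a, 'b) monoid_scheme \<Rightarrow> enat" where
  "group_rank G = (SUP B\<in>{B. finite B \<and> B \<subseteq> carrier G \<and> int_independent G B}. enat (card B))"

definition picard_rank :: "(real ^ 'n) set set \<Rightarrow> enat" where
  "picard_rank \<Sigma> = group_rank (picard_group \<Sigma>)"

end

theory Submission
  imports Defs
begin

text \<open>
  A Cartier divisor on \<open>X\<close> is principal on the torus, because Laurent polynomials form a factorial ring;
  after subtracting a principal divisor it is therefore given near the fixed point of every maximal
  cone \<open>\<sigma>\<close> by a character \<open>m\<^sub>\<sigma>\<close>, where \<open>m\<^sub>\<sigma>\<close> and \<open>m\<^sub>\<tau>\<close> agree on the common vertices of \<open>\<sigma>\<close> and \<open>\<tau>\<close>
  (look at the generic points of the corresponding torus-invariant prime divisors). By normality the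
  divisor is trivial if all \<open>m\<^sub>\<sigma>\<close> vanish, and it is principal if all \<open>m\<^sub>\<sigma>\<close> coincide. Following a facet
  sequence, \<open>m\<^sub>\<sigma>\<close> is determined by the earlier ones in a step of cost 0, and up to one integer parameter
  in a step of cost 1. Hence more than \<open>\<rho>\<^sub>L\<close> divisor classes satisfy a linear relation.

  For the second inequality one orders the facets such that each of them meets an earlier one in a
  ridge; this is possible since a generic path on the boundary of \<open>P\<close> only crosses faces of
  codimension at most one in the boundary.
\<close>

section \<open>Supports and gradings of Laurent polynomials\<close>

text \<open>Two devices carry the algebra. The first is the initial form: for an additive weight on
  exponents, the lowest part of a product is the product of the lowest parts, so \<open>low\<close>
  is a valuation. At a vertex it is the order along a torus-invariant divisor; at a coordinate and
  its negative it replaces the degree, which gives the Gauss lemma and Euclid's algorithm. The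
  second is specialization: a divisor is a coset of units at every scheme point, and a local
  equation at p stays valid at each prime contained in p. Comparing two equations thus means testing
  whether a quotient is a unit, and this is tested at points of codimension one. For the bound only
  a relation between classes has to be found. In a step of cost 1 the common vertices span a
  hyperplane through 0 that misses some \<open>axis k 1\<close>; a character vanishing on them is
  determined by its k-th coordinate. So each such step costs one integer linear equation, and with
  more classes than equations there is a nonzero solution. Its data agree on all maximal cones,
  which is the case of the principal divisor of a character.\<close>

definition coeff :: "'n::finite laurent \<Rightarrow> int ^ 'n \<Rightarrow> complex" where
  "coeff f m = Poly_Mapping.lookup (laurent_coeffs f) m"

definition supp :: "'n::finite laurent \<Rightarrow> (int ^ 'n) set" where
  "supp f = {m. coeff f m \<noteq> 0}"

definition monom :: "int ^ 'n \<Rightarrow> 'n::finite laurent" where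
  "monom m = Laurent (Poly_Mapping.single m 1)"

definition restr :: "(int ^ 'n) set \<Rightarrow> 'n::finite laurent \<Rightarrow> 'n laurent" where
  "restr A f = Laurent (Abs_poly_mapping (\<lambda>m. coeff f m when m \<in> A))"

lemma supp_keys: "supp f = Poly_Mapping.keys (laurent_coeffs f)"
  by (auto simp: supp_def coeff_def in_keys_iff)

lemma finite_supp [simp]: "finite (supp f)"
  by (simp add: supp_keys)

lemma laurent_eqI: "(\<And>m. coeff f m = coeff g m) \<Longrightarrow> f = g"
  unfolding coeff_def by (metis laurent_coeffs_inject poly_mapping_eqI)

lemma coeff_add [simp]: "coeff (f + g) m = coeff f m + coeff g m"
  by (simp add: coeff_def plus_laurent.rep_eq lookup_add)

lemma coeff_diff [simp]: "coeff (f - g) m = coeff f m - coeff g m"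
  by (simp add: coeff_def minus_laurent.rep_eq lookup_minus)

lemma coeff_0 [simp]: "coeff 0 m = 0"
  by (simp add: coeff_def zero_laurent.rep_eq)

lemma coeff_restr [simp]: "coeff (restr A f) m = (if m \<in> A then coeff f m else 0)"
proof -
  have "finite {m. (coeff f m when m \<in> A) \<noteq> 0}"
    by (rule finite_subset[OF _ finite_supp[of f]]) (auto simp: supp_def when_def)
  then have "Poly_Mapping.lookup (Abs_poly_mapping (\<lambda>m. coeff f m when m \<in> A)) m
      = (coeff f m when m \<in> A)"
    by simp
  then show ?thesis
    unfolding restr_def coeff_def[of "Laurent _"] by (simp add: Laurent_inverse when_def)
qed

lemma coeff_monom: "coeff (monom k) m = (if m = k then 1 else 0)"
  by (simp add: coeff_def monom_def Laurent_inverse lookup_single when_def)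

lemma supp_0 [simp]: "supp 0 = {}"
  by (simp add: supp_def)

lemma supp_eq_empty [simp]: "supp f = {} \<longleftrightarrow> f = 0"
  by (auto simp: supp_def intro: laurent_eqI)

lemma supp_add: "supp (f + g) \<subseteq> supp f \<union> supp g"
  by (auto simp: supp_def)

lemma supp_diff: "supp (f - g) \<subseteq> supp f \<union> supp g"
  by (auto simp: supp_def)

lemma supp_mult: "supp (f * g) \<subseteq> {k + l | k l. k \<in> supp f \<and> l \<in> supp g}"
  unfolding supp_keys times_laurent.rep_eq by (rule keys_mult)

lemma supp_multE:
  assumes "m \<in> supp (f * g)"
  obtains k l where "m = k + l" "k \<in> supp f" "l \<in> supp g"
  using assms supp_mult by blast

lemma supp_restr [simp]: "supp (restr A f) = supp f \<inter> A"
  by (auto simp: supp_def)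

lemma supp_monom [simp]: "supp (monom m) = {m}"
  by (auto simp: supp_def coeff_monom)

lemma supp_1 [simp]: "supp (1 :: 'n::finite laurent) = {0}"
  by (simp add: supp_keys one_laurent.rep_eq)

lemma monom_0 [simp]: "monom 0 = 1"
  unfolding monom_def one_laurent_def by simp

lemma monom_add: "monom (m + k) = monom m * monom k"
  by (metis (no_types, lifting) Laurent_inverse UNIV_I laurent_coeffs_inject monom_def mult_1
      mult_single times_laurent.rep_eq)

lemma monom_nz [simp]: "monom m \<noteq> 0"
  using supp_monom supp_eq_empty by blast

lemma monom_uminus: "monom (- m) * monom m = 1" "monom m * monom (- m) = 1"
  using monom_add[of "-m" m] monom_add[of m "-m"] by auto

lemma supp_monom_mult: "supp (monom m * f) = (+) m ` supp f"
proof -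
  have 1: "supp (monom m * f) \<subseteq> (+) m ` supp f" for m :: "int ^ 'a" and f
    using supp_mult[of "monom m" f] by auto
  have "monom (-m) * (monom m * f) = f"
    by (simp add: mult.assoc[symmetric] monom_uminus)
  then have 2: "supp f \<subseteq> (+) (-m) ` supp (monom m * f)"
    using 1[of "-m" "monom m * f"] by (simp only:)
  have "(+) m ` supp f \<subseteq> supp (monom m * f)"
  proof
    fix x assume "x \<in> (+) m ` supp f"
    then obtain y where "y \<in> supp f" "x = m + y" by auto
    with 2 obtain z where "z \<in> supp (monom m * f)" "y = - m + z" by auto
    then show "x \<in> supp (monom m * f)" using \<open>x = m + y\<close> by simp
  qed
  with 1 show ?thesis by blast
qed

lemma restr_diff: "restr A (f - g) = restr A f - restr A g"
  and restr_add: "restr A (f + g) = restr A f + restr A g"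
  by (rule laurent_eqI; simp)+

lemma restr_id: "supp f \<subseteq> A \<Longrightarrow> restr A f = f"
  by (rule laurent_eqI) (auto simp: supp_def)

lemma restr_disjoint: "supp f \<inter> A = {} \<Longrightarrow> restr A f = 0"
  by (rule laurent_eqI) (auto simp: supp_def)

text \<open>Splitting off the parts outside A and B, the remaining products have no exponent in
  C.\<close>

lemma restr_mult:
  assumes "\<And>k l. k \<in> supp f \<Longrightarrow> l \<in> supp g \<Longrightarrow> k + l \<in> C \<longleftrightarrow> k \<in> A \<and> l \<in> B"
  shows "restr C (f * g) = restr A f * restr B g"
proof -
  define f' g' where "f' = f - restr A f" and "g' = g - restr B g"
  have s: "supp f' \<subseteq> supp f - A" "supp g' \<subseteq> supp g - B"
    by (auto simp: f'_def g'_def supp_def split: if_splits)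
  have "f * g = restr A f * restr B g + (restr A f * g' + f' * g)"
    by (simp add: f'_def g'_def algebra_simps)
  then have "restr C (f * g) = restr C (restr A f * restr B g) + (restr C (restr A f * g') + restr C (f' * g))"
    by (simp add: restr_add)
  moreover have "restr C (restr A f * restr B g) = restr A f * restr B g"
    by (rule restr_id) (use assms in \<open>auto elim!: supp_multE\<close>)
  moreover have "restr C (restr A f * g') = 0" "restr C (f' * g) = 0"
    by (rule restr_disjoint; use assms s in \<open>auto elim!: supp_multE\<close>)+
  ultimately show ?thesis by simp
qed

lemma restr_mult_left:
  assumes "\<And>k l. k \<in> supp f \<Longrightarrow> l \<in> supp g \<Longrightarrow> k + l \<in> C \<longleftrightarrow> l \<in> B"
  shows "restr C (f * g) = f * restr B g"
  using restr_mult[of f g C UNIV B] assms by (simp add: restr_id)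

text \<open>The valuation of a weight. For 0 the minimum runs over the empty set and has no meaning,
  hence the hypotheses \<open>f \<noteq> 0\<close> below.\<close>

definition low :: "(int ^ 'n \<Rightarrow> 'b) \<Rightarrow> 'n::finite laurent \<Rightarrow> 'b::linordered_ab_group_add" where
  "low \<phi> f = Min (\<phi> ` supp f)"

lemma low_le: "m \<in> supp f \<Longrightarrow> low \<phi> f \<le> \<phi> m"
  by (simp add: low_def)

lemma low_attained:
  assumes "f \<noteq> 0"
  obtains m where "m \<in> supp f" "\<phi> m = low \<phi> f"
proof -
  have "Min (\<phi> ` supp f) \<in> \<phi> ` supp f"
    by (rule Min_in) (use assms in auto)
  then show ?thesis using that by (auto simp: low_def)
qed

lemma low_ge: "f \<noteq> 0 \<Longrightarrow> (\<And>m. m \<in> supp f \<Longrightarrow> c \<le> \<phi> m) \<Longrightarrow> c \<le> low \<phi> f"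
  by (metis low_attained)

text \<open>Two weights that are bounded below add up to the sum of the bounds only if both are
  minimal.\<close>

lemma restr_low_mult:
  assumes "f \<noteq> 0" "g \<noteq> 0" and add: "\<And>k l. \<phi> (k + l) = \<phi> k + \<phi> l"
  shows "restr {m. \<phi> m = low \<phi> f + low \<phi> g} (f * g)
    = restr {m. \<phi> m = low \<phi> f} f * restr {m. \<phi> m = low \<phi> g} g"
proof (rule restr_mult)
  fix k l assume "k \<in> supp f" "l \<in> supp g"
  then have "low \<phi> f \<le> \<phi> k" "low \<phi> g \<le> \<phi> l"
    by (auto simp: low_le)
  then show "k + l \<in> {m. \<phi> m = low \<phi> f + low \<phi> g} \<longleftrightarrow> k \<in> {m. \<phi> m = low \<phi> f} \<and> l \<in> {m. \<phi> m = low \<phi> g}"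
    unfolding mem_Collect_eq add by (metis add_le_cancel_left add_le_cancel_right antisym add_mono)
qed

lemma restr_low_nz:
  assumes "f \<noteq> 0" shows "restr {m. \<phi> m = low \<phi> f} f \<noteq> 0"
proof -
  obtain m where "m \<in> supp f" "\<phi> m = low \<phi> f" using low_attained[OF assms] by metis
  then have "m \<in> supp (restr {m. \<phi> m = low \<phi> f} f)" by simp
  then show ?thesis by force
qed

text \<open>Nothing cancels in lowest weight, because the product of the two nonzero initial forms
  is nonzero in a domain.\<close>

lemma low_mult:
  assumes "f \<noteq> 0" "g \<noteq> 0" and add: "\<And>k l. \<phi> (k + l) = \<phi> k + \<phi> l"
  shows "low \<phi> (f * g) = low \<phi> f + low \<phi> g"
proof (rule antisym)
  have "restr {m. \<phi> m = low \<phi> f + low \<phi> g} (f * g) \<noteq> 0"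
    using restr_low_mult[OF assms] restr_low_nz assms by (metis mult_eq_0_iff)
  then obtain m where "m \<in> supp (f * g)" "\<phi> m = low \<phi> f + low \<phi> g"
    using supp_eq_empty by (metis (mono_tags, lifting) IntE ex_in_conv mem_Collect_eq supp_restr)
  then show "low \<phi> (f * g) \<le> low \<phi> f + low \<phi> g"
    by (metis low_le)
  show "low \<phi> f + low \<phi> g \<le> low \<phi> (f * g)"
    by (rule low_ge) (use assms in \<open>auto simp: add low_le add_mono elim!: supp_multE\<close>)
qed

lemma low_monom [simp]: "low \<phi> (monom m) = \<phi> m"
  by (simp add: low_def)

lemma low_1 [simp]: "low \<phi> 1 = \<phi> 0"
  by (simp add: low_def)


section \<open>Laurent polynomials form a factorial ring\<close>

text \<open>Highest minus lowest exponent of the variable i. Unlike the degree it does not change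
  under multiplication by monomials, which are units here.\<close>

definition width :: "'n \<Rightarrow> 'n::finite laurent \<Rightarrow> int" where
  "width i f = - low (\<lambda>m. - (m $ i)) f - low (\<lambda>m. m $ i) f"

text \<open>Additive on products and positive on nonunits, hence the measure for all inductions over
  factorizations.\<close>

definition size_laurent :: "'n::finite laurent \<Rightarrow> nat" where
  "size_laurent f = nat (\<Sum>i\<in>UNIV. width i f)"

lemma width_mult: "f \<noteq> 0 \<Longrightarrow> g \<noteq> 0 \<Longrightarrow> width i (f * g) = width i f + width i g"
  by (simp add: width_def low_mult)

lemma low_high: "m \<in> supp f \<Longrightarrow> low (\<lambda>m. m $ i) f \<le> m $ i"
  "m \<in> supp f \<Longrightarrow> m $ i \<le> - low (\<lambda>m. - (m $ i)) f"
  using low_le[of m f "\<lambda>m. m $ i"] low_le[of m f "\<lambda>m. - (m $ i)"] by auto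

lemma width_nonneg: "f \<noteq> 0 \<Longrightarrow> 0 \<le> width i f"
  using low_high[of _ f i] low_attained[of f] unfolding width_def by (metis diff_ge_0_iff_ge order_trans)

lemma width_ge: "k \<in> supp f \<Longrightarrow> l \<in> supp f \<Longrightarrow> k $ i - l $ i \<le> width i f"
  using low_high(2)[of k f i] low_high(1)[of l f i] by (simp add: width_def)

lemma size_mult: "f \<noteq> 0 \<Longrightarrow> g \<noteq> 0 \<Longrightarrow> size_laurent (f * g) = size_laurent f + size_laurent g"
  unfolding size_laurent_def
  by (simp add: width_mult sum.distrib nat_add_distrib sum_nonneg width_nonneg)

text \<open>The support is then a single exponent, so f is a nonzero scalar times a
  monomial.\<close>

lemma dvd_1_if_width_0:
  assumes "f \<noteq> 0" "\<And>i. width i f = 0" shows "f dvd 1"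
proof -
  obtain m where m: "m \<in> supp f" using assms(1) by force
  have "k = m" if "k \<in> supp f" for k
  proof -
    have "k $ i = m $ i" for i
      using width_ge[OF that m, of i] width_ge[OF m that, of i] assms(2)[of i] by auto
    then show ?thesis by (simp add: vec_eq_iff)
  qed
  then have s: "supp f = {m}" using m by blast
  define g where "g = Laurent (Poly_Mapping.single (-m) (inverse (coeff f m)))"
  have "laurent_coeffs f = Poly_Mapping.single m (coeff f m)"
    by (rule poly_mapping_eqI) (use s in \<open>auto simp: coeff_def supp_def lookup_single when_def\<close>)
  then have "laurent_coeffs (f * g) = Poly_Mapping.single 0 1"
    using m by (simp add: times_laurent.rep_eq g_def Laurent_inverse mult_single supp_def)
  then have "f * g = 1"
    by (metis laurent_coeffs_inject one_laurent.rep_eq single_one)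
  then show ?thesis by (metis dvd_triv_left)
qed

lemma size_pos:
  assumes "f \<noteq> 0" "\<not> f dvd 1" shows "0 < size_laurent f"
proof -
  obtain i where "width i f \<noteq> 0" using dvd_1_if_width_0 assms by blast
  then have "0 < (\<Sum>i\<in>UNIV. width i f)"
    using width_nonneg[OF assms(1)] by (intro sum_pos2[of _ i]) (auto simp: less_le)
  then show ?thesis by (simp add: size_laurent_def)
qed

lemma size_dvd_less:
  assumes "f = a * b" "f \<noteq> 0" "\<not> a dvd 1" shows "size_laurent b < size_laurent f"
  using assms size_pos[of a] size_mult[of a b] by auto

lemma irreducible_divisor:
  fixes f :: "'n::finite laurent"
  assumes "f \<noteq> 0" "\<not> f dvd 1" shows "\<exists>g. irreducible g \<and> g dvd f"
  using assms
proof (induction "size_laurent f" arbitrary: f rule: less_induct)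
  case less
  show ?case
  proof (cases "irreducible f")
    case False
    then obtain a b where ab: "f = a * b" "\<not> a dvd 1" "\<not> b dvd 1"
      using less.prems by (auto simp: irreducible_def)
    then have "\<exists>g. irreducible g \<and> g dvd b"
      using less size_dvd_less by (metis mult_zero_right)
    then show ?thesis using ab by auto
  qed auto
qed

section \<open>Subrings in fewer variables, and factoriality by adjoining one variable at a
  time\<close>

definition vars :: "'n set \<Rightarrow> 'n::finite laurent set" where
  "vars J = {f. \<forall>m\<in>supp f. \<forall>i. i \<notin> J \<longrightarrow> m $ i = 0}"

lemma vars_mult: "f \<in> vars J \<Longrightarrow> g \<in> vars J \<Longrightarrow> f * g \<in> vars J"
  by (auto simp: vars_def elim!: supp_multE)

lemma vars_add: "f \<in> vars J \<Longrightarrow> g \<in> vars J \<Longrightarrow> f + g \<in> vars J"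
  using supp_add[of f g] by (auto simp: vars_def)

lemma vars_diff: "f \<in> vars J \<Longrightarrow> g \<in> vars J \<Longrightarrow> f - g \<in> vars J"
  using supp_diff[of f g] by (auto simp: vars_def)

lemma vars_mono: "J \<subseteq> K \<Longrightarrow> vars J \<subseteq> vars K"
  by (auto simp: vars_def)

lemma vars_0 [simp]: "0 \<in> vars J" and vars_1 [simp]: "1 \<in> vars J"
  by (auto simp: vars_def)

lemma vars_restr: "f \<in> vars J \<Longrightarrow> restr A f \<in> vars J"
  by (auto simp: vars_def)

lemma vars_monom: "(\<And>i. i \<notin> J \<Longrightarrow> m $ i = 0) \<Longrightarrow> monom m \<in> vars J"
  by (auto simp: vars_def)

lemma vars_low:
  assumes "f \<in> vars J" "f \<noteq> 0" "i \<notin> J"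
  shows "low (\<lambda>m. m $ i) f = 0" "low (\<lambda>m. - (m $ i)) f = 0" "width i f = 0"
proof -
  obtain m where "m \<in> supp f" "m $ i = low (\<lambda>m. m $ i) f"
    using low_attained[OF assms(2)] by metis
  then show 1: "low (\<lambda>m. m $ i) f = 0" using assms by (auto simp: vars_def)
  obtain m where "m \<in> supp f" "- (m $ i) = low (\<lambda>m. - (m $ i)) f"
    using low_attained[OF assms(2)] by (metis (lifting))
  then show 2: "low (\<lambda>m. - (m $ i)) f = 0" using assms by (auto simp: vars_def)
  show "width i f = 0" by (simp add: width_def 1 2)
qed

text \<open>Extreme exponents add up in products; for the variables outside J they are 0 in f and in
  the product, hence also in the cofactor.\<close>

lemma vars_quotient:
  assumes "f \<in> vars J" "f \<noteq> 0" "f * k \<in> vars J" shows "k \<in> vars J"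
proof (cases "k = 0")
  case False
  have "m $ i = 0" if "m \<in> supp k" "i \<notin> J" for m i
  proof -
    have "low (\<lambda>m. m $ i) k = 0" "low (\<lambda>m. - (m $ i)) k = 0"
      using low_mult[of f k "\<lambda>m. m $ i"] low_mult[of f k "\<lambda>m. - (m $ i)"]
        vars_low[OF assms(1,2) that(2)] vars_low[OF assms(3) _ that(2)] False assms by auto
    then show ?thesis using low_high[OF that(1), of i] by auto
  qed
  then show ?thesis by (auto simp: vars_def)
qed auto

text \<open>Width 0 means a constant exponent, which a monomial shifts to 0.\<close>

lemma vars_normalize:
  assumes "a \<noteq> 0" "\<And>i. i \<notin> J \<Longrightarrow> width i a = 0"
  obtains m where "monom m * a \<in> vars J"
proof -
  obtain k where k: "k \<in> supp a" using assms(1) by force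
  define m where "m = (\<chi> i. if i \<in> J then 0 else - (k $ i))"
  have "x $ i = 0" if x: "x \<in> supp (monom m * a)" and i: "i \<notin> J" for x i
  proof -
    obtain l where l: "l \<in> supp a" "x = m + l" using x by (auto simp: supp_monom_mult)
    show ?thesis
      using width_ge[OF l(1) k, of i] width_ge[OF k l(1), of i] assms(2)[OF i] i by (simp add: m_def l(2))
  qed
  then have "monom m * a \<in> vars J" by (auto simp: vars_def)
  then show ?thesis using that by blast
qed

lemma vars_divisor:
  assumes "f \<in> vars J" "f \<noteq> 0" "a dvd f"
  obtains m where "monom m * a \<in> vars J"
proof -
  obtain b where b: "f = a * b" using assms by auto
  have "width i a = 0" if "i \<notin> J" for i
    using vars_low(3)[OF assms(1,2) that] width_mult[of a b i] width_nonneg[of a i] width_nonneg[of b i] b assms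
    by force
  moreover have "a \<noteq> 0" using assms by auto
  ultimately show ?thesis using vars_normalize[of a J] that by blast
qed

lemma dvd_monom_mult: "a dvd monom m * b \<longleftrightarrow> a dvd b"
proof
  assume "a dvd monom m * b"
  then have "a dvd monom (- m) * (monom m * b)" by (rule dvd_mult)
  then show "a dvd b" by (simp add: mult.assoc[symmetric] monom_uminus)
qed (rule dvd_mult)

lemma monom_mult_dvd: "monom m * a dvd b \<longleftrightarrow> a dvd b"
proof
  assume "a dvd b"
  then have "monom m * a dvd monom m * (monom (- m) * b)"
    by (intro mult_dvd_mono) (auto simp: dvd_monom_mult)
  then show "monom m * a dvd b" by (simp add: mult.assoc[symmetric] monom_uminus)
qed (rule dvd_mult_right)

lemma irreducible_monom_mult:
  fixes a :: "'n::finite laurent"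
  assumes "irreducible a" shows "irreducible (monom m * a)"
  using assms by (rule irreducible_mono) (use assms in \<open>auto simp: monom_mult_dvd irreducible_def\<close>)

lemma irreducible_divisor_vars:
  assumes "f \<in> vars J" "f \<noteq> 0" "\<not> f dvd 1"
  shows "\<exists>g. irreducible g \<and> g dvd f \<and> g \<in> vars J"
  by (metis assms irreducible_divisor irreducible_monom_mult monom_mult_dvd vars_divisor)

text \<open>The induction hypothesis over the set of variables. Irreducibility and divisibility
  refer to the full ring; by \<open>vars_quotient\<close> the cofactors stay in the subring.\<close>

definition primes_on :: "'n::finite set \<Rightarrow> bool" where
  "primes_on J \<longleftrightarrow> (\<forall>p\<in>vars J. irreducible p \<longrightarrow>
     (\<forall>g\<in>vars J. \<forall>h\<in>vars J. p dvd g * h \<longrightarrow> p dvd g \<or> p dvd h))"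

definition primitive_over :: "'n::finite set \<Rightarrow> 'n laurent \<Rightarrow> bool" where
  "primitive_over J f \<longleftrightarrow> (\<forall>p\<in>vars J. irreducible p \<longrightarrow> \<not> p dvd f)"

text \<open>This is the coefficient of the j-th power of the variable i, viewed as an element of the
  smaller ring.\<close>

lemma restr_coord_vars:
  assumes "g \<in> vars (insert i J)"
  shows "monom (axis i (- j)) * restr {m. m $ i = j} g \<in> vars J"
  using assms by (auto simp: vars_def supp_monom_mult axis_def)

text \<open>Gauss's lemma. The lowest coefficients of g and h in the variable i have a product
  divisible by p, so p divides one of them. Subtracting that initial form from its factor keeps the
  divisibility and shortens the support.\<close>

lemma prime_on_insert:
  assumes "primes_on J" "i \<notin> J" "p \<in> vars J" "irreducible p"
  shows "g \<in> vars (insert i J) \<Longrightarrow> h \<in> vars (insert i J) \<Longrightarrow> p dvd g * h \<Longrightarrow> p dvd g \<or> p dvd h"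
proof (induction "card (supp g) + card (supp h)" arbitrary: g h rule: less_induct)
  case less
  show ?case
  proof (cases "g = 0 \<or> h = 0")
    case False
    define j k where "j = low (\<lambda>m. m $ i) g" and "k = low (\<lambda>m. m $ i) h"
    define g' h' where "g' = restr {m. m $ i = j} g" and "h' = restr {m. m $ i = k} h"
    have step: "card (supp (f - restr {m. m $ i = low (\<lambda>m. m $ i) f} f)) < card (supp f)"
      if f: "f \<noteq> 0" for f :: "'a laurent"
    proof -
      obtain m where "m \<in> supp f" "m $ i = low (\<lambda>m. m $ i) f" using low_attained[OF f] by metis
      then have "supp (f - restr {m. m $ i = low (\<lambda>m. m $ i) f} f) \<subseteq> supp f - {m}"
        by (auto simp: supp_def split: if_splits)
      with \<open>m \<in> supp f\<close> show ?thesis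
        by (intro psubset_card_mono) auto
    qed
    obtain u where u: "g * h = p * u" using less.prems by auto
    have "g' * h' = restr {m. m $ i = j + k} (g * h)"
      using restr_low_mult[of g h "\<lambda>m. m $ i"] False by (simp add: g'_def h'_def j_def k_def)
    also have "\<dots> = p * restr {m. m $ i = j + k} u"
      unfolding u using assms(2,3) by (intro restr_mult_left) (auto simp: vars_def)
    finally have "p dvd monom (axis i (- j)) * (monom (axis i (- k)) * (g' * h'))"
      by (simp add: dvd_monom_mult)
    then have "p dvd (monom (axis i (- j)) * g') * (monom (axis i (- k)) * h')"
      by (simp add: mult_ac)
    then have "p dvd monom (axis i (- j)) * g' \<or> p dvd monom (axis i (- k)) * h'"
      using assms(1,3,4) restr_coord_vars[OF less.prems(1), of j] restr_coord_vars[OF less.prems(2), of k]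
      unfolding primes_on_def g'_def h'_def by blast
    then have "p dvd g' \<or> p dvd h'" by (simp add: dvd_monom_mult)
    moreover have "p dvd f \<or> p dvd f2" if dvd: "p dvd restr {m. m $ i = low (\<lambda>m. m $ i) f} f"
      and f: "f \<in> vars (insert i J)" "f2 \<in> vars (insert i J)" "f \<noteq> 0" "p dvd f * f2"
        "card (supp f) + card (supp f2) = card (supp g) + card (supp h)" for f f2
    proof -
      define f' where "f' = restr {m. m $ i = low (\<lambda>m. m $ i) f} f"
      have "p dvd (f - f') * f2"
        unfolding left_diff_distrib using dvd f(4) by (intro dvd_diff) (auto simp: f'_def)
      moreover have "f - f' \<in> vars (insert i J)" unfolding f'_def using f(1) by (intro vars_diff vars_restr)
      ultimately have "p dvd f - f' \<or> p dvd f2"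
        using less.hyps[of "f - f'" f2] step[OF f(3)] f(2,5) by (simp add: f'_def)
      then show ?thesis using dvd_add[of p "f - f'" f'] dvd by (auto simp: f'_def)
    qed
    from this[of g h] this[of h g] have "p dvd g' \<Longrightarrow> ?thesis" "p dvd h' \<Longrightarrow> ?thesis"
      using False less.prems by (auto simp: g'_def h'_def j_def k_def mult.commute add.commute)
    ultimately show ?thesis by blast
  qed auto
qed

text \<open>The prime factors of c are removed one at a time: each stays prime in the larger ring
  and does not divide the primitive f, so it divides g.\<close>

lemma primitive_cancel:
  assumes "primes_on J" "i \<notin> J" "f \<in> vars (insert i J)" "primitive_over J f"
  shows "c \<in> vars J \<Longrightarrow> c \<noteq> 0 \<Longrightarrow> g \<in> vars (insert i J) \<Longrightarrow> c dvd f * g \<Longrightarrow> c dvd g"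
proof (induction "size_laurent c" arbitrary: c g rule: less_induct)
  case less
  show ?case
  proof (cases "c dvd 1")
    case True
    then show ?thesis by (metis dvd_trans one_dvd)
  next
    case False
    then obtain p where p: "irreducible p" "p dvd c" "p \<in> vars J"
      using irreducible_divisor_vars less.prems by metis
    then obtain c' where c': "c = p * c'" by auto
    have "p dvd f * g" using p less.prems by (metis dvd_trans)
    then have "p dvd g"
      using prime_on_insert[OF assms(1,2) p(3,1) assms(3)] less.prems assms(4) p by (auto simp: primitive_over_def)
    then obtain g' where g': "g = p * g'" by auto
    have p0: "p \<noteq> 0" using p by auto
    have "p * c' dvd p * (f * g')" using less.prems(4) by (simp add: c' g' mult_ac)
    then have "c' dvd f * g'" using p0 by simp
    moreover have "c' \<in> vars J" using vars_quotient[OF p(3) p0] less.prems c' by simp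
    moreover have "g' \<in> vars (insert i J)"
      using vars_quotient[of p "insert i J" g'] p(3) p0 less.prems g' vars_mono[of J "insert i J"] by auto
    ultimately have "c' dvd g'"
      using less.hyps[of c' g'] size_dvd_less[OF c'] less.prems p by (auto simp: c' irreducible_def)
    then show ?thesis by (simp add: c' g')
  qed
qed

lemma content_decomp:
  assumes "r \<in> vars (insert i J)" "r \<noteq> 0"
  shows "\<exists>e\<in>vars J. \<exists>r0\<in>vars (insert i J). r = e * r0 \<and> primitive_over J r0"
  using assms
proof (induction "size_laurent r" arbitrary: r rule: less_induct)
  case less
  show ?case
  proof (cases "primitive_over J r")
    case True
    then show ?thesis using less.prems by (intro bexI[of _ 1] bexI[of _ r]) auto
  next
    case False
    then obtain p where p: "p \<in> vars J" "irreducible p" "p dvd r" by (auto simp: primitive_over_def)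
    then obtain r' where r': "r = p * r'" by auto
    have "r' \<in> vars (insert i J)"
      using vars_quotient[of p "insert i J" r'] p less.prems r' vars_mono[of J "insert i J"] by auto
    moreover have "size_laurent r' < size_laurent r"
      by (rule size_dvd_less[OF r']) (use p less.prems in \<open>auto simp: irreducible_def\<close>)
    ultimately obtain e r0 where e: "e \<in> vars J" "r0 \<in> vars (insert i J)" "r' = e * r0" "primitive_over J r0"
      using less.hyps[of r'] less.prems r' by auto
    then show ?thesis using vars_mult[OF p(1) e(1)]
      by (intro bexI[of _ "p * e"] bexI[of _ r0]) (auto simp: r' mult.assoc)
  qed
qed

text \<open>Cross-multiplication with the leading coefficients cancels the top power of the variable
  i. As r is no wider than s, the shifted copy of r does not reach below the lowest exponent of s,
  so the width drops.\<close>

lemma pseudo_division_step: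
  assumes r: "r \<in> vars (insert i J)" "r \<noteq> 0" and s: "s \<in> vars (insert i J)" "s \<noteq> 0"
    and w: "width i r \<le> width i s" and "i \<notin> J"
  obtains a q where "a \<in> vars J" "a \<noteq> 0" "q \<in> vars (insert i J)"
    "a * s - q * r = 0 \<or> width i (a * s - q * r) < width i s"
proof -
  \<comment> \<open>The highest exponents of the variable i in r and s; a and b below are the
    leading coefficients.\<close>
  define hr hs where "hr = - low (\<lambda>m. - (m $ i)) r" and "hs = - low (\<lambda>m. - (m $ i)) s"
  define a where "a = monom (axis i (- hr)) * restr {m. m $ i = hr} r"
  define b where "b = monom (axis i (- hs)) * restr {m. m $ i = hs} s"
  define q where "q = b * monom (axis i (hs - hr))"
  define t where "t = a * s - q * r"
  have ab: "a \<in> vars J" "b \<in> vars J"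
    unfolding a_def b_def using r s by (simp_all add: restr_coord_vars)
  have ab0: "m $ i = 0" if "m \<in> supp a \<or> m \<in> supp b" for m
    using that ab \<open>i \<notin> J\<close> by (auto simp: vars_def)
  have q: "q \<in> vars (insert i J)"
    unfolding q_def using ab vars_mono[of J "insert i J"]
    by (intro vars_mult vars_monom) (auto simp: axis_def)
  have "{m. m $ i = hr} = {m. - (m $ i) = low (\<lambda>m. - (m $ i)) r}" by (auto simp: hr_def)
  then have "restr {m. m $ i = hr} r \<noteq> 0" using restr_low_nz[OF r(2), of "\<lambda>m. - (m $ i)"] by simp
  then have a0: "a \<noteq> 0" by (simp add: a_def)
  have mm: "monom (axis i k) * monom (axis i (- k)) = 1" for k :: int
  proof -
    have "- axis i k = axis i (- k)" by (simp add: axis_def vec_eq_iff)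
    then show ?thesis using monom_uminus(2)[of "axis i k"] by simp
  qed
  have "restr {m. m $ i = hs} (a * s) = a * restr {m. m $ i = hs} s"
    by (rule restr_mult_left) (auto simp: ab0)
  also have "restr {m. m $ i = hs} s = monom (axis i hs) * b"
    using mm[of hs] by (simp add: b_def mult.assoc[symmetric])
  finally have 1: "restr {m. m $ i = hs} (a * s) = monom (axis i hs) * (a * b)"
    by (simp add: mult_ac)
  have qs: "m $ i = hs - hr" if "m \<in> supp q" for m
    using that ab0 by (auto simp: q_def axis_def elim!: supp_multE)
  have "restr {m. m $ i = hs} (q * r) = q * restr {m. m $ i = hr} r"
    by (rule restr_mult_left) (auto simp: qs)
  also have "restr {m. m $ i = hr} r = monom (axis i hr) * a"
    using mm[of hr] by (simp add: a_def mult.assoc[symmetric])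
  also have "q * (monom (axis i hr) * a) = (monom (axis i (hs - hr)) * monom (axis i hr)) * (a * b)"
    by (simp add: q_def mult_ac)
  also have "monom (axis i (hs - hr)) * monom (axis i hr) = monom (axis i hs)"
    unfolding monom_add[symmetric] by (rule arg_cong[of _ _ monom]) (simp add: axis_def vec_eq_iff)
  finally have "restr {m. m $ i = hs} t = 0"
    using 1 by (simp add: t_def restr_diff)
  then have ne: "m $ i \<noteq> hs" if "m \<in> supp t" for m
    using that by (metis (mono_tags, lifting) IntI empty_iff mem_Collect_eq supp_0 supp_restr)
  have r_le: "m $ i \<le> hr \<and> hr - width i r \<le> m $ i" if "m \<in> supp r" for m
    using low_high[OF that, of i] by (auto simp: hr_def width_def)
  have s_le: "m $ i \<le> hs \<and> hs - width i s \<le> m $ i" if "m \<in> supp s" for m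
    using low_high[OF that, of i] by (auto simp: hs_def width_def)
  have bd: "m $ i < hs \<and> hs - width i s \<le> m $ i" if m: "m \<in> supp t" for m
  proof -
    have "m \<in> supp (a * s) \<or> m \<in> supp (q * r)" using m supp_diff by (auto simp: t_def)
    then have "m $ i \<le> hs \<and> hs - width i s \<le> m $ i"
    proof
      assume "m \<in> supp (a * s)"
      then show ?thesis using ab0 s_le by (auto elim!: supp_multE)
    next
      assume "m \<in> supp (q * r)"
      then obtain k l where "m = k + l" "k \<in> supp q" "l \<in> supp r" by (rule supp_multE)
      then show ?thesis using qs[of k] r_le[of l] w by auto
    qed
    with ne[OF m] show ?thesis by auto
  qed
  have "width i t < width i s" if t0: "t \<noteq> 0"
  proof -
    obtain m where m: "m \<in> supp t" "m $ i = low (\<lambda>m. m $ i) t" using low_attained[OF t0] by metis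
    obtain k where k: "k \<in> supp t" "- (k $ i) = low (\<lambda>m. - (m $ i)) t"
      using low_attained[OF t0] by (metis (lifting))
    show ?thesis using bd[OF m(1)] bd[OF k(1)] m(2) k(2) by (simp add: width_def)
  qed
  then show ?thesis using that[OF ab(1) a0 q] by (auto simp: t_def)
qed

text \<open>Euclid's algorithm over the fraction field of the coefficients, with denominators
  cleared: pseudo-division by an element of least width stays inside the ideal I and lowers the
  width of s until the remainder is 0.\<close>

lemma min_width_divides:
  assumes "i \<notin> J" and I: "I \<subseteq> vars (insert i J)"
    and clos: "\<And>a s q r. a \<in> vars (insert i J) \<Longrightarrow> q \<in> vars (insert i J) \<Longrightarrow> s \<in> I \<Longrightarrow> r \<in> I \<Longrightarrow> a * s - q * r \<in> I"
    and r: "r \<in> I" "r \<noteq> 0" and min: "\<And>s. s \<in> I \<Longrightarrow> s \<noteq> 0 \<Longrightarrow> width i r \<le> width i s"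
  shows "s \<in> I \<Longrightarrow> \<exists>c\<in>vars J. c \<noteq> 0 \<and> r dvd c * s"
proof (induction "nat (width i s)" arbitrary: s rule: less_induct)
  case less
  show ?case
  proof (cases "s = 0")
    case True
    then show ?thesis by (intro bexI[of _ 1]) auto
  next
    case False
    obtain a q where aq: "a \<in> vars J" "a \<noteq> 0" "q \<in> vars (insert i J)"
      "a * s - q * r = 0 \<or> width i (a * s - q * r) < width i s"
      using pseudo_division_step[of r i J s] r I less.prems False min[OF less.prems False] assms(1)
      by (metis subsetD)
    define t where "t = a * s - q * r"
    have tI: "t \<in> I" unfolding t_def
      by (rule clos) (use aq vars_mono[of J "insert i J"] less.prems r in auto)
    have "\<exists>c\<in>vars J. c \<noteq> 0 \<and> r dvd c * t"
    proof (cases "t = 0")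
      case True
      then show ?thesis by (intro bexI[of _ 1]) auto
    next
      case nz: False
      then have "width i t < width i s" using aq(4) by (simp add: t_def)
      then show ?thesis using less.hyps[OF _ tI] width_nonneg[OF nz, of i] by simp
    qed
    then obtain c where c: "c \<in> vars J" "c \<noteq> 0" "r dvd c * t" by auto
    have "(c * a) * s = c * t + (c * q) * r" by (simp add: t_def algebra_simps)
    then have "r dvd (c * a) * s" using c(3) by simp
    then show ?thesis using c aq vars_mult[OF c(1) aq(1)] by (intro bexI[of _ "c * a"]) auto
  qed
qed

text \<open>If f involves the variable i, the ideal of f and g is generated up to coefficients by
  some r, whose primitive part \<open>r0\<close> divides both. As f is irreducible,
  \<open>r0\<close> is either associated to f, so that f divides g, or a unit, so that the ideal
  contains a coefficient e; then f divides \<open>e * h\<close>, and e cancels.\<close>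

lemma primes_on_insert:
  assumes J: "primes_on J" "i \<notin> J" shows "primes_on (insert i J)"
  unfolding primes_on_def
proof (intro ballI impI)
  let ?B = "vars (insert i J)"
  fix f g h assume fB: "f \<in> ?B" and irr: "irreducible f" and gB: "g \<in> ?B" and hB: "h \<in> ?B" and dvd: "f dvd g * h"
  have JB: "vars J \<subseteq> ?B" by (rule vars_mono) auto
  have f0: "f \<noteq> 0" using irr by auto
  show "f dvd g \<or> f dvd h"
  proof (cases "width i f = 0")
    case True
    \<comment> \<open>Here f is free of the variable i up to a monomial, which makes the Gauss lemma
      applicable.\<close>
    then have "width k f = 0" if "k \<notin> J" for k
      using vars_low(3)[OF fB f0, of k] that by (cases "k = i") auto
    then obtain m where "monom m * f \<in> vars J" using vars_normalize f0 by metis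
    moreover have "irreducible (monom m * f)" using irr by (rule irreducible_monom_mult)
    ultimately show ?thesis
      using prime_on_insert[OF J, of "monom m * f" g h] gB hB dvd by (simp add: monom_mult_dvd)
  next
    case False
    \<comment> \<open>An irreducible divisor free of the variable i would be associated to f and
      force f to have width 0.\<close>
    have prim_f: "primitive_over J f"
      unfolding primitive_over_def
    proof (intro ballI impI notI)
      fix p assume p: "p \<in> vars J" "irreducible p" "p dvd f"
      then obtain u where u: "f = p * u" by auto
      then have "u dvd 1" using irr p by (auto simp: irreducible_def)
      then obtain v where "1 = u * v" by auto
      then have "width i u + width i v = 0"
        using width_mult[of u v i] by (metis mult_not_zero width_def low_1 zero_index diff_0 minus_zero one_neq_zero)
      moreover have "u \<noteq> 0" "v \<noteq> 0" using \<open>1 = u * v\<close> by auto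
      ultimately have "width i u = 0" using width_nonneg[of u i] width_nonneg[of v i] by simp
      moreover have "width i p = 0" using vars_low(3)[of p J i] p J by (auto simp: irreducible_def)
      ultimately show False using False width_mult[of p u i] u f0 by auto
    qed
    define I where "I = {u * f + v * g | u v. u \<in> ?B \<and> v \<in> ?B}"
    have IB: "I \<subseteq> ?B" using fB gB by (auto simp: I_def intro!: vars_add vars_mult)
    have fI: "f \<in> I" unfolding I_def by (rule CollectI, rule exI[of _ 1], rule exI[of _ 0]) simp
    have gI: "g \<in> I" unfolding I_def by (rule CollectI, rule exI[of _ 0], rule exI[of _ 1]) simp
    have clos: "a * s - q * r \<in> I" if asm: "a \<in> ?B" "q \<in> ?B" "s \<in> I" "r \<in> I" for a s q r
    proof -
      obtain u v u' v' where s: "s = u * f + v * g" "u \<in> ?B" "v \<in> ?B" and r: "r = u' * f + v' * g" "u' \<in> ?B" "v' \<in> ?B"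
        using asm(3,4) by (auto simp: I_def)
      have "a * s - q * r = (a * u - q * u') * f + (a * v - q * v') * g"
        by (simp add: s r algebra_simps)
      then show ?thesis unfolding I_def using asm s r by (blast intro: vars_diff vars_mult)
    qed
    obtain r where r: "r \<in> I" "r \<noteq> 0" and min: "\<And>s. s \<in> I \<Longrightarrow> s \<noteq> 0 \<Longrightarrow> nat (width i r) \<le> nat (width i s)"
      using ex_has_least_nat[of "\<lambda>r. r \<in> I \<and> r \<noteq> 0" f "\<lambda>r. nat (width i r)"] fI f0 by auto
    have min': "width i r \<le> width i s" if "s \<in> I" "s \<noteq> 0" for s
      using min[OF that] width_nonneg[OF r(2), of i] width_nonneg[OF that(2), of i] by simp
    obtain e r0 where e: "e \<in> vars J" "r0 \<in> ?B" "r = e * r0" "primitive_over J r0"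
      using content_decomp[of r i J] r IB by auto
    \<comment> \<open>Division by r holds only after multiplication with a coefficient c; since
      \<open>r0\<close> is primitive, c can be cancelled against the rest of the quotient.\<close>
    have r0: "r0 dvd s" if sI: "s \<in> I" for s
    proof -
      obtain c where c: "c \<in> vars J" "c \<noteq> 0" "r dvd c * s"
        using min_width_divides[OF J(2) IB clos r min' sI] by auto
      then obtain k where k: "c * s = r * k" by auto
      have kB: "k \<in> ?B" by (rule vars_quotient[of r]) (use r IB k c JB \<open>s \<in> I\<close> in \<open>auto intro: vars_mult simp: k[symmetric]\<close>)
      have "c dvd r0 * (e * k)" using k e(3) by (metis dvd_triv_left mult.assoc mult.commute)
      then have "c dvd e * k"
        using primitive_cancel[OF J e(2,4) c(1,2), of "e * k"] kB e JB by (auto intro: vars_mult)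
      then obtain w where "e * k = c * w" by auto
      then have "c * s = c * (r0 * w)" using k e(3) by (metis mult.assoc mult.commute)
      then show ?thesis using c by auto
    qed
    obtain w where w: "f = r0 * w" using r0[OF fI] by auto
    then consider "w dvd 1" | "r0 dvd 1" using irreducibleD[OF irr w] by auto
    then show ?thesis
    proof cases
      case 1
      then have "f dvd r0" unfolding w by (metis dvd_refl mult_dvd_mono mult_1_right)
      then show ?thesis using r0[OF gI] by (metis dvd_trans)
    next
      case 2
      then obtain t where t: "r0 * t = 1" by (metis dvdE)
      obtain u v where uv: "r = u * f + v * g" "u \<in> ?B" "v \<in> ?B" using r by (auto simp: I_def)
      \<comment> \<open>With \<open>r0\<close> a unit, the content e itself lies in the ideal of f
        and g.\<close>
      have "e = r * t" using e(3) t by (simp add: mult.assoc)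
      then have "e * h = t * (u * h * f + v * (g * h))" by (simp add: uv algebra_simps)
      then have "f dvd e * h" using dvd by simp
      then obtain k where k: "e * h = f * k" by auto
      have e0: "e \<noteq> 0" using e r by auto
      have "k \<in> ?B" by (rule vars_quotient[OF fB f0]) (use k e JB hB in \<open>auto intro: vars_mult simp: k[symmetric]\<close>)
      then have "e dvd k"
        using primitive_cancel[OF J fB prim_f e(1) e0, of k] by (metis dvd_triv_left k)
      then obtain l where "k = e * l" by auto
      then have "e * h = e * (f * l)" using k by (simp add: mult_ac)
      then have "f dvd h" using e0 by auto
      then show ?thesis ..
    qed
  qed
qed

lemma primes_on_all: "primes_on (J :: 'n::finite set)"
proof (induction J rule: finite_induct[OF finite])
  case 1
  \<comment> \<open>Without variables every nonzero element is a constant, so there are no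
    irreducible elements to treat.\<close>
  have "f dvd 1" if "f \<in> vars {}" "f \<noteq> 0" for f :: "'n laurent"
    by (rule dvd_1_if_width_0) (use that vars_low(3)[of f "{}"] in auto)
  then show ?case by (auto simp: primes_on_def irreducible_def)
qed (rule primes_on_insert)

theorem laurent_irreducible_imp_prime:
  assumes "irreducible (p :: 'n::finite laurent)" shows "prime_elem p"
proof (rule prime_elemI)
  fix a b assume "p dvd a * b"
  then show "p dvd a \<or> p dvd b"
    using primes_on_all[of UNIV] assms by (auto simp: primes_on_def vars_def)
qed (use assms in \<open>auto simp: irreducible_def\<close>)

section \<open>Consequences of prime factorization\<close>

lemma prime_divisor:
  assumes "(f :: 'n::finite laurent) \<noteq> 0" "\<not> f dvd 1"
  obtains p where "prime_elem p" "p dvd f"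
  using irreducible_divisor[OF assms] laurent_irreducible_imp_prime by blast

lemma laurent_prime_induct [consumes 1, case_names unit prime]:
  assumes "(f :: 'n::finite laurent) \<noteq> 0"
    and "\<And>f. f dvd 1 \<Longrightarrow> P f"
    and "\<And>p f. prime_elem p \<Longrightarrow> f \<noteq> 0 \<Longrightarrow> P f \<Longrightarrow> P (p * f)"
  shows "P f"
  using assms(1)
proof (induction "size_laurent f" arbitrary: f rule: less_induct)
  case less
  show ?case
  proof (cases "f dvd 1")
    case False
    then obtain p where p: "prime_elem p" "p dvd f" using prime_divisor less.prems by blast
    then obtain g where g: "f = p * g" by auto
    show ?thesis unfolding g
      by (rule assms(3)[OF p(1)]) (use less g p size_dvd_less[OF g] in \<open>auto simp: prime_elem_def\<close>)
  qed (rule assms(2))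
qed

lemma coprime_decomp:
  fixes a b :: "'n::finite laurent"
  assumes "b \<noteq> 0"
  shows "\<exists>a' b'. b' \<noteq> 0 \<and> a * b' = a' * b \<and> (\<forall>p. prime_elem p \<longrightarrow> \<not> (p dvd a' \<and> p dvd b'))"
  using assms
proof (induction "size_laurent b" arbitrary: a b rule: less_induct)
  case less
  show ?case
  proof (cases "\<exists>p. prime_elem p \<and> p dvd a \<and> p dvd b")
    case True
    then obtain p c d where p: "prime_elem p" and a: "a = p * c" and b: "b = p * d" by (meson dvdE)
    have "size_laurent d < size_laurent b"
      by (rule size_dvd_less[OF b]) (use p less.prems in \<open>auto simp: prime_elem_def\<close>)
    then obtain a' b' where "b' \<noteq> 0" "c * b' = a' * d" "\<forall>p. prime_elem p \<longrightarrow> \<not> (p dvd a' \<and> p dvd b')"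
      using less.hyps[of d c] less.prems b by auto
    then show ?thesis by (intro exI[of _ a'] exI[of _ b']) (auto simp: a b mult_ac)
  next
    case False
    then show ?thesis using less.prems by (intro exI[of _ a] exI[of _ b]) auto
  qed
qed

section \<open>Primes and localizations of subrings\<close>

text \<open>Charts are treated as subsets of one domain, and their local rings as subsets of its
  fraction field. Restriction of primes is then plain intersection, and local rings on different
  charts can be equal as sets.\<close>

definition subring_set :: "'a::idom set \<Rightarrow> bool" where
  "subring_set A \<longleftrightarrow> 0 \<in> A \<and> 1 \<in> A \<and> (\<forall>a\<in>A. \<forall>b\<in>A. a + b \<in> A \<and> a * b \<in> A \<and> - a \<in> A)"

definition prime_of :: "'a::idom set \<Rightarrow> 'a set \<Rightarrow> bool" where
  "prime_of A p \<longleftrightarrow> p \<subseteq> A \<and> 0 \<in> p \<and> 1 \<notin> p \<and> (\<forall>a\<in>p. \<forall>b\<in>p. a + b \<in> p) \<and>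
     (\<forall>a\<in>A. \<forall>b\<in>p. a * b \<in> p) \<and> (\<forall>a\<in>A. \<forall>b\<in>A. a * b \<in> p \<longrightarrow> a \<in> p \<or> b \<in> p)"

definition loc_ring :: "'a::idom set \<Rightarrow> 'a set \<Rightarrow> 'a fract set" where
  "loc_ring A p = {Fract a b | a b. a \<in> A \<and> b \<in> A - p}"

definition loc_units :: "'a::idom set \<Rightarrow> 'a set \<Rightarrow> 'a fract set" where
  "loc_units A p = {Fract a b | a b. a \<in> A - p \<and> b \<in> A - p}"

text \<open>B is the localization of A at the powers of s, described inside a common domain.\<close>

definition localizes :: "'a::idom set \<Rightarrow> 'a set \<Rightarrow> 'a \<Rightarrow> bool" where
  "localizes A B s \<longleftrightarrow> A \<subseteq> B \<and> s \<in> A \<and> (\<exists>t\<in>B. s * t = 1) \<and> (\<forall>f\<in>B. \<exists>N. s ^ N * f \<in> A)"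

lemma subring_setD:
  assumes "subring_set A"
  shows "0 \<in> A" "1 \<in> A" "a \<in> A \<Longrightarrow> b \<in> A \<Longrightarrow> a + b \<in> A" "a \<in> A \<Longrightarrow> b \<in> A \<Longrightarrow> a * b \<in> A"
    "a \<in> A \<Longrightarrow> - a \<in> A" "a \<in> A \<Longrightarrow> a ^ N \<in> A"
proof -
  show "a \<in> A \<Longrightarrow> a ^ N \<in> A" using assms by (induction N) (auto simp: subring_set_def)
qed (use assms in \<open>auto simp: subring_set_def\<close>)

lemma prime_ofD:
  assumes "prime_of A p"
  shows "p \<subseteq> A" "0 \<in> p" "1 \<notin> p" "a \<in> p \<Longrightarrow> b \<in> p \<Longrightarrow> a + b \<in> p" "a \<in> A \<Longrightarrow> b \<in> p \<Longrightarrow> a * b \<in> p"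
    "a \<in> A \<Longrightarrow> b \<in> p \<Longrightarrow> b * a \<in> p" "a \<in> A \<Longrightarrow> b \<in> A \<Longrightarrow> a * b \<in> p \<Longrightarrow> a \<in> p \<or> b \<in> p"
  using assms by (auto simp: prime_of_def mult.commute)

lemma prime_of_power:
  assumes "prime_of A p" "subring_set A" "s \<in> A" "s ^ N \<in> p" shows "s \<in> p"
  using assms(4)
proof (induction N)
  case (Suc N)
  then show ?case using assms prime_ofD(7)[OF assms(1), of s "s ^ N"] subring_setD(6)[OF assms(2)] by auto
qed (use assms prime_ofD(3) in auto)

lemma prime_of_unit:
  assumes "prime_of A p" "t \<in> A" "s * t = 1" shows "s \<notin> p"
  using prime_ofD(3,6)[OF assms(1)] assms by metis

lemma nonmember_mult:
  assumes "prime_of A p" "subring_set A" "a \<in> A - p" "b \<in> A - p" shows "a * b \<in> A - p"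
  using assms prime_ofD(7)[OF assms(1)] subring_setD(4)[OF assms(2)] by auto

lemma one_nonmember: "prime_of A p \<Longrightarrow> subring_set A \<Longrightarrow> 1 \<in> A - p"
  using prime_ofD(3) subring_setD(2) by blast

lemma prime_of_Int:
  assumes "prime_of B q" "subring_set A" "A \<subseteq> B" shows "prime_of A (q \<inter> A)"
  using assms unfolding prime_of_def subring_set_def by blast

text \<open>A power of s, which is a unit of B, carries any element of B into A, where the two
  primes agree.\<close>

lemma prime_of_localizes_eq:
  assumes "localizes A B s" "subring_set A" "subring_set B" "prime_of B q" "prime_of B q'" "q \<inter> A = q' \<inter> A"
  shows "q = q'"
proof -
  have *: "q \<subseteq> q'" if q: "prime_of B q" "prime_of B q'" "q \<inter> A = q' \<inter> A" for q q'
  proof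
    fix f assume f: "f \<in> q"
    then have fB: "f \<in> B" using prime_ofD(1)[OF q(1)] by auto
    obtain t where t: "t \<in> B" "s * t = 1" and sA: "s \<in> A" "A \<subseteq> B" using assms(1) by (auto simp: localizes_def)
    obtain N where N: "s ^ N * f \<in> A" using assms(1) fB by (auto simp: localizes_def)
    have sN: "s ^ N \<in> B" using subring_setD(6)[OF assms(3)] sA by auto
    have "s ^ N * f \<in> q'" using prime_ofD(5)[OF q(1) sN f] N q(3) by auto
    then have "s ^ N \<in> q' \<or> f \<in> q'" using prime_ofD(7)[OF q(2) sN fB] by auto
    then show "f \<in> q'"
      using prime_of_power[OF q(2) assms(3), of s N] prime_of_unit[OF q(2) t] sA by auto
  qed
  show ?thesis using *[of q q'] *[of q' q] assms by auto
qed

lemma prime_of_localizes_extend: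
  assumes loc: "localizes A B s" and A: "subring_set A" and B: "subring_set B" and p: "prime_of A p" and "s \<notin> p"
  shows "\<exists>q. prime_of B q \<and> q \<inter> A = p"
proof -
  \<comment> \<open>This is the extension of p to B, in saturated form.\<close>
  define q where "q = {f\<in>B. \<exists>N. s ^ N * f \<in> p}"
  have s: "s \<in> A" "A \<subseteq> B" using loc by (auto simp: localizes_def)
  have sN: "s ^ N \<in> A" for N by (rule subring_setD(6)[OF A s(1)])
  have mono: "s ^ (M + N) * f \<in> p" if "s ^ N * f \<in> p" for M N f
    using prime_ofD(5)[OF p sN that, of M] by (simp add: power_add mult.assoc)
  have in_p: "f \<in> p" if "f \<in> A" "s ^ N * f \<in> p" for f N
    using prime_ofD(7)[OF p sN that] prime_of_power[OF p A s(1)] \<open>s \<notin> p\<close> by blast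
  have qA: "q \<inter> A = p"
  proof
    show "q \<inter> A \<subseteq> p" using in_p by (auto simp: q_def)
    show "p \<subseteq> q \<inter> A" using prime_ofD(1)[OF p] s by (auto simp: q_def intro!: exI[of _ 0])
  qed
  have "prime_of B q"
    unfolding prime_of_def
  proof (intro conjI ballI impI)
    show "q \<subseteq> B" by (auto simp: q_def)
    show "0 \<in> q" using qA prime_ofD(2)[OF p] by auto
    show "1 \<notin> q" using qA prime_ofD(3)[OF p] subring_setD(2)[OF A] by auto
  next
    fix a b assume "a \<in> q" "b \<in> q"
    then obtain M N where ab: "a \<in> B" "b \<in> B" "s ^ M * a \<in> p" "s ^ N * b \<in> p" by (auto simp: q_def)
    have "s ^ (N + M) * a + s ^ (M + N) * b \<in> p" using mono ab prime_ofD(4)[OF p] by blast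
    then have "s ^ (M + N) * (a + b) \<in> p" by (simp add: algebra_simps)
    then show "a + b \<in> q" using ab subring_setD(3)[OF B] by (auto simp: q_def)
  next
    fix a b assume "a \<in> B" "b \<in> q"
    then obtain M N where ab: "b \<in> B" "s ^ M * a \<in> A" "s ^ N * b \<in> p" using loc by (auto simp: q_def localizes_def)
    have "(s ^ M * a) * (s ^ N * b) \<in> p" using ab prime_ofD(5)[OF p] by blast
    then have "s ^ (M + N) * (a * b) \<in> p" by (simp add: power_add mult_ac)
    then show "a * b \<in> q" using ab subring_setD(4)[OF B \<open>a \<in> B\<close> ab(1)] by (auto simp: q_def)
  next
    fix a b assume a: "a \<in> B" and b: "b \<in> B" and "a * b \<in> q"
    then obtain M N K where N: "s ^ M * a \<in> A" "s ^ N * b \<in> A" "s ^ K * (a * b) \<in> p"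
      using loc unfolding q_def localizes_def by blast
    have "s ^ ((M + N) + K) * (a * b) \<in> p" using mono[OF N(3)] .
    then have "s ^ K * ((s ^ M * a) * (s ^ N * b)) \<in> p" by (simp add: power_add mult_ac)
    then have "(s ^ M * a) * (s ^ N * b) \<in> p" using in_p N subring_setD(4)[OF A] by blast
    then have "s ^ M * a \<in> p \<or> s ^ N * b \<in> p" using prime_ofD(7)[OF p N(1,2)] by blast
    then show "a \<in> q \<or> b \<in> q" using a b by (auto simp: q_def)
  qed
  with qA show ?thesis by blast
qed

lemma Fract_scale: "c \<noteq> 0 \<Longrightarrow> b \<noteq> 0 \<Longrightarrow> Fract (c * a) (c * b) = Fract a b"
  by (simp add: eq_fract mult_ac)

text \<open>Numerator and denominator of a fraction over B are brought into A by a common power of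
  s, which avoids q.\<close>

lemma localizes_loc:
  assumes loc: "localizes A B s" and A: "subring_set A" and B: "subring_set B" and q: "prime_of B q"
  shows "loc_ring A (q \<inter> A) = loc_ring B q" "loc_units A (q \<inter> A) = loc_units B q"
proof -
  have s: "s \<in> A" "A \<subseteq> B" using loc by (auto simp: localizes_def)
  obtain t where t: "t \<in> B" "s * t = 1" using loc by (auto simp: localizes_def)
  have sN: "s ^ N \<in> A" for N by (rule subring_setD(6)[OF A s(1)])
  have sq: "s ^ N \<in> B - q" for N
    using sN s prime_of_unit[OF q t] prime_of_power[OF q B, of s N] by auto
  have s0: "s \<noteq> 0" using t by auto
  have ex: "\<exists>a' b'. Fract a b = Fract a' b' \<and> a' \<in> A \<and> b' \<in> A - (q \<inter> A) \<and> (a \<notin> q \<longrightarrow> a' \<notin> q)"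
    if a: "a \<in> B" and b: "b \<in> B - q" for a b
  proof -
    obtain M N where MN: "s ^ M * a \<in> A" "s ^ N * b \<in> A" using loc a b unfolding localizes_def by (meson DiffD1)
    have 1: "s ^ (M + N) * a \<in> A" "s ^ (M + N) * b \<in> A"
      using subring_setD(4)[OF A sN[of N] MN(1)] subring_setD(4)[OF A sN[of M] MN(2)]
      by (simp_all add: power_add mult_ac)
    have b0: "b \<noteq> 0" using b prime_ofD(2)[OF q] by auto
    have "Fract a b = Fract (s ^ (M + N) * a) (s ^ (M + N) * b)"
      using Fract_scale[of "s ^ (M + N)" b a] s0 b0 by auto
    moreover have "s ^ (M + N) * b \<notin> q" using nonmember_mult[OF q B sq b] by auto
    moreover have "a \<notin> q \<longrightarrow> s ^ (M + N) * a \<notin> q" using nonmember_mult[OF q B sq, of a] a by auto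
    ultimately show ?thesis using 1 by blast
  qed
  show "loc_ring A (q \<inter> A) = loc_ring B q"
  proof
    show "loc_ring A (q \<inter> A) \<subseteq> loc_ring B q" using s by (auto simp: loc_ring_def)
    show "loc_ring B q \<subseteq> loc_ring A (q \<inter> A)" using ex by (fastforce simp: loc_ring_def)
  qed
  show "loc_units A (q \<inter> A) = loc_units B q"
  proof
    show "loc_units A (q \<inter> A) \<subseteq> loc_units B q" using s by (auto simp: loc_units_def)
    show "loc_units B q \<subseteq> loc_units A (q \<inter> A)"
    proof
      fix x assume "x \<in> loc_units B q"
      then obtain a b where ab: "x = Fract a b" "a \<in> B" "a \<notin> q" "b \<in> B - q" by (auto simp: loc_units_def)
      then obtain a' b' where "x = Fract a' b'" "a' \<in> A" "b' \<in> A - (q \<inter> A)" "a' \<notin> q" using ex[of a b] by auto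
      then show "x \<in> loc_units A (q \<inter> A)" by (auto simp: loc_units_def)
    qed
  qed
qed

lemma Fract_eq_0: "b \<noteq> 0 \<Longrightarrow> Fract a b = 0 \<longleftrightarrow> a = 0"
  by (simp add: Zero_fract_def eq_fract)

lemma loc_units_eq:
  assumes p: "prime_of A p" and A: "subring_set A"
  shows "loc_units A p = {u \<in> loc_ring A p. u \<noteq> 0 \<and> inverse u \<in> loc_ring A p}"
proof
  have nz: "b \<noteq> 0" if "b \<in> A - p" for b using that prime_ofD(2)[OF p] by auto
  show "loc_units A p \<subseteq> {u \<in> loc_ring A p. u \<noteq> 0 \<and> inverse u \<in> loc_ring A p}"
  proof
    fix u assume "u \<in> loc_units A p"
    then obtain a b where ab: "u = Fract a b" "a \<in> A - p" "b \<in> A - p" unfolding loc_units_def by blast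
    then have "inverse u = Fract b a" "u \<noteq> 0" using nz[of a] nz[of b] Fract_eq_0 by auto
    then show "u \<in> {u \<in> loc_ring A p. u \<noteq> 0 \<and> inverse u \<in> loc_ring A p}"
      using ab unfolding loc_ring_def by blast
  qed
  show "{u \<in> loc_ring A p. u \<noteq> 0 \<and> inverse u \<in> loc_ring A p} \<subseteq> loc_units A p"
  proof
    fix u assume "u \<in> {u \<in> loc_ring A p. u \<noteq> 0 \<and> inverse u \<in> loc_ring A p}"
    then obtain a b c d where u: "u = Fract a b" "a \<in> A" "b \<in> A - p" "u \<noteq> 0"
      "inverse u = Fract c d" "c \<in> A" "d \<in> A - p" by (auto simp: loc_ring_def)
    have b: "b \<noteq> 0" and d: "d \<noteq> 0" and a: "a \<noteq> 0" using u nz Fract_eq_0[of b a] by auto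
    have "Fract b a = Fract c d" using u by auto
    then have "b * d = c * a" using a d by (simp add: eq_fract)
    moreover have "b * d \<notin> p" using nonmember_mult[OF p A u(3,7)] by auto
    ultimately have "a \<notin> p" using prime_ofD(5)[OF p u(6)] by metis
    then show "u \<in> loc_units A p" using u by (auto simp: loc_units_def)
  qed
qed

lemma loc_units_mult:
  assumes "prime_of A p" "subring_set A" "u \<in> loc_units A p" "v \<in> loc_units A p"
  shows "u * v \<in> loc_units A p"
proof -
  obtain a b where u: "u = Fract a b" "a \<in> A - p" "b \<in> A - p" using assms(3) unfolding loc_units_def by blast
  obtain c d where v: "v = Fract c d" "c \<in> A - p" "d \<in> A - p" using assms(4) unfolding loc_units_def by blast
  have "u * v = Fract (a * c) (b * d)" by (simp add: u v)
  moreover have "a * c \<in> A - p" "b * d \<in> A - p" using nonmember_mult[OF assms(1,2)] u v by auto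
  ultimately show ?thesis unfolding loc_units_def by blast
qed

lemma loc_units_inverse: "u \<in> loc_units A p \<Longrightarrow> inverse u \<in> loc_units A p"
  unfolding loc_units_def using inverse_fract by blast

lemma loc_units_1: "prime_of A p \<Longrightarrow> subring_set A \<Longrightarrow> 1 \<in> loc_units A p"
  using one_nonmember unfolding loc_units_def One_fract_def by blast

lemma loc_units_nz: "prime_of A p \<Longrightarrow> u \<in> loc_units A p \<Longrightarrow> u \<noteq> 0"
proof -
  assume p: "prime_of A p" and "u \<in> loc_units A p"
  then obtain a b where "u = Fract a b" "a \<notin> p" "b \<notin> p" by (auto simp: loc_units_def)
  then show "u \<noteq> 0" using prime_ofD(2)[OF p] Fract_eq_0[of b a] by metis
qed

section \<open>The scheme of a fan\<close>

definition pair :: "int ^ 'n \<Rightarrow> real ^ 'n \<Rightarrow> real" where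
  "pair m u = (\<Sum>i\<in>UNIV. real_of_int (m $ i) * u $ i)"

abbreviation chart :: "(real ^ 'n) set \<Rightarrow> 'n::finite laurent set" where
  "chart \<sigma> \<equiv> carrier (coord_ring \<sigma>)"

lemma pair_add: "pair (m + k) u = pair m u + pair k u"
  by (simp add: pair_def sum.distrib algebra_simps)

lemma pair_uminus: "pair (- m) u = - pair m u"
  by (simp add: pair_def sum_negf)

lemma pair_diff: "pair (m - k) u = pair m u - pair k u"
  by (simp add: pair_def sum_subtractf algebra_simps)

lemma pair_scale: "pair (c *s m) u = real_of_int c * pair m u"
  by (simp add: pair_def sum_distrib_left mult.assoc)

lemma pair_0 [simp]: "pair 0 u = 0" "pair m 0 = 0"
  by (simp_all add: pair_def)

abbreviation low_at :: "real ^ 'n \<Rightarrow> 'n::finite laurent \<Rightarrow> real" where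
  "low_at v \<equiv> low (\<lambda>m. pair m v)"

lemma dual_semigroup_pair: "dual_semigroup \<sigma> = {m. \<forall>u\<in>\<sigma>. 0 \<le> pair m u}"
  by (simp add: dual_semigroup_def pair_def)

lemma chart_iff: "f \<in> chart \<sigma> \<longleftrightarrow> supp f \<subseteq> dual_semigroup \<sigma>"
  by (simp add: coord_ring_def supp_keys)

lemma dual_semigroup_add: "m \<in> dual_semigroup \<sigma> \<Longrightarrow> k \<in> dual_semigroup \<sigma> \<Longrightarrow> m + k \<in> dual_semigroup \<sigma>"
  by (simp add: dual_semigroup_pair pair_add)

lemma dual_semigroup_0 [simp]: "0 \<in> dual_semigroup \<sigma>"
  by (simp add: dual_semigroup_pair)

lemma supp_uminus [simp]: "supp (- f) = supp f"
  by (simp add: supp_keys uminus_laurent.rep_eq)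

lemma subring_chart: "subring_set (chart \<sigma>)"
  unfolding subring_set_def chart_iff
proof (intro conjI ballI)
  fix f g :: "'a laurent" assume fg: "f \<in> chart \<sigma>" "g \<in> chart \<sigma>"
  show "supp (f + g) \<subseteq> dual_semigroup \<sigma>" using fg supp_add by (fastforce simp: chart_iff)
  show "supp (f * g) \<subseteq> dual_semigroup \<sigma>"
    using fg by (auto simp: chart_iff intro: dual_semigroup_add elim!: supp_multE)
  show "supp (- f) \<subseteq> dual_semigroup \<sigma>" using fg by (simp add: chart_iff)
qed auto

lemma coord_ring_simps [simp]:
  "mult (coord_ring \<sigma>) = (*)" "one (coord_ring \<sigma>) = 1" "zero (coord_ring \<sigma>) = 0" "add (coord_ring \<sigma>) = (+)"
  by (simp_all add: coord_ring_def)

lemma cring_coord_ring: "cring (coord_ring \<sigma>)"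
proof (rule cringI)
  note A = subring_setD[OF subring_chart[of \<sigma>]]
  show "abelian_group (coord_ring \<sigma>)"
    by (rule abelian_groupI) (use A in \<open>auto simp: add_ac intro: bexI[of _ "- _"]\<close>)
  show "comm_monoid (coord_ring \<sigma>)"
    by (rule comm_monoidI) (use A in \<open>auto simp: mult_ac\<close>)
qed (auto simp: algebra_simps)

lemma Spec_iff: "p \<in> Spec \<sigma> \<longleftrightarrow> prime_of (chart \<sigma>) p"
proof
  note A = subring_setD[OF subring_chart[of \<sigma>]]
  assume "p \<in> Spec \<sigma>"
  then interpret primeideal p "coord_ring \<sigma>" by (simp add: Spec_def)
  show "prime_of (chart \<sigma>) p"
    unfolding prime_of_def
  proof (intro conjI ballI impI)
    show "p \<subseteq> chart \<sigma>" by (rule a_subset)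
    show "0 \<in> p" using additive_subgroup.zero_closed[OF is_additive_subgroup] by simp
    show "1 \<notin> p" using I_notcarr one_imp_carrier by auto
  next
    fix a b assume "a \<in> p" "b \<in> p"
    then show "a + b \<in> p" using additive_subgroup.a_closed[OF is_additive_subgroup] by simp
  next
    fix a b assume "a \<in> chart \<sigma>" "b \<in> p"
    then show "a * b \<in> p" using I_l_closed by simp
  next
    fix a b assume "a \<in> chart \<sigma>" "b \<in> chart \<sigma>" "a * b \<in> p"
    then show "a \<in> p \<or> b \<in> p" using I_prime by simp
  qed
next
  note A = subring_setD[OF subring_chart[of \<sigma>]]
  assume p: "prime_of (chart \<sigma>) p"
  interpret cring "coord_ring \<sigma>" by (rule cring_coord_ring)
  have inv_eq: "inv\<^bsub>add_monoid (coord_ring \<sigma>)\<^esub> a = - a" if "a \<in> p" for a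
    using that prime_ofD(1)[OF p] A(5)[of a] by (intro group.inv_equality[OF a_group]) auto
  have "- a \<in> p" if "a \<in> p" for a
    using prime_ofD(5)[OF p _ that, of "- 1"] A by simp
  then have "subgroup p (add_monoid (coord_ring \<sigma>))"
    using prime_ofD[OF p] inv_eq by unfold_locales (auto simp: a_inv_def)
  then have "ideal p (coord_ring \<sigma>)"
    by (intro idealI local.ring_axioms) (use prime_ofD[OF p] in auto)
  then have "primeideal p (coord_ring \<sigma>)"
    by (rule primeidealI[OF _ cring_coord_ring]) (use prime_ofD(3,7)[OF p] A in auto)
  then show "p \<in> Spec \<sigma>" by (simp add: Spec_def)
qed

lemma monom_scale: "monom m ^ N = monom (int N *s m)"
proof (induction N)
  case (Suc N)
  have "int (Suc N) *s m = m + int N *s m" by (simp add: vec_eq_iff algebra_simps)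
  then show ?case using Suc by (simp add: monom_add)
qed (simp flip: monom_0)

text \<open>What the gluing uses of a fan. By \<open>face_cone\<close> a smaller cone is cut out by
  one character, so its chart is the localization at one monomial; \<open>finite_cone\<close> makes
  a single power of that monomial sufficient to clear denominators.\<close>

locale toric_fan =
  fixes \<Sigma> :: "(real ^ 'n) set set"
  assumes zero_cone: "{0} \<in> \<Sigma>"
    and Int_cone: "\<sigma> \<in> \<Sigma> \<Longrightarrow> \<tau> \<in> \<Sigma> \<Longrightarrow> \<sigma> \<inter> \<tau> \<in> \<Sigma>"
    and face_cone: "\<sigma> \<in> \<Sigma> \<Longrightarrow> \<tau> \<in> \<Sigma> \<Longrightarrow> \<tau> \<subseteq> \<sigma> \<Longrightarrow> \<exists>m\<in>dual_semigroup \<sigma>. \<tau> = {u\<in>\<sigma>. pair m u = 0}"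
    and finite_cone: "\<sigma> \<in> \<Sigma> \<Longrightarrow> \<exists>V\<subseteq>\<sigma>. finite V \<and> (\<forall>m. (\<forall>v\<in>V. 0 \<le> pair m v) \<longrightarrow> m \<in> dual_semigroup \<sigma>)"
begin

lemma chart_mono: "\<tau> \<subseteq> \<sigma> \<Longrightarrow> chart \<sigma> \<subseteq> chart \<tau>"
  by (force simp: chart_iff dual_semigroup_pair)

text \<open>It suffices to look at the finitely many generators v. Where m vanishes, v lies in the
  face and the exponents of f are already nonnegative; where m is positive, a large multiple of m
  dominates.\<close>

lemma localizes_face:
  assumes \<sigma>: "\<sigma> \<in> \<Sigma>" and m: "m \<in> dual_semigroup \<sigma>"
  shows "localizes (chart \<sigma>) (chart {u\<in>\<sigma>. pair m u = 0}) (monom m)"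
  unfolding localizes_def
proof (intro conjI ballI)
  let ?\<tau> = "{u\<in>\<sigma>. pair m u = 0}"
  show "chart \<sigma> \<subseteq> chart ?\<tau>" by (rule chart_mono) auto
  show "monom m \<in> chart \<sigma>" using m by (simp add: chart_iff)
  show "\<exists>t\<in>chart ?\<tau>. monom m * t = 1"
    by (intro bexI[of _ "monom (- m)"])
      (auto simp: monom_uminus chart_iff dual_semigroup_pair pair_uminus)
  fix f assume f: "f \<in> chart ?\<tau>"
  obtain V where V: "V \<subseteq> \<sigma>" "finite V" "\<And>k. (\<forall>v\<in>V. 0 \<le> pair k v) \<Longrightarrow> k \<in> dual_semigroup \<sigma>"
    using finite_cone[OF \<sigma>] by blast
  have ex: "\<exists>N::nat. \<forall>M\<ge>N. 0 \<le> real M * pair m v + pair k v" if "k \<in> supp f" "v \<in> V" for k v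
  proof (cases "pair m v = 0")
    case True
    then have "v \<in> ?\<tau>" using V that by auto
    moreover have "k \<in> dual_semigroup ?\<tau>" using f that(1) by (auto simp: chart_iff)
    ultimately show ?thesis by (auto simp: dual_semigroup_pair True)
  next
    case False
    then have pos: "0 < pair m v" using m V that by (force simp: dual_semigroup_pair)
    obtain N :: nat where N: "- pair k v / pair m v < real N" using reals_Archimedean2 by blast
    have "0 \<le> real M * pair m v + pair k v" if "M \<ge> N" for M
    proof -
      have "- pair k v / pair m v \<le> real M" using N that by linarith
      then show ?thesis using pos by (simp add: field_simps)
    qed
    then show ?thesis by blast
  qed
  then obtain N where N: "\<And>k v M. k \<in> supp f \<Longrightarrow> v \<in> V \<Longrightarrow> N k v \<le> M \<Longrightarrow> 0 \<le> real M * pair m v + pair k v"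
    by metis
  \<comment> \<open>The sum is a common upper bound for the finitely many thresholds, also if there
    are none.\<close>
  define M where "M = (\<Sum>k\<in>supp f. \<Sum>v\<in>V. N k v)"
  have "N k v \<le> M" if "k \<in> supp f" "v \<in> V" for k v
  proof -
    have "N k v \<le> (\<Sum>v\<in>V. N k v)" by (rule member_le_sum) (use that V in auto)
    also have "\<dots> \<le> M" unfolding M_def by (rule member_le_sum[of k _ "\<lambda>k. \<Sum>v\<in>V. N k v"]) (use that in auto)
    finally show ?thesis .
  qed
  then have "0 \<le> real M * pair m v + pair k v" if "k \<in> supp f" "v \<in> V" for k v
    using N that by blast
  then have "monom m ^ M * f \<in> chart \<sigma>"
    unfolding monom_scale chart_iff supp_monom_mult
    by (auto intro!: V(3) simp: pair_add pair_scale)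
  then show "\<exists>M. monom m ^ M * f \<in> chart \<sigma>" ..
qed

lemma localizes_subcone:
  assumes "\<sigma> \<in> \<Sigma>" "\<tau> \<in> \<Sigma>" "\<tau> \<subseteq> \<sigma>"
  obtains s where "localizes (chart \<sigma>) (chart \<tau>) s"
proof -
  obtain m where m: "m \<in> dual_semigroup \<sigma>" "\<tau> = {u\<in>\<sigma>. pair m u = 0}" using face_cone[OF assms] by blast
  show ?thesis by (rule that[of "monom m"]) (use localizes_face[OF assms(1) m(1)] m(2) in simp)
qed

lemma Spec_Int:
  assumes "q \<in> Spec \<tau>" "\<tau> \<subseteq> \<sigma>" shows "q \<inter> chart \<sigma> \<in> Spec \<sigma>"
  using prime_of_Int[OF _ subring_chart chart_mono] assms by (auto simp: Spec_iff)

lemma gluing_iff: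
  "((\<sigma>, p), (\<sigma>', p')) \<in> gluing \<Sigma> \<longleftrightarrow> \<sigma> \<in> \<Sigma> \<and> \<sigma>' \<in> \<Sigma> \<and>
     (\<exists>q\<in>Spec (\<sigma> \<inter> \<sigma>'). p = q \<inter> chart \<sigma> \<and> p' = q \<inter> chart \<sigma>')"
  (is "?L \<longleftrightarrow> ?R")
proof
  assume ?L then show ?R unfolding gluing_def by blast
next
  assume ?R
  moreover have "q \<inter> chart \<sigma> \<in> Spec \<sigma>" "q \<inter> chart \<sigma>' \<in> Spec \<sigma>'" if "q \<in> Spec (\<sigma> \<inter> \<sigma>')" for q
    using Spec_Int[OF that] by auto
  ultimately show ?L unfolding gluing_def by blast
qed

text \<open>The characters m and k that cut out the two overlaps inside \<sigma> are units there, so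
  neither lies in p. Hence p extends to the triple overlap, which \<open>m + k\<close> cuts out, and
  this extension is contracted to the overlap of the outer cones.\<close>

lemma gluing_trans:
  assumes "((\<rho>, p1), (\<sigma>, p)) \<in> gluing \<Sigma>" "((\<sigma>, p), (\<tau>, p3)) \<in> gluing \<Sigma>"
  shows "((\<rho>, p1), (\<tau>, p3)) \<in> gluing \<Sigma>"
proof -
  note sub = subring_chart
  have \<Sigma>: "\<rho> \<in> \<Sigma>" "\<sigma> \<in> \<Sigma>" "\<tau> \<in> \<Sigma>" using assms by (auto simp: gluing_iff)
  obtain r1 where q1: "prime_of (chart (\<rho> \<inter> \<sigma>)) r1" "p1 = r1 \<inter> chart \<rho>" "p = r1 \<inter> chart \<sigma>"
    using assms(1) by (auto simp: gluing_iff Spec_iff)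
  obtain r3 where q3: "prime_of (chart (\<sigma> \<inter> \<tau>)) r3" "p3 = r3 \<inter> chart \<tau>" "p = r3 \<inter> chart \<sigma>"
    using assms(2) by (auto simp: gluing_iff Spec_iff)
  obtain m where m: "m \<in> dual_semigroup \<sigma>" "\<rho> \<inter> \<sigma> = {u\<in>\<sigma>. pair m u = 0}"
    using face_cone[of \<sigma> "\<rho> \<inter> \<sigma>"] Int_cone \<Sigma> by blast
  obtain k where k: "k \<in> dual_semigroup \<sigma>" "\<sigma> \<inter> \<tau> = {u\<in>\<sigma>. pair k u = 0}"
    using face_cone[of \<sigma> "\<sigma> \<inter> \<tau>"] Int_cone \<Sigma> by blast
  let ?\<upsilon> = "\<rho> \<inter> \<sigma> \<inter> \<tau>"
  have "?\<upsilon> = {u\<in>\<sigma>. pair m u = 0} \<inter> {u\<in>\<sigma>. pair k u = 0}" using m(2) k(2) by auto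
  also have "\<dots> = {u\<in>\<sigma>. pair (m + k) u = 0}"
    using m(1) k(1) by (auto simp: dual_semigroup_pair pair_add add_nonneg_eq_0_iff)
  finally have "localizes (chart \<sigma>) (chart ?\<upsilon>) (monom (m + k))"
    using localizes_face[OF \<Sigma>(2) dual_semigroup_add[OF m(1) k(1)]] by simp
  moreover have lm: "localizes (chart \<sigma>) (chart (\<rho> \<inter> \<sigma>)) (monom m)"
    using localizes_face[OF \<Sigma>(2) m(1)] m(2) by simp
  moreover have lk: "localizes (chart \<sigma>) (chart (\<sigma> \<inter> \<tau>)) (monom k)"
    using localizes_face[OF \<Sigma>(2) k(1)] k(2) by simp
  moreover have P: "prime_of (chart \<sigma>) p"
    using prime_of_Int[OF q1(1) sub chart_mono] q1(3) by auto
  moreover have "monom (m + k) \<notin> p"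
  proof -
    have "monom m \<notin> r1" using prime_of_unit[OF q1(1)] lm by (auto simp: localizes_def)
    moreover have "monom k \<notin> r3" using prime_of_unit[OF q3(1)] lk by (auto simp: localizes_def)
    moreover have "monom m \<in> chart \<sigma>" "monom k \<in> chart \<sigma>" using m k by (auto simp: chart_iff)
    ultimately show ?thesis using prime_ofD(7)[OF P, of "monom m" "monom k"] q1(3) q3(3)
      by (auto simp: monom_add)
  qed
  ultimately obtain q where q: "prime_of (chart ?\<upsilon>) q" "q \<inter> chart \<sigma> = p"
    using prime_of_localizes_extend[OF _ sub sub] by blast
  have sub1: "chart (\<rho> \<inter> \<sigma>) \<subseteq> chart ?\<upsilon>" "chart (\<sigma> \<inter> \<tau>) \<subseteq> chart ?\<upsilon>"
    "chart (\<rho> \<inter> \<tau>) \<subseteq> chart ?\<upsilon>" "chart \<rho> \<subseteq> chart (\<rho> \<inter> \<tau>)" "chart \<tau> \<subseteq> chart (\<rho> \<inter> \<tau>)"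
    "chart \<rho> \<subseteq> chart (\<rho> \<inter> \<sigma>)" "chart \<tau> \<subseteq> chart (\<sigma> \<inter> \<tau>)"
    "chart \<sigma> \<subseteq> chart (\<rho> \<inter> \<sigma>)" "chart \<sigma> \<subseteq> chart (\<sigma> \<inter> \<tau>)"
    by (rule chart_mono; blast)+
  \<comment> \<open>A prime of a localization is determined by its trace on the chart of \<sigma>,
    and both traces are p.\<close>
  have "q \<inter> chart (\<rho> \<inter> \<sigma>) = r1"
    by (rule prime_of_localizes_eq[OF lm sub sub prime_of_Int[OF q(1) sub sub1(1)] q1(1)])
      (use q(2) q1(3) sub1(8) in auto)
  moreover have "q \<inter> chart (\<sigma> \<inter> \<tau>) = r3"
    by (rule prime_of_localizes_eq[OF lk sub sub prime_of_Int[OF q(1) sub sub1(2)] q3(1)])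
      (use q(2) q3(3) sub1(9) in auto)
  ultimately have "p1 = (q \<inter> chart (\<rho> \<inter> \<tau>)) \<inter> chart \<rho>" "p3 = (q \<inter> chart (\<rho> \<inter> \<tau>)) \<inter> chart \<tau>"
    using q1(2) q3(2) sub1 by blast+
  moreover have "q \<inter> chart (\<rho> \<inter> \<tau>) \<in> Spec (\<rho> \<inter> \<tau>)"
    unfolding Spec_iff by (rule prime_of_Int[OF q(1) sub sub1(3)])
  ultimately show ?thesis using \<Sigma> by (auto simp: gluing_iff)
qed

lemma gluing_sym: "(x, y) \<in> gluing \<Sigma> \<Longrightarrow> (y, x) \<in> gluing \<Sigma>"
  by (cases x; cases y) (auto simp: gluing_iff Int_commute)

lemma gluing_refl: "\<sigma> \<in> \<Sigma> \<Longrightarrow> p \<in> Spec \<sigma> \<Longrightarrow> ((\<sigma>, p), (\<sigma>, p)) \<in> gluing \<Sigma>"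
  using prime_ofD(1)[of "chart \<sigma>" p] by (auto simp: gluing_iff Spec_iff intro!: bexI[of _ p])

abbreviation "X \<equiv> toric_points \<Sigma>"

definition pt :: "(real ^ 'n) set \<Rightarrow> 'n laurent set \<Rightarrow> 'n chart_point set" where
  "pt \<sigma> p = gluing \<Sigma> `` {(\<sigma>, p)}"

lemma toric_points_iff: "x \<in> X \<longleftrightarrow> (\<exists>\<sigma>\<in>\<Sigma>. \<exists>p\<in>Spec \<sigma>. x = pt \<sigma> p)"
  unfolding toric_points_def quotient_def pt_def by blast

lemma pt_in [simp]: "\<sigma> \<in> \<Sigma> \<Longrightarrow> p \<in> Spec \<sigma> \<Longrightarrow> pt \<sigma> p \<in> X"
  by (auto simp: toric_points_iff)

lemma pt_eqI: "((\<sigma>, p), (\<sigma>', p')) \<in> gluing \<Sigma> \<Longrightarrow> pt \<sigma> p = pt \<sigma>' p'"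
proof -
  assume *: "((\<sigma>, p), (\<sigma>', p')) \<in> gluing \<Sigma>"
  have "((\<sigma>, p), x) \<in> gluing \<Sigma> \<longleftrightarrow> ((\<sigma>', p'), x) \<in> gluing \<Sigma>" for x
    using gluing_trans[OF *] gluing_trans[OF gluing_sym[OF *]] by (cases x) blast
  then show ?thesis by (simp add: pt_def Image_singleton)
qed

lemma pt_subcone:
  assumes "\<sigma> \<in> \<Sigma>" "\<tau> \<in> \<Sigma>" "\<tau> \<subseteq> \<sigma>" "q \<in> Spec \<tau>"
  shows "pt \<tau> q = pt \<sigma> (q \<inter> chart \<sigma>)"
proof (rule pt_eqI)
  have "\<tau> \<inter> \<sigma> = \<tau>" using assms by auto
  then show "((\<tau>, q), (\<sigma>, q \<inter> chart \<sigma>)) \<in> gluing \<Sigma>"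
    using assms prime_ofD(1)[of "chart \<tau>" q] by (auto simp: gluing_iff Spec_iff intro!: bexI[of _ q])
qed

lemma loc_subcone:
  assumes "\<sigma> \<in> \<Sigma>" "\<tau> \<in> \<Sigma>" "\<tau> \<subseteq> \<sigma>" "q \<in> Spec \<tau>"
  shows "loc_ring (chart \<sigma>) (q \<inter> chart \<sigma>) = loc_ring (chart \<tau>) q"
    "loc_units (chart \<sigma>) (q \<inter> chart \<sigma>) = loc_units (chart \<tau>) q"
proof -
  obtain s where "localizes (chart \<sigma>) (chart \<tau>) s" using localizes_subcone assms by metis
  then show "loc_ring (chart \<sigma>) (q \<inter> chart \<sigma>) = loc_ring (chart \<tau>) q"
    "loc_units (chart \<sigma>) (q \<inter> chart \<sigma>) = loc_units (chart \<tau>) q"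
    using localizes_loc[OF _ subring_chart subring_chart] assms(4) by (simp_all add: Spec_iff)
qed

lemma local_ring_pt:
  assumes "\<sigma> \<in> \<Sigma>" "p \<in> Spec \<sigma>" shows "local_ring (pt \<sigma> p) = loc_ring (chart \<sigma>) p"
proof -
  \<comment> \<open>Two representatives are traces of one prime on the overlap, and both local rings
    equal the local ring there.\<close>
  have eq: "loc_ring (chart \<sigma>') p' = loc_ring (chart \<sigma>) p" if mem: "(\<sigma>', p') \<in> pt \<sigma> p" for \<sigma>' p'
  proof -
    obtain q where q: "q \<in> Spec (\<sigma> \<inter> \<sigma>')" "p = q \<inter> chart \<sigma>" "p' = q \<inter> chart \<sigma>'" "\<sigma>' \<in> \<Sigma>"
      using mem unfolding pt_def by (auto simp: gluing_iff)
    then show ?thesis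
      using loc_subcone(1)[OF assms(1) Int_cone[OF assms(1) q(4)] _ q(1)]
        loc_subcone(1)[OF q(4) Int_cone[OF assms(1) q(4)] _ q(1)] by simp
  qed
  have mem: "(\<sigma>, p) \<in> pt \<sigma> p" using gluing_refl[OF assms] by (simp add: pt_def)
  have "local_ring (pt \<sigma> p) = (\<Union>(\<sigma>', p')\<in>pt \<sigma> p. loc_ring (chart \<sigma>') p')"
    by (simp add: local_ring_def loc_ring_def)
  also have "\<dots> = (\<Union>x\<in>pt \<sigma> p. loc_ring (chart \<sigma>) p)"
    by (rule SUP_cong) (use eq in auto)
  also have "\<dots> = loc_ring (chart \<sigma>) p" using mem by blast
  finally show ?thesis .
qed

lemma local_units_pt:
  "\<sigma> \<in> \<Sigma> \<Longrightarrow> p \<in> Spec \<sigma> \<Longrightarrow> local_units (pt \<sigma> p) = loc_units (chart \<sigma>) p"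
  by (simp add: local_units_def local_ring_pt loc_units_eq[OF _ subring_chart] Spec_iff)

end

section \<open>Cartier divisors on a toric variety\<close>

context toric_fan
begin

lemma local_units_props:
  assumes "x \<in> X"
  shows "1 \<in> local_units x" "u \<in> local_units x \<Longrightarrow> v \<in> local_units x \<Longrightarrow> u * v \<in> local_units x"
    "u \<in> local_units x \<Longrightarrow> inverse u \<in> local_units x" "u \<in> local_units x \<Longrightarrow> u \<noteq> 0"
proof -
  obtain \<sigma> p where "\<sigma> \<in> \<Sigma>" "p \<in> Spec \<sigma>" "x = pt \<sigma> p" using assms by (auto simp: toric_points_iff)
  then have "local_units x = loc_units (chart \<sigma>) p" "prime_of (chart \<sigma>) p" by (simp_all add: local_units_pt Spec_iff)
  then show "1 \<in> local_units x" "u \<in> local_units x \<Longrightarrow> v \<in> local_units x \<Longrightarrow> u * v \<in> local_units x"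
    "u \<in> local_units x \<Longrightarrow> inverse u \<in> local_units x" "u \<in> local_units x \<Longrightarrow> u \<noteq> 0"
    using loc_units_1 loc_units_mult loc_units_inverse loc_units_nz subring_chart by metis+
qed

definition coset :: "'n function_field \<Rightarrow> 'n chart_point set \<Rightarrow> 'n function_field set" where
  "coset f x = (*) f ` local_units x"

lemma principal_divisor_at: "x \<in> X \<Longrightarrow> principal_divisor \<Sigma> f x = coset f x"
  by (simp add: principal_divisor_def coset_def)

lemma coset_iff: "f \<noteq> 0 \<Longrightarrow> a \<in> coset f x \<longleftrightarrow> a / f \<in> local_units x"
  unfolding coset_def by (auto simp: image_iff intro!: bexI[of _ "a / f"])

lemma coset_mult:
  assumes "x \<in> X" "f \<noteq> 0" "g \<noteq> 0"
  shows "{a * b | a b. a \<in> coset f x \<and> b \<in> coset g x} = coset (f * g) x"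
proof
  note U = local_units_props[OF assms(1)]
  show "{a * b | a b. a \<in> coset f x \<and> b \<in> coset g x} \<subseteq> coset (f * g) x"
  proof
    fix c assume "c \<in> {a * b | a b. a \<in> coset f x \<and> b \<in> coset g x}"
    then obtain a b where ab: "c = a * b" "a / f \<in> local_units x" "b / g \<in> local_units x"
      using assms by (auto simp: coset_iff)
    have "c / (f * g) = (a / f) * (b / g)" by (simp add: ab(1))
    also have "\<dots> \<in> local_units x" by (rule U(2)[OF ab(2,3)])
    finally show "c \<in> coset (f * g) x" using assms by (simp add: coset_iff)
  qed
  show "coset (f * g) x \<subseteq> {a * b | a b. a \<in> coset f x \<and> b \<in> coset g x}"
  proof
    fix c assume "c \<in> coset (f * g) x"
    then have "c = (c / g) * g" "c / g \<in> coset f x" "g \<in> coset g x"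
      using assms U(1) by (auto simp: coset_iff mult.commute)
    then show "c \<in> {a * b | a b. a \<in> coset f x \<and> b \<in> coset g x}" by blast
  qed
qed

lemma coset_eq_iff:
  assumes x: "x \<in> X" and nz: "f \<noteq> 0" "g \<noteq> 0"
  shows "coset f x = coset g x \<longleftrightarrow> f / g \<in> local_units x"
proof
  note U = local_units_props[OF x]
  assume "coset f x = coset g x"
  moreover have "f \<in> coset f x" using nz U(1) by (simp add: coset_iff)
  ultimately show "f / g \<in> local_units x" using coset_iff[OF nz(2)] by auto
next
  note U = local_units_props[OF x]
  assume fg: "f / g \<in> local_units x"
  then have gf: "g / f \<in> local_units x" using U(3)[OF fg] by simp
  have "a / f \<in> local_units x \<longleftrightarrow> a / g \<in> local_units x" for a
    using U(2)[OF _ fg, of "a / f"] U(2)[OF _ gf, of "a / g"] nz by auto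
  then show "coset f x = coset g x" using nz by (auto simp: coset_iff)
qed

lemma coset_1: "coset 1 x = local_units x"
  by (auto simp: coset_def)

lemma coset_1_iff: "x \<in> X \<Longrightarrow> f \<noteq> 0 \<Longrightarrow> coset f x = local_units x \<longleftrightarrow> f \<in> local_units x"
  using coset_eq_iff[of x f 1] by (simp add: coset_1)

lemma toric_open_all: "toric_open \<Sigma> X"
  unfolding toric_open_def
proof (intro conjI ballI)
  fix \<sigma> assume \<sigma>: "\<sigma> \<in> \<Sigma>"
  have "{p \<in> Spec \<sigma>. gluing \<Sigma> `` {(\<sigma>, p)} \<in> X} = {p \<in> Spec \<sigma>. \<not> {1} \<subseteq> p}"
    using \<sigma> prime_ofD(3) by (auto simp flip: pt_def simp: Spec_iff)
  then show "\<exists>T\<subseteq>chart \<sigma>. {p \<in> Spec \<sigma>. gluing \<Sigma> `` {(\<sigma>, p)} \<in> X} = {p \<in> Spec \<sigma>. \<not> T \<subseteq> p}"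
    using subring_setD(2)[OF subring_chart] by (intro exI[of _ "{1}"]) auto
qed auto

lemma toric_open_Int:
  assumes "toric_open \<Sigma> U" "toric_open \<Sigma> V" shows "toric_open \<Sigma> (U \<inter> V)"
  unfolding toric_open_def
proof (intro conjI ballI)
  show "U \<inter> V \<subseteq> X" using assms by (auto simp: toric_open_def)
  fix \<sigma> assume \<sigma>: "\<sigma> \<in> \<Sigma>"
  let ?S = "\<lambda>U. {p \<in> Spec \<sigma>. gluing \<Sigma> `` {(\<sigma>, p)} \<in> U}"
  obtain S where S: "S \<subseteq> chart \<sigma>" "?S U = {p \<in> Spec \<sigma>. \<not> S \<subseteq> p}"
    using assms(1) \<sigma> unfolding toric_open_def by meson
  obtain T where T: "T \<subseteq> chart \<sigma>" "?S V = {p \<in> Spec \<sigma>. \<not> T \<subseteq> p}"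
    using assms(2) \<sigma> unfolding toric_open_def by meson
  \<comment> \<open>A prime contains all these products exactly if it contains S or T.\<close>
  define R where "R = {a * b | a b. a \<in> S \<and> b \<in> T}"
  have "\<not> R \<subseteq> p \<longleftrightarrow> \<not> S \<subseteq> p \<and> \<not> T \<subseteq> p" if "p \<in> Spec \<sigma>" for p
  proof -
    have p: "prime_of (chart \<sigma>) p" using that by (simp add: Spec_iff)
    have "a * b \<in> p \<longleftrightarrow> a \<in> p \<or> b \<in> p" if "a \<in> S" "b \<in> T" for a b
      using prime_ofD(5)[OF p, of a b] prime_ofD(6)[OF p, of b a] prime_ofD(7)[OF p, of a b] that S(1) T(1) by blast
    then show ?thesis unfolding R_def by blast
  qed
  moreover have "?S (U \<inter> V) = ?S U \<inter> ?S V" by auto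
  ultimately have "?S (U \<inter> V) = {p \<in> Spec \<sigma>. \<not> R \<subseteq> p}" unfolding S(2) T(2) by auto
  moreover have "R \<subseteq> chart \<sigma>" unfolding R_def using S T subring_setD(4)[OF subring_chart] by blast
  ultimately show "\<exists>T\<subseteq>chart \<sigma>. ?S (U \<inter> V) = {p \<in> Spec \<sigma>. \<not> T \<subseteq> p}"
    by (intro exI[of _ R] conjI)
qed

abbreviation "CG \<equiv> cartier_group \<Sigma>"
abbreviation "CDiv \<equiv> carrier CG"
abbreviation cartier_mult (infixl \<open>\<odot>\<close> 70) where "D \<odot> E \<equiv> D \<otimes>\<^bsub>CG\<^esub> E"
abbreviation "PG \<equiv> picard_group \<Sigma>"

lemma CDiv_iff:
  "D \<in> CDiv \<longleftrightarrow> D \<in> extensional X \<and>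
     (\<forall>x\<in>X. \<exists>U f. toric_open \<Sigma> U \<and> x \<in> U \<and> f \<noteq> 0 \<and> (\<forall>y\<in>U. D y = coset f y))"
proof -
  have "(\<forall>y\<in>U. D y = principal_divisor \<Sigma> f y) \<longleftrightarrow> (\<forall>y\<in>U. D y = coset f y)" if "toric_open \<Sigma> U" for U f
    using that principal_divisor_at unfolding toric_open_def by (metis subsetD)
  note eq = this
  have "(\<exists>U f. toric_open \<Sigma> U \<and> x \<in> U \<and> f \<noteq> 0 \<and> (\<forall>y\<in>U. D y = principal_divisor \<Sigma> f y)) =
      (\<exists>U f. toric_open \<Sigma> U \<and> x \<in> U \<and> f \<noteq> 0 \<and> (\<forall>y\<in>U. D y = coset f y))" for x
    using eq by blast
  then show ?thesis unfolding cartier_group_def by simp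
qed

lemma CDiv_at:
  assumes "D \<in> CDiv" "x \<in> X" obtains f where "f \<noteq> 0" "D x = coset f x"
  using assms by (fastforce simp: CDiv_iff)

text \<open>The neighbourhood is shrunk to the basic open set where h does not vanish. To transfer
  the equation to another prime, one then only checks that h is outside it.\<close>

lemma CDiv_local:
  assumes D: "D \<in> CDiv" and \<sigma>: "\<sigma> \<in> \<Sigma>" and p: "p \<in> Spec \<sigma>"
  obtains f h where "f \<noteq> 0" "h \<in> chart \<sigma>" "h \<notin> p"
    "\<And>q. q \<in> Spec \<sigma> \<Longrightarrow> h \<notin> q \<Longrightarrow> D (pt \<sigma> q) = coset f (pt \<sigma> q)"
proof -
  obtain U f where U: "toric_open \<Sigma> U" "pt \<sigma> p \<in> U" "f \<noteq> 0" "\<And>y. y \<in> U \<Longrightarrow> D y = coset f y"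
    using D pt_in[OF \<sigma> p] unfolding CDiv_iff by blast
  obtain T where T: "T \<subseteq> chart \<sigma>" "{p \<in> Spec \<sigma>. pt \<sigma> p \<in> U} = {p \<in> Spec \<sigma>. \<not> T \<subseteq> p}"
    using U(1) \<sigma> unfolding toric_open_def pt_def by meson
  have "\<not> T \<subseteq> p" using T(2) p U(2) by blast
  then obtain h where h: "h \<in> T" "h \<notin> p" by blast
  show ?thesis
  proof (rule that[of f h])
    fix q assume "q \<in> Spec \<sigma>" "h \<notin> q"
    then have "pt \<sigma> q \<in> U" using T(2) h by blast
    then show "D (pt \<sigma> q) = coset f (pt \<sigma> q)" by (rule U(4))
  qed (use U h T in auto)
qed

lemma principal_in_CDiv: "f \<noteq> 0 \<Longrightarrow> principal_divisor \<Sigma> f \<in> CDiv"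
  unfolding CDiv_iff using toric_open_all principal_divisor_at
  by (auto simp: principal_divisor_def intro!: exI[of _ X] exI[of _ f])

lemma cartier_mult_at:
  "x \<in> X \<Longrightarrow> (D \<odot> E) x = {a * b | a b. a \<in> D x \<and> b \<in> E x}"
  by (simp add: cartier_group_def)

lemma cartier_mult_coset:
  assumes "x \<in> X" "D x = coset f x" "E x = coset g x" "f \<noteq> 0" "g \<noteq> 0"
  shows "(D \<odot> E) x = coset (f * g) x"
  using assms by (simp add: cartier_mult_at coset_mult)

lemma cartier_mult_ext: "D \<odot> E \<in> extensional X"
  by (simp add: cartier_group_def)

lemma cartier_mult_closed:
  assumes D: "D \<in> CDiv" and E: "E \<in> CDiv" shows "D \<odot> E \<in> CDiv"
  unfolding CDiv_iff
proof (intro conjI ballI cartier_mult_ext)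
  fix x assume x: "x \<in> X"
  obtain U f where U: "toric_open \<Sigma> U" "x \<in> U" "f \<noteq> 0" "\<And>y. y \<in> U \<Longrightarrow> D y = coset f y"
    using D x unfolding CDiv_iff by blast
  obtain V g where V: "toric_open \<Sigma> V" "x \<in> V" "g \<noteq> 0" "\<And>y. y \<in> V \<Longrightarrow> E y = coset g y"
    using E x unfolding CDiv_iff by blast
  have "(D \<odot> E) y = coset (f * g) y" if "y \<in> U \<inter> V" for y
    using that U V by (intro cartier_mult_coset) (auto simp: toric_open_def)
  then show "\<exists>W h. toric_open \<Sigma> W \<and> x \<in> W \<and> h \<noteq> 0 \<and> (\<forall>y\<in>W. (D \<odot> E) y = coset h y)"
    using toric_open_Int[OF U(1) V(1)] U V by (intro exI[of _ "U \<inter> V"] exI[of _ "f * g"]) auto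
qed

lemma cartier_one: "\<one>\<^bsub>CG\<^esub> = principal_divisor \<Sigma> 1"
  by (simp add: cartier_group_def)

lemma cartier_inverse:
  assumes D: "D \<in> CDiv"
  shows "\<exists>E\<in>CDiv. E \<odot> D = \<one>\<^bsub>CG\<^esub>"
proof
  \<comment> \<open>The local units are stable under inversion, so inverting a coset pointwise
    yields the coset of the inverse equation.\<close>
  define E where "E = (\<lambda>x\<in>X. inverse ` D x)"
  have inv: "inverse ` coset f x = coset (inverse f) x" if x: "x \<in> X" and f: "f \<noteq> 0" for f x
  proof -
    note U = local_units_props[OF x]
    have "inverse ` local_units x = local_units x"
      using U(3) by (force simp: image_iff intro: bexI[of _ "inverse _"])
    then show ?thesis unfolding coset_def
      by (metis (mono_tags, lifting) image_image image_cong inverse_mult_distrib)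
  qed
  show "E \<in> CDiv"
    unfolding CDiv_iff
  proof (intro conjI ballI)
    show "E \<in> extensional X" by (simp add: E_def)
    fix x assume x: "x \<in> X"
    obtain U f where U: "toric_open \<Sigma> U" "x \<in> U" "f \<noteq> 0" "\<And>y. y \<in> U \<Longrightarrow> D y = coset f y"
      using D x unfolding CDiv_iff by blast
    have "E y = coset (inverse f) y" if "y \<in> U" for y
      using U(1) inv[of y f] U(3,4) that by (auto simp: E_def toric_open_def)
    then show "\<exists>W h. toric_open \<Sigma> W \<and> x \<in> W \<and> h \<noteq> 0 \<and> (\<forall>y\<in>W. E y = coset h y)"
      using U by (intro exI[of _ U] exI[of _ "inverse f"]) auto
  qed
  show "E \<odot> D = \<one>\<^bsub>CG\<^esub>"
  proof (rule extensionalityI[of _ X])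
    fix x assume x: "x \<in> X"
    obtain f where f: "f \<noteq> 0" "D x = coset f x" using CDiv_at[OF D x] by blast
    then have "E x = coset (inverse f) x" using inv[OF x] x by (simp add: E_def)
    then have "(E \<odot> D) x = coset (inverse f * f) x"
      using f x by (intro cartier_mult_coset) auto
    then show "(E \<odot> D) x = \<one>\<^bsub>CG\<^esub> x"
      using f x by (simp add: cartier_one principal_divisor_at)
  qed (simp_all add: cartier_mult_ext cartier_one principal_divisor_def)
qed

lemma comm_group_cartier: "comm_group CG"
proof (rule comm_groupI)
  show one: "\<one>\<^bsub>CG\<^esub> \<in> CDiv" by (simp add: cartier_one principal_in_CDiv)
next
  fix D E F assume D: "D \<in> CDiv" and E: "E \<in> CDiv" and F: "F \<in> CDiv"
  show "D \<odot> E \<odot> F = D \<odot> (E \<odot> F)"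
  proof (rule extensionalityI[of _ X])
    fix x assume x: "x \<in> X"
    obtain f where f: "f \<noteq> 0" "D x = coset f x" using CDiv_at[OF D x] by blast
    obtain g where g: "g \<noteq> 0" "E x = coset g x" using CDiv_at[OF E x] by blast
    obtain h where h: "h \<noteq> 0" "F x = coset h x" using CDiv_at[OF F x] by blast
    have "(D \<odot> E \<odot> F) x = coset (f * g * h) x"
      using f g h x by (intro cartier_mult_coset) auto
    moreover have "(D \<odot> (E \<odot> F)) x = coset (f * (g * h)) x"
      using f g h x by (intro cartier_mult_coset) auto
    ultimately show "(D \<odot> E \<odot> F) x =
        (D \<odot> (E \<odot> F)) x" by (simp add: mult.assoc)
  qed (rule cartier_mult_ext)+
next
  fix D E assume D: "D \<in> CDiv" and E: "E \<in> CDiv"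
  show "D \<odot> E = E \<odot> D"
  proof (rule extensionalityI[of _ X])
    fix x assume x: "x \<in> X"
    show "(D \<odot> E) x = (E \<odot> D) x"
      unfolding cartier_mult_at[OF x] by (metis (no_types, opaque_lifting) mult.commute)
  qed (rule cartier_mult_ext)+
next
  fix D assume D: "D \<in> CDiv"
  show "\<one>\<^bsub>CG\<^esub> \<odot> D = D"
  proof (rule extensionalityI[of _ X])
    fix x assume x: "x \<in> X"
    obtain f where f: "f \<noteq> 0" "D x = coset f x" using CDiv_at[OF D x] by blast
    have "(\<one>\<^bsub>CG\<^esub> \<odot> D) x = coset (1 * f) x"
      by (rule cartier_mult_coset) (use f x in \<open>auto simp: cartier_one principal_divisor_at\<close>)
    then show "(\<one>\<^bsub>CG\<^esub> \<odot> D) x = D x" using f by simp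
  qed (use D in \<open>auto simp: cartier_mult_ext CDiv_iff\<close>)
qed (simp_all add: cartier_mult_closed cartier_inverse)

lemma principal_mult:
  assumes "f \<noteq> 0" "g \<noteq> 0"
  shows "principal_divisor \<Sigma> f \<odot> principal_divisor \<Sigma> g = principal_divisor \<Sigma> (f * g)"
proof (rule extensionalityI[of _ X])
  fix x assume x: "x \<in> X"
  have "(principal_divisor \<Sigma> f \<odot> principal_divisor \<Sigma> g) x = coset (f * g) x"
    using assms x by (intro cartier_mult_coset) (auto simp: principal_divisor_at)
  then show "(principal_divisor \<Sigma> f \<odot> principal_divisor \<Sigma> g) x = principal_divisor \<Sigma> (f * g) x"
    using x by (simp add: principal_divisor_at)
qed (simp_all add: cartier_mult_ext principal_divisor_def)

lemma subgroup_principal: "subgroup (principal_divisor \<Sigma> ` (- {0})) CG"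
proof -
  interpret comm_group CG by (rule comm_group_cartier)
  show ?thesis
  proof (rule subgroupI)
    fix D assume "D \<in> principal_divisor \<Sigma> ` (- {0})"
    then obtain f where f: "f \<noteq> 0" "D = principal_divisor \<Sigma> f" by auto
    then have "principal_divisor \<Sigma> (inverse f) \<odot> D = \<one>\<^bsub>CG\<^esub>"
      by (simp add: principal_mult cartier_one)
    then have "inv\<^bsub>CG\<^esub> D = principal_divisor \<Sigma> (inverse f)"
      using f by (intro inv_equality) (auto simp: principal_in_CDiv)
    then show "inv\<^bsub>CG\<^esub> D \<in> principal_divisor \<Sigma> ` (- {0})" using f by auto
  next
    have "(1 :: 'n function_field) \<in> - {0}" by simp
    then show "principal_divisor \<Sigma> ` (- {0}) \<noteq> {}" by blast
  next
    show "principal_divisor \<Sigma> ` (- {0}) \<subseteq> CDiv" using principal_in_CDiv by blast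
  qed (auto simp: principal_mult)
qed

lemma comm_group_picard: "comm_group PG"
  unfolding picard_group_def
  by (rule comm_group.abelian_FactGroup[OF comm_group_cartier subgroup_principal])

end

section \<open>Primes of a chart\<close>

text \<open>For v on a ray of a rational cone this is the generic point of a torus-invariant prime
  divisor; for other v in \<sigma> it is that of the orbit closure of the face whose relative
  interior contains v. Allowing all v makes it possible to compare cones at any common
  vector.\<close>

definition ray_prime :: "(real ^ 'n) set \<Rightarrow> real ^ 'n \<Rightarrow> 'n::finite laurent set" where
  "ray_prime \<sigma> v = {f \<in> chart \<sigma>. \<forall>m\<in>supp f. 0 < pair m v}"

text \<open>The functions without constant term: for a full-dimensional cone, the maximal ideal of
  the torus-fixed point.\<close>

definition fixed_prime :: "(real ^ 'n) set \<Rightarrow> 'n::finite laurent set" where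
  "fixed_prime \<sigma> = {f \<in> chart \<sigma>. 0 \<notin> supp f}"

definition multiples :: "'a::comm_semiring_1 \<Rightarrow> 'a set" where
  "multiples g = {f. g dvd f}"

definition chi :: "int ^ 'n \<Rightarrow> 'n::finite function_field" where
  "chi m = Fract (monom m) 1"

lemma chi_add: "chi (m + k) = chi m * chi k"
  by (simp add: chi_def monom_add)

lemma chi_0 [simp]: "chi 0 = 1"
  by (simp add: chi_def One_fract_def)

lemma chi_nz [simp]: "chi m \<noteq> 0"
  by (simp add: chi_def Fract_eq_0)

lemma chi_diff: "chi (m - k) = chi m / chi k"
  using chi_add[of "m - k" k] by (simp add: field_simps)

lemma chart_zero_cone: "chart {0} = UNIV"
  by (auto simp: chart_iff dual_semigroup_pair)

lemma prime_of_multiples: "prime_elem g \<Longrightarrow> prime_of UNIV (multiples g)"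
  for g :: "'a::idom"
  by (auto simp: prime_of_def multiples_def prime_elem_def)

lemma Spec_multiples: "prime_elem g \<Longrightarrow> multiples g \<in> Spec {0}"
  by (simp add: Spec_iff chart_zero_cone prime_of_multiples)

lemma Spec_zero: "{0} \<in> Spec {0}"
  by (auto simp: Spec_iff chart_zero_cone prime_of_def)

lemma Spec_ray:
  assumes "v \<in> \<sigma>" shows "ray_prime \<sigma> v \<in> Spec \<sigma>"
  unfolding Spec_iff prime_of_def
proof (intro conjI ballI impI)
  note A = subring_setD[OF subring_chart[of \<sigma>]]
  have nn: "0 \<le> pair m v" if "f \<in> chart \<sigma>" "m \<in> supp f" for f m
    using that assms by (auto simp: chart_iff dual_semigroup_pair)
  show "ray_prime \<sigma> v \<subseteq> chart \<sigma>" "0 \<in> ray_prime \<sigma> v" "1 \<notin> ray_prime \<sigma> v"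
    using A by (auto simp: ray_prime_def)
  fix f g
  {
    assume "f \<in> ray_prime \<sigma> v" "g \<in> ray_prime \<sigma> v"
    then show "f + g \<in> ray_prime \<sigma> v" using supp_add[of f g] A(3) by (auto simp: ray_prime_def)
  }
  {
    assume f: "f \<in> chart \<sigma>" and g: "g \<in> ray_prime \<sigma> v"
    have "0 < pair m v" if "m \<in> supp (f * g)" for m
    proof -
      obtain k l where "m = k + l" "k \<in> supp f" "l \<in> supp g" using \<open>m \<in> supp (f * g)\<close> by (rule supp_multE)
      then show ?thesis using nn[OF f, of k] g by (auto simp: ray_prime_def pair_add intro: add_nonneg_pos)
    qed
    then show "f * g \<in> ray_prime \<sigma> v" using f g A(4) by (auto simp: ray_prime_def)
  }
  {
    assume fg: "f \<in> chart \<sigma>" "g \<in> chart \<sigma>" "f * g \<in> ray_prime \<sigma> v"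
    let ?C = "{m. pair m v = 0}"
    \<comment> \<open>On the chart all weights are nonnegative, so the part of weight 0 is
      multiplicative; the ideal is the kernel of this projection to a domain.\<close>
    have "restr ?C (f * g) = restr ?C f * restr ?C g"
      by (rule restr_mult) (use nn fg in \<open>auto simp: pair_add add_nonneg_eq_0_iff\<close>)
    moreover have "restr ?C (f * g) = 0"
      by (rule restr_disjoint) (use fg(3) in \<open>force simp: ray_prime_def\<close>)
    ultimately have "restr ?C f = 0 \<or> restr ?C g = 0" by simp
    then have "supp f \<inter> ?C = {} \<or> supp g \<inter> ?C = {}" by (metis supp_0 supp_restr)
    then show "f \<in> ray_prime \<sigma> v \<or> g \<in> ray_prime \<sigma> v"
      using nn fg(1,2) unfolding ray_prime_def by (fastforce simp: less_le)
  }
qed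

lemma Spec_fixed:
  assumes pointed: "\<And>m. m \<in> dual_semigroup \<sigma> \<Longrightarrow> - m \<in> dual_semigroup \<sigma> \<Longrightarrow> m = 0"
  shows "fixed_prime \<sigma> \<in> Spec \<sigma>"
  unfolding Spec_iff prime_of_def
proof (intro conjI ballI impI)
  note A = subring_setD[OF subring_chart[of \<sigma>]]
  \<comment> \<open>As the dual cone contains no line, 0 arises only as 0 + 0; taking the constant
    term is therefore multiplicative.\<close>
  have zero: "k = 0 \<and> l = 0" if "k + l = 0" "f \<in> chart \<sigma>" "g \<in> chart \<sigma>" "k \<in> supp f" "l \<in> supp g" for f g k l
  proof -
    have "l = - k" using that(1) by (metis add.commute eq_neg_iff_add_eq_0)
    then show ?thesis using pointed[of k] that by (auto simp: chart_iff)
  qed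
  show "fixed_prime \<sigma> \<subseteq> chart \<sigma>" "0 \<in> fixed_prime \<sigma>" "1 \<notin> fixed_prime \<sigma>"
    using A by (auto simp: fixed_prime_def)
  fix f g
  {
    assume "f \<in> fixed_prime \<sigma>" "g \<in> fixed_prime \<sigma>"
    then show "f + g \<in> fixed_prime \<sigma>" using supp_add[of f g] A(3) by (auto simp: fixed_prime_def)
  }
  {
    assume f: "f \<in> chart \<sigma>" and g: "g \<in> fixed_prime \<sigma>"
    have "0 \<notin> supp (f * g)"
    proof
      assume "0 \<in> supp (f * g)"
      then obtain k l where "0 = k + l" "k \<in> supp f" "l \<in> supp g" by (rule supp_multE)
      then show False using zero[of k l f g] f g by (auto simp: fixed_prime_def)
    qed
    then show "f * g \<in> fixed_prime \<sigma>" using f g A(4) by (auto simp: fixed_prime_def)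
  }
  {
    assume fg: "f \<in> chart \<sigma>" "g \<in> chart \<sigma>" "f * g \<in> fixed_prime \<sigma>"
    have "restr {0} (f * g) = restr {0} f * restr {0} g"
    proof (rule restr_mult)
      fix k l assume "k \<in> supp f" "l \<in> supp g"
      then show "k + l \<in> {0} \<longleftrightarrow> k \<in> {0} \<and> l \<in> {0}" using zero[of k l f g] fg by auto
    qed
    moreover have "restr {0} (f * g) = 0" by (rule restr_disjoint) (use fg(3) in \<open>auto simp: fixed_prime_def\<close>)
    ultimately have "restr {0} f = 0 \<or> restr {0} g = 0" by simp
    then have "supp f \<inter> {0} = {} \<or> supp g \<inter> {0} = {}" by (metis supp_0 supp_restr)
    then show "f \<in> fixed_prime \<sigma> \<or> g \<in> fixed_prime \<sigma>"
      using fg(1,2) by (auto simp: fixed_prime_def)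
  }
qed

lemma ray_subset_fixed: "ray_prime \<sigma> v \<subseteq> fixed_prime \<sigma>"
  by (auto simp: ray_prime_def fixed_prime_def)

lemma ray_prime_Int: "\<tau> \<subseteq> \<sigma> \<Longrightarrow> ray_prime \<tau> v \<inter> chart \<sigma> = ray_prime \<sigma> v"
  using chart_iff by (fastforce simp: ray_prime_def dual_semigroup_pair chart_iff)

text \<open>Elements of the chart outside the ray prime have valuation 0 at v, and so has every
  quotient of two of them.\<close>

lemma chi_unit_ray:
  assumes "v \<in> \<sigma>" "chi m \<in> loc_units (chart \<sigma>) (ray_prime \<sigma> v)"
  shows "pair m v = 0"
proof -
  obtain a b where ab: "chi m = Fract a b" "a \<in> chart \<sigma> - ray_prime \<sigma> v" "b \<in> chart \<sigma> - ray_prime \<sigma> v"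
    using assms(2) unfolding loc_units_def by blast
  have low: "low_at v a = 0" if a: "a \<in> chart \<sigma> - ray_prime \<sigma> v" for a
  proof -
    have nn: "0 \<le> pair m v" if "m \<in> supp a" for m
      using that assms(1) a by (auto simp: chart_iff dual_semigroup_pair)
    obtain k where k: "k \<in> supp a" "pair k v \<le> 0" using a by (force simp: ray_prime_def)
    then show ?thesis using low_le[OF k(1), of "\<lambda>m. pair m v"] low_ge[of a 0 "\<lambda>m. pair m v"] nn by force
  qed
  have nz: "a \<noteq> 0" "b \<noteq> 0" using ab prime_ofD(2)[of "chart \<sigma>" "ray_prime \<sigma> v"] Spec_ray[OF assms(1)]
    by (auto simp: Spec_iff)
  then have "monom m * b = a" using ab(1) by (simp add: chi_def eq_fract)
  then have "low_at v a = pair m v + low_at v b"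
    using low_mult[of "monom m" b "\<lambda>m. pair m v"] nz by (simp add: pair_add)
  then show ?thesis using low ab by simp
qed

section \<open>Regularity tested in codimension one\<close>

lemma fract_coprime:
  fixes x :: "'n::finite function_field"
  shows "\<exists>a b. x = Fract a b \<and> b \<noteq> 0 \<and> (\<forall>p. prime_elem p \<longrightarrow> \<not> (p dvd a \<and> p dvd b))"
proof -
  obtain a b where ab: "x = Fract a b" "b \<noteq> 0" by (cases x)
  obtain a' b' where "b' \<noteq> 0" "a * b' = a' * b" "\<forall>p. prime_elem p \<longrightarrow> \<not> (p dvd a' \<and> p dvd b')"
    using coprime_decomp[OF ab(2), of a] by blast
  moreover from this have "x = Fract a' b'" using ab by (simp add: eq_fract)
  ultimately show ?thesis by blast
qed

lemma unit_at_prime: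
  fixes a b g :: "'n::finite laurent"
  assumes "prime_elem g" "Fract a b \<in> loc_units UNIV (multiples g)" "b \<noteq> 0"
  shows "g dvd a \<longleftrightarrow> g dvd b"
proof -
  obtain s t where st: "Fract a b = Fract s t" "\<not> g dvd s" "\<not> g dvd t"
    using assms(2) unfolding loc_units_def multiples_def by blast
  then have "t \<noteq> 0" by auto
  then have "a * t = s * b" using st assms by (simp add: eq_fract)
  then show ?thesis using st prime_elem_dvd_mult_iff[OF assms(1)] by metis
qed

text \<open>Geometrically, no prime divisor of b on the torus has p in its closure. Each prime
  factor then divides some element outside p, and the product of these elements is a multiple of
  b.\<close>

lemma dvd_nonmember:
  fixes b :: "'n::finite laurent"
  assumes "b \<noteq> 0" and p: "p \<in> Spec \<sigma>"
    and "\<And>g. prime_elem g \<Longrightarrow> g dvd b \<Longrightarrow> \<not> multiples g \<inter> chart \<sigma> \<subseteq> p"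
  shows "\<exists>e\<in>chart \<sigma> - p. b dvd e"
  using assms(1,3)
proof (induction rule: laurent_prime_induct)
  case (unit f)
  then have "f dvd 1" by simp
  then show ?case using one_nonmember[of "chart \<sigma>" p] p subring_chart by (intro bexI[of _ 1]) (auto simp: Spec_iff)
next
  case (prime g f)
  have P: "prime_of (chart \<sigma>) p" using p by (simp add: Spec_iff)
  obtain e where e: "e \<in> chart \<sigma> - p" "f dvd e" using prime.IH prime.prems by auto
  obtain e' where "e' \<in> chart \<sigma> - p" "g dvd e'" using prime.prems[OF prime.hyps(1)] by (auto simp: multiples_def)
  then have "e' * e \<in> chart \<sigma> - p" "g * f dvd e' * e"
    using e nonmember_mult[OF P subring_chart, of e' e] mult_dvd_mono[of g e' f e] by auto
  then show ?case by blast
qed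

lemma chart_generated:
  assumes "\<And>m. (\<forall>v\<in>V. 0 \<le> pair m v) \<Longrightarrow> m \<in> dual_semigroup \<sigma>"
    and "\<And>v m. v \<in> V \<Longrightarrow> m \<in> supp f \<Longrightarrow> 0 \<le> pair m v"
  shows "f \<in> chart \<sigma>"
  using assms by (auto simp: chart_iff)

text \<open>This is normality of the coordinate ring: the points of codimension one are those of the torus and
  the generic points of the torus-invariant prime divisors.\<close>

lemma regular_if_unit_in_codim_1:
  fixes f :: "'n::finite function_field"
  assumes p: "p \<in> Spec \<sigma>" and V: "finite V" "V \<subseteq> \<sigma>"
    and gen: "\<And>m. (\<forall>v\<in>V. 0 \<le> pair m v) \<Longrightarrow> m \<in> dual_semigroup \<sigma>"
    and prime: "\<And>g. prime_elem g \<Longrightarrow> multiples g \<inter> chart \<sigma> \<subseteq> p \<Longrightarrow> f \<in> loc_units UNIV (multiples g)"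
    and ray: "\<And>v. v \<in> V \<Longrightarrow> ray_prime \<sigma> v \<subseteq> p \<Longrightarrow> f \<in> loc_units (chart \<sigma>) (ray_prime \<sigma> v)"
  shows "f \<in> loc_ring (chart \<sigma>) p"
proof -
  have P: "prime_of (chart \<sigma>) p" using p by (simp add: Spec_iff)
  note sub = subring_chart[of \<sigma>]
  obtain a b where ab: "f = Fract a b" "b \<noteq> 0" "\<And>p. prime_elem p \<Longrightarrow> p dvd a \<Longrightarrow> p dvd b \<Longrightarrow> False"
    using fract_coprime[of f] by blast
  \<comment> \<open>A prime factor g of b passing through p would also divide a, since f is a unit
    at g; this contradicts coprimality.\<close>
  have "\<exists>e\<in>chart \<sigma> - p. b dvd e"
    by (rule dvd_nonmember[OF ab(2) p]) (use prime unit_at_prime[OF _ _ ab(2), of _ a] ab(1,3) in blast)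
  then obtain e c where e: "e \<in> chart \<sigma> - p" "e = b * c" by auto
  have e0: "e \<noteq> 0" using e prime_ofD(2)[OF P] by auto
  define a' where "a' = a * c"
  have f: "f = Fract a' e" using ab(1,2) e0 by (simp add: e(2) a'_def eq_fract mult_ac)
  \<comment> \<open>At a ray through p the valuations of f and e are nonnegative, and so is that of
    \<open>a' = f * e\<close>.\<close>
  have pos: "0 \<le> pair m v" if m: "m \<in> supp a'" and v: "v \<in> V" "ray_prime \<sigma> v \<subseteq> p" for m v
  proof -
    obtain s t where st: "f = Fract s t" "s \<in> chart \<sigma>" "t \<in> chart \<sigma>" "t \<notin> ray_prime \<sigma> v"
      using ray[OF v] unfolding loc_units_def by blast
    have t0: "t \<noteq> 0" and a'0: "a' \<noteq> 0" using st(4) m by (auto simp: ray_prime_def chart_iff)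
    have eq: "a' * t = s * e" using f st t0 e0 by (simp add: eq_fract)
    have nn: "0 \<le> pair m v" if "f \<in> chart \<sigma>" "m \<in> supp f" for f m
      using that v(1) V by (auto simp: chart_iff dual_semigroup_pair)
    obtain k where k: "k \<in> supp t" "pair k v \<le> 0" using st by (force simp: ray_prime_def)
    have "a' * t \<noteq> 0" using t0 a'0 by simp
    then have "0 \<le> low_at v (a' * t)"
      by (rule low_ge) (use nn subring_setD(4)[OF sub] st e eq in \<open>metis DiffD1\<close>)
    also have "\<dots> = low_at v a' + low_at v t"
      by (rule low_mult) (use t0 a'0 in \<open>auto simp: pair_add\<close>)
    also have "\<dots> \<le> pair m v + pair k v"
      using low_le[OF m, of "\<lambda>m. pair m v"] low_le[OF k(1), of "\<lambda>m. pair m v"] by auto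
    finally show ?thesis using k(2) by simp
  qed
  \<comment> \<open>For a ray not through p there is a function h outside p of positive valuation at
    v. A high power of h repairs the exponents at v and does no harm at the other
    generators.\<close>
  have clear: "W \<subseteq> V \<Longrightarrow> (\<And>v. v \<in> W \<Longrightarrow> \<not> ray_prime \<sigma> v \<subseteq> p) \<Longrightarrow>
      \<exists>d\<in>chart \<sigma> - p. \<forall>m\<in>supp (a' * d). \<forall>v\<in>W. 0 \<le> pair m v" if "finite W" for W
    using that
  proof (induction W)
    case empty
    then show ?case using one_nonmember[OF P sub] by auto
  next
    case (insert v W)
    obtain d where d: "d \<in> chart \<sigma> - p" "\<And>m v. m \<in> supp (a' * d) \<Longrightarrow> v \<in> W \<Longrightarrow> 0 \<le> pair m v"
      using insert by auto
    obtain h where h: "h \<in> ray_prime \<sigma> v" "h \<notin> p" using insert.prems(2)[of v] by blast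
    have hc: "h ^ N \<in> chart \<sigma> - p" for N
      using h prime_of_power[OF P sub, of h N] subring_setD(6)[OF sub, of h N] by (auto simp: ray_prime_def)
    have h0: "h \<noteq> 0" using h prime_ofD(2)[OF P] by auto
    have lowh: "0 < low_at v h"
      using low_attained[OF h0, of "\<lambda>m. pair m v"] h(1) unfolding ray_prime_def by (metis (mono_tags, lifting) mem_Collect_eq)
    have lowN: "low_at v (h ^ N) = real N * low_at v h" for N
    proof (induction N)
      case (Suc N)
      then show ?case using low_mult[of h "h ^ N" "\<lambda>m. pair m v"] h0 by (simp add: pair_add algebra_simps)
    qed simp
    obtain N :: nat where N: "- low_at v (a' * d) / low_at v h < real N"
      using reals_Archimedean2 by blast
    have "0 \<le> pair m w" if m: "m \<in> supp (a' * (d * h ^ N))" and w: "w \<in> insert v W" for m w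
    proof (cases "w = v")
      case True
      have "h ^ N \<noteq> 0" using h0 by simp
      moreover have "a' * d \<noteq> 0" using m by auto
      ultimately have nz: "a' * d \<noteq> 0" "h ^ N \<noteq> 0" by auto
      have "low_at v ((a' * d) * h ^ N) = low_at v (a' * d) + real N * low_at v h"
        using low_mult[OF nz, of "\<lambda>m. pair m v"] by (simp add: pair_add lowN)
      moreover have "0 \<le> low_at v (a' * d) + real N * low_at v h"
        using N lowh by (simp add: field_simps)
      moreover have "low_at v ((a' * d) * h ^ N) \<le> pair m v"
        using m by (intro low_le[of m _ "\<lambda>m. pair m v"]) (simp add: mult.assoc)
      ultimately show ?thesis using True by simp
    next
      case False
      have "m \<in> supp ((a' * d) * h ^ N)" using m by (simp add: mult.assoc)
      then obtain k l where kl: "m = k + l" "k \<in> supp (a' * d)" "l \<in> supp (h ^ N)" by (rule supp_multE)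
      have "0 \<le> pair k w" using d(2) kl(2) w False by auto
      moreover have "0 \<le> pair l w"
        using hc[of N] kl(3) w insert.prems(1) V by (auto simp: chart_iff dual_semigroup_pair)
      ultimately show ?thesis by (simp add: kl(1) pair_add)
    qed
    moreover have "d * h ^ N \<in> chart \<sigma> - p" by (rule nonmember_mult[OF P sub d(1) hc])
    ultimately show ?case by blast
  qed
  define W where "W = {v\<in>V. \<not> ray_prime \<sigma> v \<subseteq> p}"
  have W: "finite W" "W \<subseteq> V" "\<And>v. v \<in> W \<Longrightarrow> \<not> ray_prime \<sigma> v \<subseteq> p" using V by (auto simp: W_def)
  obtain d where d: "d \<in> chart \<sigma> - p" "\<And>m v. m \<in> supp (a' * d) \<Longrightarrow> v \<in> W \<Longrightarrow> 0 \<le> pair m v"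
    using clear[OF W] by blast
  have "a' * d \<in> chart \<sigma>"
  proof (rule chart_generated[OF gen])
    fix v m assume v: "v \<in> V" and m: "m \<in> supp (a' * d)"
    show "0 \<le> pair m v"
    proof (cases "ray_prime \<sigma> v \<subseteq> p")
      case True
      obtain k l where kl: "m = k + l" "k \<in> supp a'" "l \<in> supp d" using m by (rule supp_multE)
      have "0 \<le> pair l v" using d(1) kl(3) v V by (auto simp: chart_iff dual_semigroup_pair)
      then show ?thesis using pos[OF kl(2) v True] by (simp add: kl(1) pair_add)
    qed (use d(2)[OF m, of v] v W_def in blast)
  qed
  moreover have "e * d \<in> chart \<sigma> - p" by (rule nonmember_mult[OF P sub e(1) d(1)])
  moreover have "f = Fract (a' * d) (e * d)"
  proof -
    have "d \<noteq> 0" using d(1) prime_ofD(2)[OF P] by auto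
    then show ?thesis using f e0 Fract_scale[of d e a'] by (simp add: mult.commute)
  qed
  ultimately show ?thesis unfolding loc_ring_def by blast
qed

lemma unit_if_unit_in_codim_1:
  fixes f :: "'n::finite function_field"
  assumes p: "p \<in> Spec \<sigma>" and V: "finite V" "V \<subseteq> \<sigma>" and f0: "f \<noteq> 0"
    and gen: "\<And>m. (\<forall>v\<in>V. 0 \<le> pair m v) \<Longrightarrow> m \<in> dual_semigroup \<sigma>"
    and prime: "\<And>g. prime_elem g \<Longrightarrow> multiples g \<inter> chart \<sigma> \<subseteq> p \<Longrightarrow> f \<in> loc_units UNIV (multiples g)"
    and ray: "\<And>v. v \<in> V \<Longrightarrow> ray_prime \<sigma> v \<subseteq> p \<Longrightarrow> f \<in> loc_units (chart \<sigma>) (ray_prime \<sigma> v)"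
  shows "f \<in> loc_units (chart \<sigma>) p"
proof -
  have "f \<in> loc_ring (chart \<sigma>) p"
    by (rule regular_if_unit_in_codim_1[OF p V gen prime ray])
  moreover have "inverse f \<in> loc_ring (chart \<sigma>) p"
    by (rule regular_if_unit_in_codim_1[OF p V gen]) (auto intro: loc_units_inverse prime ray)
  moreover have "loc_units (chart \<sigma>) p = {u \<in> loc_ring (chart \<sigma>) p. u \<noteq> 0 \<and> inverse u \<in> loc_ring (chart \<sigma>) p}"
    by (rule loc_units_eq[OF _ subring_chart]) (use p in \<open>simp add: Spec_iff\<close>)
  ultimately show ?thesis using f0 by simp
qed

section \<open>Linear equivalence with torus-invariant divisors\<close>

lemma prime_elem_dvd_prime_elem:
  assumes "prime_elem (g :: 'a::idom)" "prime_elem p" "g dvd p" shows "p dvd g"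
proof -
  obtain k where k: "p = g * k" using assms by auto
  then have "p dvd g \<or> p dvd k" using prime_elem_dvd_multD[OF assms(2), of g k] by simp
  then show ?thesis
  proof
    assume "p dvd k"
    then obtain l where "k = p * l" by auto
    then have "p * 1 = p * (g * l)" using k by (simp add: mult_ac)
    then have "g * l = 1" using assms(2) by (metis mult_cancel_left prime_elem_def)
    then show ?thesis using assms(1) by (metis dvd_triv_left prime_elem_def)
  qed
qed

lemma split_prime_power:
  fixes a p :: "'n::finite laurent"
  assumes "a \<noteq> 0" "prime_elem p" shows "\<exists>i a'. a = p ^ i * a' \<and> \<not> p dvd a'"
  using assms(1)
proof (induction "size_laurent a" arbitrary: a rule: less_induct)
  case less
  show ?case
  proof (cases "p dvd a")
    case True
    then obtain b where b: "a = p * b" by auto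
    have "size_laurent b < size_laurent a"
      by (rule size_dvd_less[OF b]) (use less.prems assms in \<open>auto simp: prime_elem_def\<close>)
    then obtain i b' where "b = p ^ i * b'" "\<not> p dvd b'" using less b by (metis mult_zero_right)
    then show ?thesis using b by (intro exI[of _ "Suc i"] exI[of _ b']) (auto simp: mult.assoc)
  next
    case False
    then show ?thesis by (intro exI[of _ 0] exI[of _ a]) simp
  qed
qed

text \<open>The factor c is the power of p, possibly negative, by which x is divisible. It changes
  the order at p only.\<close>

lemma prime_part:
  fixes x :: "'n::finite function_field"
  assumes "x \<noteq> 0" "prime_elem p"
  shows "\<exists>c. c \<noteq> 0 \<and> x / c \<in> loc_units UNIV (multiples p) \<and>
    (\<forall>g. prime_elem g \<longrightarrow> \<not> g dvd p \<longrightarrow> c \<in> loc_units UNIV (multiples g))"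
proof -
  obtain a b where ab: "x = Fract a b" "b \<noteq> 0" by (cases x)
  then have "a \<noteq> 0" using assms(1) Fract_eq_0 by blast
  then obtain i a' where a': "a = p ^ i * a'" "\<not> p dvd a'" using split_prime_power assms(2) by blast
  obtain j b' where b': "b = p ^ j * b'" "\<not> p dvd b'" using split_prime_power[OF ab(2) assms(2)] by blast
  have p0: "p \<noteq> 0" using assms(2) by auto
  define c where "c = Fract (p ^ i) (p ^ j)"
  have c0: "c \<noteq> 0" using p0 by (simp add: c_def Fract_eq_0)
  have "x / c = Fract (p ^ (i + j) * a') (p ^ (i + j) * b')"
    by (simp add: c_def ab a' b' power_add mult_ac)
  also have "\<dots> = Fract a' b'" by (rule Fract_scale) (use p0 b' in auto)
  finally have "x / c \<in> loc_units UNIV (multiples p)"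
    using a' b' unfolding loc_units_def multiples_def by blast
  moreover have "c \<in> loc_units UNIV (multiples g)" if "prime_elem g" "\<not> g dvd p" for g
    unfolding c_def loc_units_def multiples_def using that prime_elem_dvd_power by blast
  ultimately show ?thesis using c0 by blast
qed

context toric_fan
begin

lemma local_units_torus: "q \<in> Spec {0} \<Longrightarrow> local_units (pt {0} q) = loc_units UNIV q"
  using local_units_pt[OF zero_cone] by (simp add: chart_zero_cone)

abbreviation gen_pt :: "'n laurent \<Rightarrow> 'n chart_point set" where
  "gen_pt g \<equiv> pt {0} (multiples g)"

text \<open>The trace of \<open>multiples g\<close> lies in p and hence does not contain h, so the
  equation at p is also valid at the generic point of g.\<close>

lemma local_equation_at_gen_pt:
  assumes S: "\<sigma> \<in> \<Sigma>" and zs: "{0} \<subseteq> \<sigma>" and f: "f \<noteq> 0" "f0 \<noteq> 0"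
    and loc: "\<And>q. q \<in> Spec \<sigma> \<Longrightarrow> h \<notin> q \<Longrightarrow> D (pt \<sigma> q) = coset f (pt \<sigma> q)" and h: "h \<notin> p"
    and g: "prime_elem g" "multiples g \<inter> chart \<sigma> \<subseteq> p" and D: "D (gen_pt g) = coset f0 (gen_pt g)"
  shows "f / f0 \<in> loc_units UNIV (multiples g)"
proof -
  note gS = Spec_multiples[OF g(1)]
  have q: "multiples g \<inter> chart \<sigma> \<in> Spec \<sigma>" by (rule Spec_Int[OF gS zs])
  have eq: "gen_pt g = pt \<sigma> (multiples g \<inter> chart \<sigma>)" by (rule pt_subcone[OF S zero_cone zs gS])
  have "coset f (gen_pt g) = coset f0 (gen_pt g)" using loc[OF q] g(2) h D eq by auto
  then show ?thesis
    unfolding coset_eq_iff[OF pt_in[OF zero_cone gS] f] local_units_torus[OF gS] .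
qed

text \<open>\<open>f0\<close> is to be an equation away from h. For each of the finitely many primes
  dividing h it is corrected by a power of that prime, which is a unit at all other primes.\<close>

lemma divisor_at_primes:
  assumes D: "D \<in> CDiv" and f0: "f0 \<noteq> 0" and "h \<noteq> 0"
  shows "\<exists>f. f \<noteq> 0 \<and> (\<forall>g. prime_elem g \<longrightarrow>
    (if g dvd h then D (gen_pt g) = coset f (gen_pt g)
     else f / f0 \<in> loc_units UNIV (multiples g)))"
  using assms(3)
proof (induction rule: laurent_prime_induct)
  case (unit h)
  then have "\<not> g dvd h" if "prime_elem g" for g using that unit by (meson dvd_trans prime_elem_def)
  moreover have "1 \<in> loc_units UNIV (multiples g)" if "prime_elem g" for g :: "'n laurent"
    by (rule loc_units_1[OF prime_of_multiples[OF that]]) (simp add: subring_set_def)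
  ultimately show ?case using f0 by (intro exI[of _ f0]) simp
next
  case (prime p h)
  obtain f where f: "f \<noteq> 0"
    "\<And>g. prime_elem g \<Longrightarrow> g dvd h \<Longrightarrow> D (gen_pt g) = coset f (gen_pt g)"
    "\<And>g. prime_elem g \<Longrightarrow> \<not> g dvd h \<Longrightarrow> f / f0 \<in> loc_units UNIV (multiples g)"
    using prime.IH by metis
  have eq: "p dvd g" if "prime_elem g" "g dvd p" for g
    using prime_elem_dvd_prime_elem that prime.hyps(1) by blast
  have dvd: "g dvd p * h \<longleftrightarrow> g dvd p \<or> g dvd h" if "prime_elem g" for g
    using that by (rule prime_elem_dvd_mult_iff)
  show ?case
  \<comment> \<open>A repeated factor has been corrected before and must not be corrected
    again.\<close>
  proof (cases "p dvd h")
    case True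
    then have "g dvd p * h \<longleftrightarrow> g dvd h" if "prime_elem g" for g
      using dvd[OF that] by (meson dvd_trans)
    then show ?thesis using f by (intro exI[of _ f]) auto
  next
    case False
    have tp: "gen_pt g \<in> X" if "prime_elem g" for g
      using zero_cone Spec_multiples[OF that] by simp
    have tu: "local_units (gen_pt g) = loc_units UNIV (multiples g)" if "prime_elem g" for g
      using local_units_torus Spec_multiples[OF that] by simp
    obtain f' where f': "f' \<noteq> 0" "D (gen_pt p) = coset f' (gen_pt p)"
      using CDiv_at[OF D tp[OF prime.hyps(1)]] by blast
    have "f' / f \<noteq> 0" using f f' by simp
    then obtain c where c: "c \<noteq> 0" "f' / f / c \<in> loc_units UNIV (multiples p)"
      "\<And>g. prime_elem g \<Longrightarrow> \<not> g dvd p \<Longrightarrow> c \<in> loc_units UNIV (multiples g)"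
      using prime_part[OF _ prime.hyps(1)] by metis
    show ?thesis
    proof (intro exI[of _ "f * c"] conjI allI impI)
      show "f * c \<noteq> 0" using f c by simp
      fix g :: "'n laurent" assume g: "prime_elem g"
      show "if g dvd p * h then D (gen_pt g) = coset (f * c) (gen_pt g)
        else f * c / f0 \<in> loc_units UNIV (multiples g)"
      proof (cases "g dvd p")
        case True
        then have "multiples g = multiples p" using eq[OF g True] dvd_trans unfolding multiples_def by blast
        moreover have "coset f' (gen_pt p) = coset (f * c) (gen_pt p)"
          unfolding coset_eq_iff[OF tp[OF prime.hyps(1)] f'(1) \<open>f * c \<noteq> 0\<close>] tu[OF prime.hyps(1)]
          using c(2) by (simp add: field_simps)
        ultimately show ?thesis using True f' by simp
      next
        case gp: False
        show ?thesis
        proof (cases "g dvd h")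
          case True
          have "coset (f * c) (gen_pt g) = coset f (gen_pt g)"
            unfolding coset_eq_iff[OF tp[OF g] \<open>f * c \<noteq> 0\<close> f(1)] tu[OF g]
            using c(3)[OF g gp] f by simp
          then show ?thesis using True f(2)[OF g True] by simp
        next
          case False
          have "f / f0 * c \<in> loc_units UNIV (multiples g)"
            by (rule loc_units_mult[OF prime_of_multiples[OF g]])
              (use f(3)[OF g False] c(3)[OF g gp] in \<open>auto simp: subring_set_def\<close>)
          then show ?thesis using False gp dvd[OF g] by simp
        qed
      qed
    qed
  qed
qed

text \<open>An equation at the generic point is valid outside some \<open>h = 0\<close>. After
  correction at the prime factors of h it is valid in codimension one, and normality extends this to
  all points of the torus.\<close>

lemma principal_on_torus:
  assumes D: "D \<in> CDiv"
  shows "\<exists>f. f \<noteq> 0 \<and> (\<forall>q\<in>Spec {0}. D (pt {0} q) = coset f (pt {0} q))"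
proof -
  define z :: "'n laurent set" where "z = {0}"
  obtain f0 h where h: "f0 \<noteq> 0" "h \<notin> z"
    "\<And>q. q \<in> Spec {0} \<Longrightarrow> h \<notin> q \<Longrightarrow> D (pt {0} q) = coset f0 (pt {0} q)"
    using CDiv_local[OF D zero_cone Spec_zero] unfolding z_def[symmetric] by metis
  then have "h \<noteq> 0" by (simp add: z_def)
  obtain f where f: "f \<noteq> 0"
    "\<And>g. prime_elem g \<Longrightarrow> g dvd h \<Longrightarrow> D (gen_pt g) = coset f (gen_pt g)"
    "\<And>g. prime_elem g \<Longrightarrow> \<not> g dvd h \<Longrightarrow> f / f0 \<in> loc_units UNIV (multiples g)"
    using divisor_at_primes[OF D h(1) \<open>h \<noteq> 0\<close>] by metis
  have at_g: "D (gen_pt g) = coset f (gen_pt g)" if g: "prime_elem g" for g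
  proof (cases "g dvd h")
    case False
    have tp: "gen_pt g \<in> X" using zero_cone Spec_multiples[OF g] by simp
    have "coset f (gen_pt g) = coset f0 (gen_pt g)"
      unfolding coset_eq_iff[OF tp f(1) h(1)] local_units_torus[OF Spec_multiples[OF g]] using f(3)[OF g False] .
    then show ?thesis using h(3)[OF Spec_multiples[OF g]] False by (simp add: multiples_def)
  qed (rule f(2)[OF g])
  have "D (pt {0} q) = coset f (pt {0} q)" if q: "q \<in> Spec {0}" for q
  proof -
    obtain f' h' where h': "f' \<noteq> 0" "h' \<notin> q"
      "\<And>q. q \<in> Spec {0} \<Longrightarrow> h' \<notin> q \<Longrightarrow> D (pt {0} q) = coset f' (pt {0} q)"
      using CDiv_local[OF D zero_cone q] by metis
    have tp: "pt {0} q \<in> X" using zero_cone q by simp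
    have "f' / f \<in> loc_units (chart {0}) q"
    \<comment> \<open>The cone of the torus has no rays, so only the primes of the Laurent ring have
      to be tested.\<close>
    proof (rule unit_if_unit_in_codim_1[OF q, of "{}"])
      fix g :: "'n laurent" assume g: "prime_elem g" "multiples g \<inter> chart {0} \<subseteq> q"
      show "f' / f \<in> loc_units UNIV (multiples g)"
        by (rule local_equation_at_gen_pt[OF zero_cone order_refl h'(1) f(1) h'(3,2) g at_g[OF g(1)]])
    qed (use f h' in \<open>auto simp: dual_semigroup_pair\<close>)
    then have "coset f' (pt {0} q) = coset f (pt {0} q)"
      unfolding coset_eq_iff[OF tp h'(1) f(1)] local_units_torus[OF q] by (simp add: chart_zero_cone)
    then show ?thesis using h'(3)[OF q h'(2)] by simp
  qed
  then show ?thesis using f(1) by blast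
qed

end

text \<open>\<open>max_cones\<close> will be the cones over the facets. The condition
  \<open>pointed\<close> on the dual cone expresses that a maximal cone is full-dimensional, so that
  its chart has a fixed point.\<close>

locale complete_toric_fan = toric_fan \<Sigma> for \<Sigma> :: "(real ^ 'n) set set" +
  fixes max_cones :: "(real ^ 'n) set set"
  assumes max_sub: "max_cones \<subseteq> \<Sigma>"
    and max_cover: "\<tau> \<in> \<Sigma> \<Longrightarrow> \<exists>\<sigma>\<in>max_cones. \<tau> \<subseteq> \<sigma>"
    and zero_in: "\<sigma> \<in> max_cones \<Longrightarrow> 0 \<in> \<sigma>"
    and pointed: "\<sigma> \<in> max_cones \<Longrightarrow> m \<in> dual_semigroup \<sigma> \<Longrightarrow> - m \<in> dual_semigroup \<sigma> \<Longrightarrow> m = 0"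
begin

definition fixed_pt :: "(real ^ 'n) set \<Rightarrow> 'n chart_point set" where
  "fixed_pt \<sigma> = pt \<sigma> (fixed_prime \<sigma>)"

text \<open>A divisor that is trivial on the torus is determined by its equations at the fixed points, and these
  can be chosen to be characters.\<close>

definition invariant_data :: "('n chart_point set \<Rightarrow> 'n function_field set) \<Rightarrow> ((real ^ 'n) set \<Rightarrow> int ^ 'n) \<Rightarrow> bool" where
  "invariant_data D \<mu> \<longleftrightarrow> D \<in> CDiv \<and> (\<forall>q\<in>Spec {0}. D (pt {0} q) = local_units (pt {0} q)) \<and>
     (\<forall>\<sigma>\<in>max_cones. D (fixed_pt \<sigma>) = coset (chi (\<mu> \<sigma>)) (fixed_pt \<sigma>))"

lemma fixed_prime_Spec: "\<sigma> \<in> max_cones \<Longrightarrow> fixed_prime \<sigma> \<in> Spec \<sigma>"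
  by (rule Spec_fixed) (rule pointed)

lemma fixed_pt_in: "\<sigma> \<in> max_cones \<Longrightarrow> fixed_pt \<sigma> \<in> X"
  unfolding fixed_pt_def using max_sub fixed_prime_Spec by auto

lemma local_units_fixed: "\<sigma> \<in> max_cones \<Longrightarrow> local_units (fixed_pt \<sigma>) = loc_units (chart \<sigma>) (fixed_prime \<sigma>)"
  unfolding fixed_pt_def using max_sub fixed_prime_Spec local_units_pt by auto

text \<open>The Newton polyhedron of \<open>a\<close> is a Minkowski summand of that of \<open>e\<close>, which is the dual cone. Hence it
  is a translate of the dual cone.\<close>

lemma monomial_times_unit:
  assumes \<sigma>: "\<sigma> \<in> max_cones" and e: "e \<in> chart \<sigma> - fixed_prime \<sigma>" "a dvd e"
  obtains k a' where "a = monom k * a'" "a' \<in> chart \<sigma> - fixed_prime \<sigma>"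
proof -
  obtain b where b: "e = a * b" using e by auto
  have "0 \<in> supp e" using e by (auto simp: fixed_prime_def)
  \<comment> \<open>The constant term of e arises from exponents k of a and -k of b; k is the vertex
    by which the support of a is translated.\<close>
  then obtain k l where kl: "0 = k + l" "k \<in> supp a" "l \<in> supp b" using b supp_multE by metis
  have nz: "a \<noteq> 0" "b \<noteq> 0" using kl by auto
  define a' where "a' = monom (- k) * a"
  have "0 \<le> pair m v" if m: "m \<in> supp a'" and v: "v \<in> \<sigma>" for m v
  proof -
    obtain k' where k': "k' \<in> supp a" "m = - k + k'" using m by (auto simp: a'_def supp_monom_mult)
    have "e \<noteq> 0" using \<open>0 \<in> supp e\<close> by auto
    then have "0 \<le> low_at v e"
      using e v by (intro low_ge) (auto simp: chart_iff dual_semigroup_pair)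
    also have "\<dots> = low_at v a + low_at v b"
      unfolding b by (rule low_mult) (use nz in \<open>auto simp: pair_add\<close>)
    also have "\<dots> \<le> pair k' v + pair l v"
      using low_le[OF k'(1), of "\<lambda>m. pair m v"] low_le[OF kl(3), of "\<lambda>m. pair m v"] by auto
    also have "pair l v = - pair k v" using kl(1) pair_add[of k l v] by simp
    finally show ?thesis by (simp add: k'(2) pair_diff)
  qed
  then have "a' \<in> chart \<sigma>" by (auto simp: chart_iff dual_semigroup_pair)
  moreover have "0 \<in> supp a'" using kl(2) by (auto simp: a'_def supp_monom_mult image_iff intro!: bexI[of _ k])
  moreover have "a = monom k * a'" by (simp add: a'_def mult.assoc[symmetric] monom_uminus)
  ultimately show ?thesis using that[of k a'] by (auto simp: fixed_prime_def)
qed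

text \<open>Write a local equation at the fixed point as a reduced fraction. As the divisor is
  trivial on the torus, no prime of numerator or denominator passes through the fixed point, so both
  divide functions not vanishing there and are monomials times local units.\<close>

lemma invariant_data_exists:
  assumes D: "D \<in> CDiv" and triv: "\<And>q. q \<in> Spec {0} \<Longrightarrow> D (pt {0} q) = local_units (pt {0} q)"
  shows "\<exists>\<mu>. invariant_data D \<mu>"
proof -
  have "\<exists>m. D (fixed_pt \<sigma>) = coset (chi m) (fixed_pt \<sigma>)" if \<sigma>: "\<sigma> \<in> max_cones" for \<sigma>
  proof -
    have S: "\<sigma> \<in> \<Sigma>" using \<sigma> max_sub by auto
    note p = fixed_prime_Spec[OF \<sigma>]
    obtain f h where f: "f \<noteq> 0" "h \<in> chart \<sigma>" "h \<notin> fixed_prime \<sigma>"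
      "\<And>q. q \<in> Spec \<sigma> \<Longrightarrow> h \<notin> q \<Longrightarrow> D (pt \<sigma> q) = coset f (pt \<sigma> q)"
      using CDiv_local[OF D S p] by blast
    obtain a b where ab: "f = Fract a b" "b \<noteq> 0" "\<And>p. prime_elem p \<Longrightarrow> p dvd a \<Longrightarrow> p dvd b \<Longrightarrow> False"
      using fract_coprime[of f] by blast
    have a0: "a \<noteq> 0" using ab(1) f(1) Fract_eq_0[OF ab(2), of a] by auto
    have units: "g dvd a \<longleftrightarrow> g dvd b" if g: "prime_elem g" "multiples g \<inter> chart \<sigma> \<subseteq> fixed_prime \<sigma>" for g
    proof -
      have "D (gen_pt g) = coset 1 (gen_pt g)" using triv[OF Spec_multiples[OF g(1)]] by (simp add: coset_1)
      then have "f / 1 \<in> loc_units UNIV (multiples g)"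
        using zero_in[OF \<sigma>] by (intro local_equation_at_gen_pt[OF S _ f(1) _ f(4,3) g]) auto
      then have "f \<in> loc_units UNIV (multiples g)" by simp
      then show ?thesis using unit_at_prime[OF g(1) _ ab(2)] ab(1) by blast
    qed
    have "\<exists>e\<in>chart \<sigma> - fixed_prime \<sigma>. a dvd e"
      by (rule dvd_nonmember[OF a0 p]) (use units ab(3) in metis)
    then obtain k a' where a': "a = monom k * a'" "a' \<in> chart \<sigma> - fixed_prime \<sigma>"
      using monomial_times_unit[OF \<sigma>] by metis
    have "\<exists>e\<in>chart \<sigma> - fixed_prime \<sigma>. b dvd e"
      by (rule dvd_nonmember[OF ab(2) p]) (use units ab(3) in metis)
    then obtain l b' where b': "b = monom l * b'" "b' \<in> chart \<sigma> - fixed_prime \<sigma>"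
      using monomial_times_unit[OF \<sigma>] by metis
    have "f / chi (k - l) = Fract a' b'"
    proof -
      have "f = chi k / chi l * Fract a' b'" by (simp add: ab(1) a'(1) b'(1) chi_def)
      then show ?thesis by (simp add: chi_diff)
    qed
    then have "f / chi (k - l) \<in> local_units (fixed_pt \<sigma>)"
      unfolding local_units_fixed[OF \<sigma>] loc_units_def using a' b' by blast
    then have "coset f (fixed_pt \<sigma>) = coset (chi (k - l)) (fixed_pt \<sigma>)"
      using coset_eq_iff[OF fixed_pt_in[OF \<sigma>] f(1)] by simp
    then show ?thesis using f(4)[OF p f(3)] by (auto simp: fixed_pt_def)
  qed
  then obtain \<mu> where "\<And>\<sigma>. \<sigma> \<in> max_cones \<Longrightarrow> D (fixed_pt \<sigma>) = coset (chi (\<mu> \<sigma>)) (fixed_pt \<sigma>)" by metis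
  then show ?thesis using D triv by (auto simp: invariant_data_def)
qed

text \<open>The ray prime is contained in the fixed prime, so equations and units at the fixed point
  remain such at the ray prime.\<close>

lemma invariant_data_ray:
  assumes D: "invariant_data D \<mu>" and \<sigma>: "\<sigma> \<in> max_cones" and v: "v \<in> \<sigma>"
  shows "D (pt \<sigma> (ray_prime \<sigma> v)) = coset (chi (\<mu> \<sigma>)) (pt \<sigma> (ray_prime \<sigma> v))"
proof -
  have S: "\<sigma> \<in> \<Sigma>" using \<sigma> max_sub by auto
  have D': "D \<in> CDiv" and Df: "D (fixed_pt \<sigma>) = coset (chi (\<mu> \<sigma>)) (fixed_pt \<sigma>)"
    using D \<sigma> by (auto simp: invariant_data_def)
  note p = fixed_prime_Spec[OF \<sigma>] and r = Spec_ray[OF v]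
  obtain f h where f: "f \<noteq> 0" "h \<in> chart \<sigma>" "h \<notin> fixed_prime \<sigma>"
    "\<And>q. q \<in> Spec \<sigma> \<Longrightarrow> h \<notin> q \<Longrightarrow> D (pt \<sigma> q) = coset f (pt \<sigma> q)"
    using CDiv_local[OF D' S p] by blast
  have "coset f (fixed_pt \<sigma>) = coset (chi (\<mu> \<sigma>)) (fixed_pt \<sigma>)"
    using f(4)[OF p f(3)] Df by (simp add: fixed_pt_def)
  then have "f / chi (\<mu> \<sigma>) \<in> loc_units (chart \<sigma>) (fixed_prime \<sigma>)"
    using coset_eq_iff[OF fixed_pt_in[OF \<sigma>] f(1)] local_units_fixed[OF \<sigma>] by simp
  then have "f / chi (\<mu> \<sigma>) \<in> loc_units (chart \<sigma>) (ray_prime \<sigma> v)"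
    using ray_subset_fixed[of \<sigma> v] unfolding loc_units_def by blast
  then have "coset f (pt \<sigma> (ray_prime \<sigma> v)) = coset (chi (\<mu> \<sigma>)) (pt \<sigma> (ray_prime \<sigma> v))"
    using coset_eq_iff[OF pt_in[OF S r] f(1)] local_units_pt[OF S r] by simp
  moreover have "h \<notin> ray_prime \<sigma> v" using f(3) ray_subset_fixed[of \<sigma> v] by auto
  ultimately show ?thesis using f(4)[OF r] by simp
qed

text \<open>The ray primes of v in the two charts and in the chart of the intersection are the same
  point, so the quotient of the two characters is a unit there and has weight 0 at v.\<close>

lemma invariant_data_compatible:
  assumes D: "invariant_data D \<mu>" and \<sigma>: "\<sigma> \<in> max_cones" "\<sigma>' \<in> max_cones" and v: "v \<in> \<sigma>" "v \<in> \<sigma>'"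
  shows "pair (\<mu> \<sigma>) v = pair (\<mu> \<sigma>') v"
proof -
  let ?\<tau> = "\<sigma> \<inter> \<sigma>'"
  have S: "\<sigma> \<in> \<Sigma>" "\<sigma>' \<in> \<Sigma>" "?\<tau> \<in> \<Sigma>" using \<sigma> max_sub Int_cone by auto
  have v\<tau>: "v \<in> ?\<tau>" using v by auto
  let ?x = "pt ?\<tau> (ray_prime ?\<tau> v)"
  have "?x = pt \<sigma> (ray_prime \<sigma> v)"
    using pt_subcone[OF S(1,3) _ Spec_ray[OF v\<tau>]] ray_prime_Int[of ?\<tau> \<sigma> v] by simp
  moreover have "?x = pt \<sigma>' (ray_prime \<sigma>' v)"
    using pt_subcone[OF S(2,3) _ Spec_ray[OF v\<tau>]] ray_prime_Int[of ?\<tau> \<sigma>' v] by simp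
  ultimately have "coset (chi (\<mu> \<sigma>)) ?x = coset (chi (\<mu> \<sigma>')) ?x"
    using invariant_data_ray[OF D \<sigma>(1) v(1)] invariant_data_ray[OF D \<sigma>(2) v(2)] by simp
  then have "chi (\<mu> \<sigma>) / chi (\<mu> \<sigma>') \<in> local_units ?x"
    using coset_eq_iff[OF pt_in[OF S(3) Spec_ray[OF v\<tau>]], of "chi (\<mu> \<sigma>)" "chi (\<mu> \<sigma>')"] by simp
  then have "chi (\<mu> \<sigma> - \<mu> \<sigma>') \<in> loc_units (chart ?\<tau>) (ray_prime ?\<tau> v)"
    using local_units_pt[OF S(3) Spec_ray[OF v\<tau>]] by (simp add: chi_diff)
  then have "pair (\<mu> \<sigma> - \<mu> \<sigma>') v = 0" by (rule chi_unit_ray[OF v\<tau>])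
  then show ?thesis by (simp add: pair_diff)
qed

text \<open>A local equation at any point is a unit at the torus primes and at the ray primes
  through that point, hence a unit by normality.\<close>

lemma invariant_data_zero:
  assumes D: "invariant_data D (\<lambda>_. 0)"
  shows "D = principal_divisor \<Sigma> 1"
proof (rule extensionalityI[of _ X])
  have D': "D \<in> CDiv" and triv: "\<And>q. q \<in> Spec {0} \<Longrightarrow> D (pt {0} q) = local_units (pt {0} q)"
    using D by (auto simp: invariant_data_def)
  show "D \<in> extensional X" using D' by (simp add: CDiv_iff)
  show "principal_divisor \<Sigma> 1 \<in> extensional X" by (simp add: principal_divisor_def)
  fix x assume x: "x \<in> X"
  then obtain \<tau> q where q: "\<tau> \<in> \<Sigma>" "q \<in> Spec \<tau>" "x = pt \<tau> q" by (auto simp: toric_points_iff)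
  obtain \<sigma> where \<sigma>: "\<sigma> \<in> max_cones" "\<tau> \<subseteq> \<sigma>" using max_cover[OF q(1)] by blast
  have S: "\<sigma> \<in> \<Sigma>" using \<sigma> max_sub by auto
  define p where "p = q \<inter> chart \<sigma>"
  have p: "p \<in> Spec \<sigma>" unfolding p_def by (rule Spec_Int[OF q(2) \<sigma>(2)])
  have xp: "x = pt \<sigma> p" using pt_subcone[OF S q(1) \<sigma>(2) q(2)] q(3) by (simp add: p_def)
  obtain f h where f: "f \<noteq> 0" "h \<in> chart \<sigma>" "h \<notin> p"
    "\<And>q. q \<in> Spec \<sigma> \<Longrightarrow> h \<notin> q \<Longrightarrow> D (pt \<sigma> q) = coset f (pt \<sigma> q)"
    using CDiv_local[OF D' S p] by blast
  obtain V where V: "V \<subseteq> \<sigma>" "finite V" "\<And>k. (\<forall>v\<in>V. 0 \<le> pair k v) \<Longrightarrow> k \<in> dual_semigroup \<sigma>"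
    using finite_cone[OF S] by blast
  have "f \<in> loc_units (chart \<sigma>) p"
  proof (rule unit_if_unit_in_codim_1[OF p V(2,1) f(1) V(3)])
    fix g :: "'n laurent" assume g: "prime_elem g" "multiples g \<inter> chart \<sigma> \<subseteq> p"
    have "D (gen_pt g) = coset 1 (gen_pt g)" using triv[OF Spec_multiples[OF g(1)]] by (simp add: coset_1)
    then have "f / 1 \<in> loc_units UNIV (multiples g)"
      using zero_in[OF \<sigma>(1)] by (intro local_equation_at_gen_pt[OF S _ f(1) _ f(4,3) g]) auto
    then show "f \<in> loc_units UNIV (multiples g)" by simp
  next
    fix v assume v: "v \<in> V" "ray_prime \<sigma> v \<subseteq> p"
    have v\<sigma>: "v \<in> \<sigma>" using v V by auto
    have "h \<notin> ray_prime \<sigma> v" using v f(3) by auto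
    then have "coset f (pt \<sigma> (ray_prime \<sigma> v)) = local_units (pt \<sigma> (ray_prime \<sigma> v))"
      using f(4)[OF Spec_ray[OF v\<sigma>]] invariant_data_ray[OF D \<sigma>(1) v\<sigma>] by (simp add: coset_1)
    then show "f \<in> loc_units (chart \<sigma>) (ray_prime \<sigma> v)"
      using coset_1_iff[OF _ f(1)] pt_in[OF S Spec_ray[OF v\<sigma>]] local_units_pt[OF S Spec_ray[OF v\<sigma>]] by auto
  qed auto
  then have "coset f x = local_units x"
    using coset_1_iff[OF x f(1)] local_units_pt[OF S p] xp by simp
  then show "D x = principal_divisor \<Sigma> 1 x"
    using f(4)[OF p f(3)] xp x by (simp add: principal_divisor_at coset_1)
qed

end

section \<open>Relations between Picard classes in terms of characters\<close>

context complete_toric_fan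
begin

abbreviation "principals \<equiv> principal_divisor \<Sigma> ` (- {0})"

abbreviation "cls D \<equiv> principals #>\<^bsub>CG\<^esub> D"

lemma normal_principals: "principals \<lhd> CG"
  using comm_group.normal_iff_subgroup[OF comm_group_cartier] subgroup_principal by blast

lemma invariant_dataD:
  assumes "invariant_data D \<mu>"
  shows "D \<in> CDiv" "q \<in> Spec {0} \<Longrightarrow> D (pt {0} q) = coset 1 (pt {0} q)"
    "\<sigma> \<in> max_cones \<Longrightarrow> D (fixed_pt \<sigma>) = coset (chi (\<mu> \<sigma>)) (fixed_pt \<sigma>)"
  using assms by (simp_all add: invariant_data_def coset_1)

lemma invariant_dataI:
  assumes "D \<in> CDiv" "\<And>q. q \<in> Spec {0} \<Longrightarrow> D (pt {0} q) = coset 1 (pt {0} q)"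
    "\<And>\<sigma>. \<sigma> \<in> max_cones \<Longrightarrow> D (fixed_pt \<sigma>) = coset (chi (\<mu> \<sigma>)) (fixed_pt \<sigma>)"
  shows "invariant_data D \<mu>"
  using assms by (simp add: invariant_data_def coset_1)

lemma invariant_data_cong:
  "(\<And>\<sigma>. \<sigma> \<in> max_cones \<Longrightarrow> \<mu> \<sigma> = \<nu> \<sigma>) \<Longrightarrow> invariant_data D \<mu> \<longleftrightarrow> invariant_data D \<nu>"
  by (simp add: invariant_data_def)

lemma invariant_data_mult:
  assumes D: "invariant_data D \<mu>" and E: "invariant_data E \<nu>"
  shows "invariant_data (D \<odot> E) (\<lambda>\<sigma>. \<mu> \<sigma> + \<nu> \<sigma>)"
proof (rule invariant_dataI)
  show "D \<odot> E \<in> CDiv" using D E by (intro cartier_mult_closed invariant_dataD)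
  fix q :: "'n laurent set" assume q: "q \<in> Spec {0}"
  have "(D \<odot> E) (pt {0} q) = coset (1 * 1) (pt {0} q)"
    by (rule cartier_mult_coset)
      (use invariant_dataD(2)[OF D q] invariant_dataD(2)[OF E q] pt_in[OF zero_cone q] in auto)
  then show "(D \<odot> E) (pt {0} q) = coset 1 (pt {0} q)" by simp
next
  fix \<sigma> assume \<sigma>: "\<sigma> \<in> max_cones"
  show "(D \<odot> E) (fixed_pt \<sigma>) = coset (chi (\<mu> \<sigma> + \<nu> \<sigma>)) (fixed_pt \<sigma>)"
    unfolding chi_add by (rule cartier_mult_coset)
      (use invariant_dataD(3)[OF D \<sigma>] invariant_dataD(3)[OF E \<sigma>] fixed_pt_in[OF \<sigma>] in auto)
qed

lemma cartier_inv_coset: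
  assumes D: "D \<in> CDiv" and x: "x \<in> X" and f: "f \<noteq> 0" "D x = coset f x"
  shows "(inv\<^bsub>CG\<^esub> D) x = coset (inverse f) x"
proof -
  interpret G: comm_group CG by (rule comm_group_cartier)
  obtain g where g: "g \<noteq> 0" "(inv\<^bsub>CG\<^esub> D) x = coset g x" using CDiv_at[OF G.inv_closed[OF D] x] by blast
  have "coset (g * f) x = (inv\<^bsub>CG\<^esub> D \<odot> D) x"
    using cartier_mult_coset[of x "inv\<^bsub>CG\<^esub> D" g D f] x g f by simp
  also have "\<dots> = coset 1 x" using D x by (simp add: cartier_one principal_divisor_at)
  finally have "g * f / 1 \<in> local_units x" using coset_eq_iff[OF x, of "g * f" 1] g f by simp
  then show ?thesis unfolding g(2) using coset_eq_iff[OF x g(1), of "inverse f"] f by (simp add: divide_inverse)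
qed

lemma invariant_data_inv:
  assumes D: "invariant_data D \<mu>"
  shows "invariant_data (inv\<^bsub>CG\<^esub> D) (\<lambda>\<sigma>. - \<mu> \<sigma>)"
proof (rule invariant_dataI)
  interpret G: comm_group CG by (rule comm_group_cartier)
  note D' = invariant_dataD[OF D]
  show "inv\<^bsub>CG\<^esub> D \<in> CDiv" using D' by simp
  fix q :: "'n laurent set" assume q: "q \<in> Spec {0}"
  show "(inv\<^bsub>CG\<^esub> D) (pt {0} q) = coset 1 (pt {0} q)"
    using cartier_inv_coset[OF D'(1) pt_in[OF zero_cone q] _ D'(2)[OF q]] by simp
next
  fix \<sigma> assume \<sigma>: "\<sigma> \<in> max_cones"
  have "inverse (chi (\<mu> \<sigma>)) = chi (- \<mu> \<sigma>)" using chi_diff[of 0 "\<mu> \<sigma>"] by (simp add: field_simps)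
  then show "(inv\<^bsub>CG\<^esub> D) (fixed_pt \<sigma>) = coset (chi (- \<mu> \<sigma>)) (fixed_pt \<sigma>)"
    using cartier_inv_coset[OF invariant_dataD(1)[OF D] fixed_pt_in[OF \<sigma>] _ invariant_dataD(3)[OF D \<sigma>]] by simp
qed

text \<open>A character is a unit on the torus; its divisor has the same data on all cones.\<close>

lemma invariant_data_principal: "invariant_data (principal_divisor \<Sigma> (chi m)) (\<lambda>_. m)"
proof (rule invariant_dataI)
  show "principal_divisor \<Sigma> (chi m) \<in> CDiv" by (rule principal_in_CDiv) simp
  fix q :: "'n laurent set" assume q: "q \<in> Spec {0}"
  have Q: "prime_of UNIV q" using q by (simp add: Spec_iff chart_zero_cone)
  have "monom m \<notin> q" by (rule prime_of_unit[OF Q, of "monom (- m)"]) (auto simp: monom_uminus)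
  then have "chi m \<in> loc_units UNIV q" using prime_ofD(3)[OF Q] unfolding chi_def loc_units_def by blast
  then have "coset (chi m) (pt {0} q) = coset 1 (pt {0} q)"
    using coset_eq_iff[OF pt_in[OF zero_cone q], of "chi m" 1] local_units_torus[OF q] by simp
  then show "principal_divisor \<Sigma> (chi m) (pt {0} q) = coset 1 (pt {0} q)"
    using pt_in[OF zero_cone q] by (simp add: principal_divisor_at)
qed (simp add: principal_divisor_at fixed_pt_in)

lemma invariant_data_pow:
  assumes D: "invariant_data D \<mu>"
  shows "invariant_data (D [^]\<^bsub>CG\<^esub> (k::int)) (\<lambda>\<sigma>. k *s \<mu> \<sigma>)"
proof -
  interpret G: comm_group CG by (rule comm_group_cartier)
  have D': "D \<in> CDiv" using invariant_dataD(1)[OF D] .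
  have nat: "invariant_data (D [^]\<^bsub>CG\<^esub> (n::nat)) (\<lambda>\<sigma>. int n *s \<mu> \<sigma>)" for n
  proof (induction n)
    case 0
    then show ?case using invariant_data_principal[of 0] by (simp add: cartier_one)
  next
    case (Suc n)
    have "(\<lambda>\<sigma>. int n *s \<mu> \<sigma> + \<mu> \<sigma>) = (\<lambda>\<sigma>. int (Suc n) *s \<mu> \<sigma>)"
      by (simp add: fun_eq_iff vec_eq_iff algebra_simps)
    then show ?case using invariant_data_mult[OF Suc D] by (simp del: of_nat_Suc)
  qed
  show ?thesis
  proof (cases k)
    case (nonneg n)
    then show ?thesis using nat[of n] by (simp add: int_pow_int)
  next
    case (neg n)
    have "- (int (Suc n) *s \<mu> \<sigma>) = k *s \<mu> \<sigma>" for \<sigma> by (simp add: neg vec_eq_iff)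
    moreover have "D [^]\<^bsub>CG\<^esub> k = inv\<^bsub>CG\<^esub> (D [^]\<^bsub>CG\<^esub> Suc n)" unfolding neg by (rule G.int_pow_neg_int[OF D'])
    ultimately show ?thesis using invariant_data_inv[OF nat[of "Suc n"]] by simp
  qed
qed

lemma picard_class_invariant:
  assumes "b \<in> carrier PG"
  shows "\<exists>D \<mu>. invariant_data D \<mu> \<and> b = cls D"
proof -
  interpret G: comm_group CG by (rule comm_group_cartier)
  obtain D where D: "D \<in> CDiv" "b = cls D"
    using assms by (auto simp: picard_group_def carrier_FactGroup)
  obtain f where f: "f \<noteq> 0" "\<And>q. q \<in> Spec {0} \<Longrightarrow> D (pt {0} q) = coset f (pt {0} q)"
    using principal_on_torus[OF D(1)] by blast
  define P where "P = principal_divisor \<Sigma> (inverse f)"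
  have P: "P \<in> principals" "P \<in> CDiv" using f by (auto simp: P_def principal_in_CDiv)
  define E where "E = P \<odot> D"
  have E: "E \<in> CDiv" using P D by (simp add: E_def)
  have "E (pt {0} q) = local_units (pt {0} q)" if q: "q \<in> Spec {0}" for q
  proof -
    have "E (pt {0} q) = coset (inverse f * f) (pt {0} q)"
      unfolding E_def by (rule cartier_mult_coset)
        (use f q pt_in[OF zero_cone q] in \<open>auto simp: P_def principal_divisor_at\<close>)
    then show ?thesis using f by (simp add: coset_1)
  qed
  then obtain \<mu> where "invariant_data E \<mu>" using invariant_data_exists[OF E] by blast
  moreover have "cls E = cls D"
    unfolding E_def using G.coset_mult_assoc[of principals P D] subgroup_principal P D(1)
      G.coset_join2[OF P(2) subgroup_principal P(1)] subgroup.subset by metis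
  ultimately show ?thesis using D(2) by blast
qed

lemma finprod_picard_classes:
  assumes "finite B" and data: "\<And>b. b \<in> B \<Longrightarrow> invariant_data (D b) (\<mu> b) \<and> b = cls (D b)"
  shows "\<exists>E. invariant_data E (\<lambda>\<sigma>. \<Sum>b\<in>B. c b *s \<mu> b \<sigma>) \<and>
    finprod PG (\<lambda>b. b [^]\<^bsub>PG\<^esub> (c b :: int)) B = cls E"
  using assms
proof (induction B rule: finite_induct)
  case empty
  interpret G: comm_group CG by (rule comm_group_cartier)
  have "cls (principal_divisor \<Sigma> (chi 0)) = principals"
    by (rule G.coset_join2[OF _ subgroup_principal]) (auto simp: principal_in_CDiv)
  moreover have "finprod PG (\<lambda>b. b [^]\<^bsub>PG\<^esub> c b) {} = principals"
  proof -
    interpret P: comm_group PG by (rule comm_group_picard)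
    show ?thesis by (subst P.finprod_empty) (simp add: picard_group_def)
  qed
  ultimately show ?case using invariant_data_principal[of 0] by (intro exI[of _ "principal_divisor \<Sigma> (chi 0)"]) auto
next
  case (insert b B)
  interpret G: comm_group CG by (rule comm_group_cartier)
  interpret P: comm_group PG by (rule comm_group_picard)
  interpret N: normal principals CG by (rule normal_principals)
  obtain E where E: "invariant_data E (\<lambda>\<sigma>. \<Sum>b\<in>B. c b *s \<mu> b \<sigma>)"
    "finprod PG (\<lambda>b. b [^]\<^bsub>PG\<^esub> c b) B = cls E"
    using insert by auto
  have Db: "invariant_data (D b) (\<mu> b)" "b = cls (D b)" using insert.prems by auto
  have car: "x \<in> carrier PG" if "x \<in> insert b B" for x
    using insert.prems[OF that] invariant_dataD(1) by (auto simp: picard_group_def carrier_FactGroup)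
  have pow: "b [^]\<^bsub>PG\<^esub> c b = cls (D b [^]\<^bsub>CG\<^esub> c b)"
    using N.FactGroup_int_pow[OF invariant_dataD(1)[OF Db(1)], of "c b"] Db(2) by (simp add: picard_group_def)
  have "finprod PG (\<lambda>b. b [^]\<^bsub>PG\<^esub> c b) (insert b B) =
      (b [^]\<^bsub>PG\<^esub> c b) \<otimes>\<^bsub>PG\<^esub> (cls E)"
    using insert.hyps car E(2) by (subst P.finprod_insert) auto
  also have "\<dots> = cls ((D b [^]\<^bsub>CG\<^esub> c b) \<odot> E)"
    unfolding pow using N.rcos_sum[of "D b [^]\<^bsub>CG\<^esub> c b" E] invariant_dataD(1)[OF Db(1)] invariant_dataD(1)[OF E(1)]
    by (simp add: picard_group_def)
  finally show ?case
    using invariant_data_mult[OF invariant_data_pow[OF Db(1), of "c b"] E(1)] insert.hyps by auto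
qed

text \<open>This reduces the rank bound to lattice data: if a combination of the data is one
  character m on all maximal cones, dividing by m leaves zero data, so the combination of the
  classes is trivial.\<close>

lemma picard_independent:
  assumes B: "finite B" "B \<subseteq> carrier PG" and ind: "int_independent PG B"
  shows "\<exists>\<mu>. (\<forall>b\<in>B. \<forall>\<sigma>\<in>max_cones. \<forall>\<sigma>'\<in>max_cones. \<forall>v\<in>\<sigma> \<inter> \<sigma>'. pair (\<mu> b \<sigma>) v = pair (\<mu> b \<sigma>') v) \<and>
    (\<forall>c m. (\<forall>\<sigma>\<in>max_cones. (\<Sum>b\<in>B. c b *s \<mu> b \<sigma>) = m) \<longrightarrow> (\<forall>b\<in>B. c b = 0))"
proof -
  define Q where "Q b D \<mu> \<longleftrightarrow> invariant_data D \<mu> \<and> b = cls D" for b D \<mu>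
  have "\<forall>b\<in>B. \<exists>D \<mu>. Q b D \<mu>" using picard_class_invariant B unfolding Q_def by blast
  then obtain D \<mu> where "\<And>b. b \<in> B \<Longrightarrow> Q b (D b) (\<mu> b)" by metis
  then have D: "\<And>b. b \<in> B \<Longrightarrow> invariant_data (D b) (\<mu> b) \<and> b = cls (D b)"
    unfolding Q_def .
  show ?thesis
  proof (intro exI[of _ \<mu>] conjI allI impI)
    show "\<forall>b\<in>B. \<forall>\<sigma>\<in>max_cones. \<forall>\<sigma>'\<in>max_cones. \<forall>v\<in>\<sigma> \<inter> \<sigma>'. pair (\<mu> b \<sigma>) v = pair (\<mu> b \<sigma>') v"
      using D invariant_data_compatible by blast
    fix c :: "_ \<Rightarrow> int" and m assume m: "\<forall>\<sigma>\<in>max_cones. (\<Sum>b\<in>B. c b *s \<mu> b \<sigma>) = m"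
    interpret G: comm_group CG by (rule comm_group_cartier)
    obtain E where E: "invariant_data E (\<lambda>\<sigma>. \<Sum>b\<in>B. c b *s \<mu> b \<sigma>)"
      "finprod PG (\<lambda>b. b [^]\<^bsub>PG\<^esub> c b) B = cls E"
      using finprod_picard_classes[OF B(1) D, of c] by blast
    have "invariant_data E (\<lambda>_. m)" using E(1) m invariant_data_cong[of "\<lambda>\<sigma>. \<Sum>b\<in>B. c b *s \<mu> b \<sigma>" "\<lambda>_. m" E] by simp
    then have "invariant_data (E \<odot> principal_divisor \<Sigma> (chi (- m))) (\<lambda>_. 0)"
      using invariant_data_mult[OF _ invariant_data_principal[of "- m"]] by fastforce
    then have "E \<odot> principal_divisor \<Sigma> (chi (- m)) = \<one>\<^bsub>CG\<^esub>"
      using invariant_data_zero by (simp add: cartier_one)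
    then have "E = inv\<^bsub>CG\<^esub> (principal_divisor \<Sigma> (chi (- m)))"
      using G.inv_equality[of E] invariant_dataD(1)[OF E(1)] principal_in_CDiv[of "chi (- m)"] by simp
    then have "E \<in> principals"
      using subgroup.m_inv_closed[OF subgroup_principal, of "principal_divisor \<Sigma> (chi (- m))"] by auto
    then have "finprod PG (\<lambda>b. b [^]\<^bsub>PG\<^esub> c b) B = \<one>\<^bsub>PG\<^esub>"
      using G.coset_join2[OF _ subgroup_principal] invariant_dataD(1)[OF E(1)] E(2) by (simp add: picard_group_def)
    then show "\<forall>b\<in>B. c b = 0" using ind unfolding int_independent_def by blast
  qed
qed

end

section \<open>Integer linear systems with more unknowns than equations\<close>

lemma int_linear_system:
  fixes L :: "'i \<Rightarrow> 'b \<Rightarrow> int"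
  assumes "finite I" "finite B" "card I < card B"
  shows "\<exists>c. (\<forall>i\<in>I. (\<Sum>b\<in>B. c b * L i b) = 0) \<and> (\<exists>b\<in>B. c b \<noteq> 0)"
  using assms
proof (induction I arbitrary: B L rule: finite_induct)
  case empty
  then have "B \<noteq> {}" by auto
  then show ?case by (intro exI[of _ "\<lambda>_. 1"]) auto
next
  case (insert i I)
  show ?case
  proof (cases "\<forall>b\<in>B. L i b = 0")
    case True
    obtain c where "\<forall>i\<in>I. (\<Sum>b\<in>B. c b * L i b) = 0" "\<exists>b\<in>B. c b \<noteq> 0"
      using insert.IH[of B L] insert.prems insert.hyps by auto
    then show ?thesis using True by (intro exI[of _ c]) auto
  next
    case False
    then obtain a where a: "a \<in> B" "L i a \<noteq> 0" by blast
    \<comment> \<open>Elimination of the unknown a with pivot \<open>L i a\<close>, by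
      cross-multiplication so that all coefficients remain integers.\<close>
    define L' where "L' j b = L i a * L j b - L j a * L i b" for j b
    have "card I < card (B - {a})" using insert a by auto
    then obtain c where c: "\<forall>j\<in>I. (\<Sum>b\<in>B - {a}. c b * L' j b) = 0" "\<exists>b\<in>B - {a}. c b \<noteq> 0"
      using insert.IH[of "B - {a}" L'] insert.prems by auto
    \<comment> \<open>The other unknowns are scaled by the pivot, so that the value at a which
      solves equation i is an integer. As the pivot is nonzero, the solution stays nonzero.\<close>
    define c' where "c' b = (if b = a then - (\<Sum>b\<in>B - {a}. c b * L i b) else L i a * c b)" for b
    have sum: "(\<Sum>b\<in>B. c' b * L j b) = (\<Sum>b\<in>B - {a}. c b * L' j b)" for j
    proof -
      have "(\<Sum>b\<in>B. c' b * L j b) = c' a * L j a + (\<Sum>b\<in>B - {a}. c' b * L j b)"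
        using insert.prems a by (simp add: sum.remove)
      also have "(\<Sum>b\<in>B - {a}. c' b * L j b) = (\<Sum>b\<in>B - {a}. L i a * c b * L j b)"
        by (rule sum.cong) (auto simp: c'_def)
      also have "c' a * L j a = - (\<Sum>b\<in>B - {a}. c b * L i b * L j a)"
        by (simp add: c'_def sum_distrib_right)
      finally show ?thesis by (simp add: L'_def sum_subtractf algebra_simps)
    qed
    have "(\<Sum>b\<in>B. c' b * L i b) = 0" unfolding sum by (simp add: L'_def mult.commute)
    moreover have "\<exists>b\<in>B. c' b \<noteq> 0" using c(2) a by (auto simp: c'_def)
    ultimately show ?thesis using sum c(1) by (intro exI[of _ c']) auto
  qed
qed

section \<open>Faces of a reflexive polytope\<close>

lemma pair_inner: "pair m u = (\<chi> i. real_of_int (m $ i)) \<bullet> u"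
  by (simp add: pair_def inner_vec_def)

lemma pair_linear: "pair m (x + y) = pair m x + pair m y" "pair m (x - y) = pair m x - pair m y"
  "pair m (a *\<^sub>R x) = a * pair m x" "pair m (- x) = - pair m x"
  by (simp_all add: pair_inner inner_add_right inner_diff_right)

lemma pair_axis: "pair m (axis i 1) = real_of_int (m $ i)"
  by (simp add: pair_inner inner_axis)

lemma pair_sum: "finite A \<Longrightarrow> pair (\<Sum>a\<in>A. f a) u = (\<Sum>a\<in>A. pair (f a) u)"
  by (induction A rule: finite_induct) (simp_all add: pair_add)

lemma pair_span_eq_0:
  assumes "\<And>v. v \<in> A \<Longrightarrow> pair m v = 0" "u \<in> span A" shows "pair m u = 0"
  using assms(2)
proof (induction rule: span_induct_alt)
  case (step c x y)
  then show ?case using assms(1) by (simp add: pair_linear)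
qed simp

lemma pair_eq_0_all:
  assumes "\<And>u. pair m u = 0" shows "m = 0"
  using assms[of "axis _ 1"] by (simp add: pair_axis vec_eq_iff)

lemma dim_eq_aff_dim:
  fixes A :: "'a::euclidean_space set"
  assumes "0 \<notin> affine hull A" shows "int (dim A) = aff_dim A + 1"
proof -
  have "int (dim A) = aff_dim (insert 0 A)"
    using aff_dim_zero[of "insert 0 A"] by (simp add: hull_inc dim_insert span_zero)
  then show ?thesis using assms by (simp add: aff_dim_insert)
qed

lemma convex_cone_hull_iff:
  fixes F :: "'a::euclidean_space set"
  assumes "convex F"
  shows "z \<in> convex_cone hull F \<longleftrightarrow> z = 0 \<or> (\<exists>t>0. \<exists>y\<in>F. z = t *\<^sub>R y)"
proof -
  have "z \<in> convex_cone hull F \<longleftrightarrow> z = 0 \<or> (\<exists>y\<in>F. \<exists>t\<ge>0. z = t *\<^sub>R y)"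
    unfolding convex_cone_hull_convex_hull[of F] hull_same[of convex, OF assms] by auto
  also have "\<dots> \<longleftrightarrow> z = 0 \<or> (\<exists>t>0. \<exists>y\<in>F. z = t *\<^sub>R y)"
    by (metis less_le order_refl scale_zero_left)
  finally show ?thesis .
qed

lemma polytope_vertices:
  fixes F :: "(real ^ 'n) set"
  assumes "polytope F"
  shows "finite (vertices F)" "convex hull (vertices F) = F" "vertices F \<subseteq> F"
proof -
  obtain V where V: "finite V" "F = convex hull V" using assms by (auto simp: polytope_def)
  show "finite (vertices F)"
    unfolding vertices_def V(2) by (rule finite_subset[OF extreme_points_of_convex_hull V(1)])
  show "convex hull (vertices F) = F"
    using Krein_Milman_polytope[OF V(1)] by (simp add: vertices_def V(2))
  show "vertices F \<subseteq> F" by (auto simp: vertices_def extreme_point_of_def)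
qed

text \<open>The form in which reflexivity enters: P is cut out by integer normals, all at height -1.
  S will be the lattice points that span the polar.\<close>

locale lattice_normals =
  fixes P :: "(real ^ 'n) set" and S :: "(int ^ 'n) set"
  assumes polytope: "polytope P" and fin: "finite S" and P_eq: "P = {y. \<forall>u\<in>S. - 1 \<le> pair u y}"
    and int0: "0 \<in> interior P"

lemma reflexive_lattice_normals:
  fixes P :: "(real ^ 'n) set"
  assumes "reflexive P" shows "\<exists>S. lattice_normals P S"
proof -
  obtain V where V: "finite V" "P = convex hull V"
    using assms by (auto simp: reflexive_def lattice_polytope_def)
  obtain T where T: "finite T" "T \<subseteq> lattice_points" "polar_dual P = convex hull T"
    using assms by (auto simp: reflexive_def lattice_polytope_def)
  have int0: "0 \<in> interior P" using assms by (simp add: reflexive_def)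
  have poly: "polytope P" using V by (auto simp: polytope_def)
  define S where "S = (\<lambda>u. \<chi> i. \<lfloor>u $ i\<rfloor>) ` T"
  have pair_T: "pair (\<chi> i. \<lfloor>u $ i\<rfloor>) y = u \<bullet> y" if "u \<in> T" for u y
    using that T(2) unfolding pair_inner lattice_points_def
    by (intro arg_cong2[of _ _ _ _ "(\<bullet>)"]) (auto simp: vec_eq_iff elim!: Ints_cases dest!: subsetD)
  have "P = {y. \<forall>u\<in>T. - 1 \<le> u \<bullet> y}"
  proof
    have "T \<subseteq> polar_dual P" unfolding T(3) by (rule hull_subset)
    then show "P \<subseteq> {y. \<forall>u\<in>T. - 1 \<le> u \<bullet> y}" by (auto simp: polar_dual_def)
    show "{y. \<forall>u\<in>T. - 1 \<le> u \<bullet> y} \<subseteq> P"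
    proof
      fix y assume y: "y \<in> {y. \<forall>u\<in>T. - 1 \<le> u \<bullet> y}"
      show "y \<in> P"
      proof (rule ccontr)
        assume "y \<notin> P"
        then obtain a b where ab: "a \<bullet> y < b" "\<And>x. x \<in> P \<Longrightarrow> b < a \<bullet> x"
          using separating_hyperplane_closed_point[of P y] poly polytope_imp_convex polytope_imp_closed by blast
        have b: "b < 0" using ab(2)[of 0] int0 interior_subset by auto
        \<comment> \<open>Since 0 lies in P, b is negative; scaling moves the separating hyperplane
          to height -1 and thereby puts u into the polar.\<close>
        define u where "u = (1 / - b) *\<^sub>R a"
        have "- 1 \<le> u \<bullet> x" if "x \<in> P" for x using ab(2)[OF that] b by (simp add: u_def field_simps)
        then have "u \<in> convex hull T" unfolding T(3)[symmetric] by (simp add: polar_dual_def)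
        moreover have "convex hull T \<subseteq> {u. y \<bullet> u \<ge> - 1}"
        proof (rule hull_minimal)
          show "T \<subseteq> {u. y \<bullet> u \<ge> - 1}" using y by (auto simp: inner_commute)
        qed (rule convex_halfspace_ge)
        ultimately have "- 1 \<le> u \<bullet> y" by (auto simp: inner_commute)
        then show False using ab(1) b by (simp add: u_def field_simps)
      qed
    qed
  qed
  also have "\<dots> = {y. \<forall>u\<in>S. - 1 \<le> pair u y}" using pair_T by (auto simp: S_def)
  finally have "lattice_normals P S" using T(1) poly int0 by unfold_locales (auto simp: S_def)
  then show ?thesis ..
qed

context lattice_normals
begin

definition active :: "(real ^ 'n) set \<Rightarrow> (int ^ 'n) set" where
  "active F = {u\<in>S. \<forall>y\<in>F. pair u y = - 1}"

abbreviation proper_face :: "(real ^ 'n) set \<Rightarrow> bool" where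
  "proper_face F \<equiv> F face_of P \<and> F \<noteq> P"

lemma in_P: "y \<in> P \<Longrightarrow> u \<in> S \<Longrightarrow> - 1 \<le> pair u y"
  using P_eq by auto

lemma zero_in_P: "0 \<in> P" using int0 interior_subset by auto

lemma bounded_P: "bounded P" using polytope polytope_imp_bounded by auto

lemma no_ray:
  assumes "y \<noteq> 0" shows "\<exists>t\<ge>0. t *\<^sub>R y \<notin> P"
proof -
  obtain B where B: "\<And>x. x \<in> P \<Longrightarrow> norm x \<le> B" using bounded_P by (auto simp: bounded_iff)
  have "((\<bar>B\<bar> + 1) / norm y) *\<^sub>R y \<notin> P" using B[of "((\<bar>B\<bar> + 1) / norm y) *\<^sub>R y"] assms by auto
  then show ?thesis by (intro exI[of _ "(\<bar>B\<bar> + 1) / norm y"]) auto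
qed

text \<open>This covers the empty face, for which all normals are active. Otherwise P would contain
  a whole ray.\<close>

lemma no_common_zero: "\<not> (\<forall>u\<in>S. pair u y = - 1)"
proof
  assume y: "\<forall>u\<in>S. pair u y = - 1"
  \<comment> \<open>All normals are positive on -y. If y is 0, then S must be empty and any
    direction will do.\<close>
  define x where "x = (if y = 0 then axis undefined 1 else - y)"
  have "x \<noteq> 0" by (simp add: x_def axis_eq_0_iff)
  then obtain t where t: "t \<ge> 0" "t *\<^sub>R x \<notin> P" using no_ray by blast
  have "t *\<^sub>R x \<in> P"
  proof (cases "y = 0")
    case True
    then have "S = {}" using y by auto
    then show ?thesis using P_eq by auto
  next
    case False
    then show ?thesis using y t(1) by (subst P_eq) (simp add: x_def pair_linear)
  qed
  then show False using t by auto
qed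

text \<open>Take x in the relative interior of F: a normal active at x is active on all of F.
  Conversely, if y in P satisfies these equalities, the segment from y to x can be prolonged beyond
  x inside P, and the face property puts y into F.\<close>

lemma face_eq_active:
  assumes F: "proper_face F" shows "F = {y\<in>P. \<forall>u\<in>active F. pair u y = - 1}"
proof (cases "F = {}")
  case True
  then have "active F = S" by (auto simp: active_def)
  then show ?thesis using no_common_zero True by auto
next
  case False
  have conv: "convex F" using F face_of_imp_convex by auto
  have FP: "F \<subseteq> P" using F face_of_imp_subset by auto
  obtain x where x: "x \<in> rel_interior F" using False conv rel_interior_eq_empty by blast
  then have xF: "x \<in> F" using rel_interior_subset by auto
  have act: "u \<in> active F" if u: "u \<in> S" "pair u x = - 1" for u
  proof -
    have "pair u y = - 1" if y: "y \<in> F" for y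
    proof -
      obtain e where e: "e > 1" "(1 - e) *\<^sub>R y + e *\<^sub>R x \<in> F"
        using x y convex_rel_interior_iff[OF conv False] by blast
      have "- 1 \<le> (1 - e) * pair u y + e * - 1"
        using in_P[of "(1 - e) *\<^sub>R y + e *\<^sub>R x" u] e FP u by (auto simp: pair_linear)
      then have "(1 - e) * (pair u y + 1) \<ge> 0" by (simp add: algebra_simps)
      then have "pair u y + 1 \<le> 0" using e(1) by (simp add: zero_le_mult_iff)
      then show ?thesis using in_P[of y u] y FP u by auto
    qed
    then show ?thesis using u by (auto simp: active_def)
  qed
  show ?thesis
  proof
    show "F \<subseteq> {y\<in>P. \<forall>u\<in>active F. pair u y = - 1}" using FP by (auto simp: active_def)
    show "{y\<in>P. \<forall>u\<in>active F. pair u y = - 1} \<subseteq> F"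
    proof
      fix y assume y: "y \<in> {y\<in>P. \<forall>u\<in>active F. pair u y = - 1}"
      show "y \<in> F"
      proof (cases "y = x")
        case False
        have "\<exists>e>0. \<forall>d. 0 < d \<longrightarrow> d \<le> e \<longrightarrow> - 1 \<le> pair u (x + d *\<^sub>R (x - y))" if u: "u \<in> S" for u
        proof (cases "pair u x = - 1")
          case True
          then have "pair u y = - 1" using act[OF u] y by auto
          then show ?thesis using True by (intro exI[of _ 1]) (simp add: pair_linear)
        next
          case False
          then have gt: "0 < pair u x + 1" using in_P[of x u] xF FP u by force
          \<comment> \<open>A bound for the change of u along the prolongation; the summand 1 keeps
            it positive as a divisor.\<close>
          define K where "K = \<bar>pair u x - pair u y\<bar> + 1"
          have K: "K > 0" by (simp add: K_def)
          have "- 1 \<le> pair u (x + d *\<^sub>R (x - y))" if d: "0 < d" "d \<le> (pair u x + 1) / K" for d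
          proof -
            have "d * (- K) \<le> d * (pair u x - pair u y)"
              using d by (intro mult_left_mono) (auto simp: K_def)
            moreover have "d * K \<le> pair u x + 1" using d K by (simp add: field_simps)
            ultimately show ?thesis by (simp add: pair_linear)
          qed
          then show ?thesis using gt K by (intro exI[of _ "(pair u x + 1) / K"]) auto
        qed
        then obtain e where e: "\<And>u. u \<in> S \<Longrightarrow> e u > 0"
          "\<And>u d. u \<in> S \<Longrightarrow> 0 < d \<Longrightarrow> d \<le> e u \<Longrightarrow> - 1 \<le> pair u (x + d *\<^sub>R (x - y))" by metis
        define d where "d = Min (insert 1 (e ` S))"
        have d: "0 < d" "\<And>u. u \<in> S \<Longrightarrow> d \<le> e u" using fin e(1) by (auto simp: d_def)
        define z where "z = x + d *\<^sub>R (x - y)"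
        have z: "z \<in> P" using e(2) d by (subst P_eq) (auto simp: z_def)
        have "x = (1 - 1 / (1 + d)) *\<^sub>R y + (1 / (1 + d)) *\<^sub>R z"
        proof -
          have "(1 + d) *\<^sub>R x = d *\<^sub>R y + z" by (simp add: z_def algebra_simps)
          then have "x = (1 / (1 + d)) *\<^sub>R (d *\<^sub>R y + z)" using d(1)
            by (metis add_pos_pos less_numeral_extra(1) less_numeral_extra(3) nonzero_divide_eq_eq scaleR_left_imp_eq scaleR_one scaleR_scaleR mult.commute)
          moreover have "1 - 1 / (1 + d) = d / (1 + d)" using d(1) by (simp add: field_simps)
          ultimately show ?thesis by (simp add: scaleR_add_right)
        qed
        moreover have "y \<noteq> z"
        proof
          assume "y = z"
          then have "(1 + d) *\<^sub>R (y - x) = 0" by (simp add: z_def algebra_simps)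
          then show False using False d(1) by simp
        qed
        moreover have "0 < 1 / (1 + d)" "1 / (1 + d) < 1" using d(1) by auto
        ultimately have "x \<in> open_segment y z" unfolding in_segment by blast
        then show ?thesis using face_ofD[of F P x y z] F xF y z by auto
      qed (use xF in simp)
    qed
  qed
qed

lemma active_nonempty: "proper_face F \<Longrightarrow> active F \<noteq> {}"
  using face_eq_active[of F] by auto

lemma proper_face_Int: "proper_face F \<Longrightarrow> proper_face F' \<Longrightarrow> proper_face (F \<inter> F')"
  using face_of_Int[of F P F'] face_of_imp_subset by blast

lemma cone_iff:
  "proper_face F \<Longrightarrow> z \<in> convex_cone hull F \<longleftrightarrow> z = 0 \<or> (\<exists>t>0. \<exists>y\<in>F. z = t *\<^sub>R y)"
  using convex_cone_hull_iff face_of_imp_convex by blast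

text \<open>A ray from 0 meets the boundary of P only once: a normal active at one point has value
  at least -1 at the other, which compares the two factors in both directions.\<close>

lemma scale_unique:
  assumes F: "proper_face F" "y \<in> F" and F': "proper_face F'" "y' \<in> F'"
    and t: "0 < t" "0 < t'" "t *\<^sub>R y = t' *\<^sub>R y'"
  shows "t = t'"
proof -
  have le: "t \<le> t'" if "proper_face F" "y \<in> F" "proper_face F'" "y' \<in> F'" "0 < t'" "t *\<^sub>R y = t' *\<^sub>R y'"
    for F F' y y' t t'
  proof -
    obtain u where u: "u \<in> active F" using active_nonempty \<open>proper_face F\<close> by blast
    have "- t = t' * pair u y'"
      using arg_cong[OF that(6), of "pair u"] u that(2) by (simp add: pair_linear active_def)
    moreover have "- 1 \<le> pair u y'"
      using in_P[of y' u] u that(4) face_of_imp_subset[of F' P] that(3) by (auto simp: active_def)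
    then have "t' * - 1 \<le> t' * pair u y'" using that(5) by (intro mult_left_mono) auto
    ultimately show ?thesis by simp
  qed
  show ?thesis using le[OF F F' t(2,3)] le[OF F' F t(1) t(3)[symmetric]] by simp
qed

lemma cone_Int:
  assumes F: "proper_face F" and F': "proper_face F'"
  shows "convex_cone hull F \<inter> convex_cone hull F' = convex_cone hull (F \<inter> F')"
proof
  show "convex_cone hull (F \<inter> F') \<subseteq> convex_cone hull F \<inter> convex_cone hull F'"
    by (simp add: hull_mono)
  show "convex_cone hull F \<inter> convex_cone hull F' \<subseteq> convex_cone hull (F \<inter> F')"
  proof
    fix z assume z: "z \<in> convex_cone hull F \<inter> convex_cone hull F'"
    show "z \<in> convex_cone hull (F \<inter> F')"
    proof (cases "z = 0")
      case False
      obtain t y where ty: "t > 0" "y \<in> F" "z = t *\<^sub>R y" using z False cone_iff[OF F] by auto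
      obtain t' y' where ty': "t' > 0" "y' \<in> F'" "z = t' *\<^sub>R y'" using z False cone_iff[OF F'] by auto
      have "t = t'" using scale_unique[OF F ty(2) F' ty'(2) ty(1) ty'(1)] ty ty' by simp
      then have "y = y'" using ty ty' by simp
      then show ?thesis using ty ty' cone_iff[OF proper_face_Int[OF F F'], of z] by blast
    qed (simp add: convex_cone_hull_contains_0)
  qed
qed

lemma fan_iff: "\<sigma> \<in> spanning_fan P \<longleftrightarrow> (\<exists>F. proper_face F \<and> \<sigma> = convex_cone hull F)"
  by (auto simp: spanning_fan_def)

lemma face_polytope: "proper_face F \<Longrightarrow> polytope F"
  using face_of_polytope_polytope polytope by blast

lemma empty_proper_face: "proper_face {}"
  using zero_in_P by auto

lemma dual_cone:
  assumes F: "proper_face F"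
  shows "m \<in> dual_semigroup (convex_cone hull F) \<longleftrightarrow> (\<forall>v\<in>F. 0 \<le> pair m v)"
proof
  assume "m \<in> dual_semigroup (convex_cone hull F)"
  then show "\<forall>v\<in>F. 0 \<le> pair m v" using hull_subset[of F convex_cone] by (auto simp: dual_semigroup_pair)
next
  assume "\<forall>v\<in>F. 0 \<le> pair m v"
  then show "m \<in> dual_semigroup (convex_cone hull F)"
    by (auto simp: dual_semigroup_pair cone_iff[OF F] pair_linear)
qed

lemma toric_fan_spanning_fan: "toric_fan (spanning_fan P)"
proof
  show "{0} \<in> spanning_fan P" using empty_proper_face fan_iff by (metis convex_cone_hull_empty)
next
  fix \<sigma> \<tau> assume "\<sigma> \<in> spanning_fan P" "\<tau> \<in> spanning_fan P"
  then show "\<sigma> \<inter> \<tau> \<in> spanning_fan P" using cone_Int proper_face_Int by (metis fan_iff)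
next
  fix \<sigma> \<tau> assume \<sigma>: "\<sigma> \<in> spanning_fan P" and \<tau>: "\<tau> \<in> spanning_fan P" and sub: "\<tau> \<subseteq> \<sigma>"
  obtain F where F: "proper_face F" "\<sigma> = convex_cone hull F" using \<sigma> fan_iff by auto
  obtain F' where F': "proper_face F'" "\<tau> = convex_cone hull F'" using \<tau> fan_iff by auto
  define E where "E = F \<inter> F'"
  have E: "proper_face E" "E \<subseteq> F" using proper_face_Int F F' by (auto simp: E_def)
  have \<tau>E: "\<tau> = convex_cone hull E" using sub cone_Int[OF F(1) F'(1)] F F' by (auto simp: E_def)
  obtain w where w: "w \<in> active F" using active_nonempty F by blast
  \<comment> \<open>On F the normal w is constantly -1, so each summand is u + 1 there: it is
    nonnegative, and all of them vanish together exactly on E. Subtracting w makes the functional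
    homogeneous and keeps it integral.\<close>
  define m where "m = (\<Sum>u\<in>active E. u - w)"
  have fa: "finite (active E)" using fin by (simp add: active_def)
  have FP: "F \<subseteq> P" using F face_of_imp_subset by blast
  have pm: "pair m v = (\<Sum>u\<in>active E. pair u v + 1)" if "v \<in> F" for v
    unfolding m_def pair_sum[OF fa] using that w by (intro sum.cong) (auto simp: pair_diff active_def)
  have nn: "0 \<le> pair u v + 1" if "v \<in> F" "u \<in> active E" for u v
    using in_P[of v u] that FP by (auto simp: active_def)
  have pm0: "pair m v = 0 \<longleftrightarrow> v \<in> E" if v: "v \<in> F" for v
  proof -
    have "pair m v = 0 \<longleftrightarrow> (\<forall>u\<in>active E. pair u v + 1 = 0)"
      unfolding pm[OF v] by (rule sum_nonneg_eq_0_iff[OF fa]) (use nn[OF v] in auto)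
    also have "\<dots> \<longleftrightarrow> (\<forall>u\<in>active E. pair u v = - 1)" by (auto simp: add_eq_0_iff)
    also have "\<dots> \<longleftrightarrow> v \<in> E" using face_eq_active[OF E(1)] v FP by auto
    finally show ?thesis .
  qed
  show "\<exists>m\<in>dual_semigroup \<sigma>. \<tau> = {u \<in> \<sigma>. pair m u = 0}"
  proof
    show "m \<in> dual_semigroup \<sigma>" unfolding F(2) dual_cone[OF F(1)] using pm nn by (auto intro: sum_nonneg)
    show "\<tau> = {u \<in> \<sigma>. pair m u = 0}"
    proof
      have "pair m v = 0" if "v \<in> E" for v using pm0[of v] E(2) that by auto
      then show "\<tau> \<subseteq> {u \<in> \<sigma>. pair m u = 0}"
        using sub unfolding \<tau>E by (auto simp: cone_iff[OF E(1)] pair_linear)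
      show "{u \<in> \<sigma>. pair m u = 0} \<subseteq> \<tau>"
      proof
        fix z assume z: "z \<in> {u \<in> \<sigma>. pair m u = 0}"
        show "z \<in> \<tau>"
        proof (cases "z = 0")
          case False
          then obtain t y where "t > 0" "y \<in> F" "z = t *\<^sub>R y" using z cone_iff[OF F(1)] F(2) by auto
          moreover from this have "y \<in> E" using z pm0[of y] by (simp add: pair_linear)
          ultimately show ?thesis unfolding \<tau>E cone_iff[OF E(1)] by blast
        qed (simp add: \<tau>E convex_cone_hull_contains_0)
      qed
    qed
  qed
next
  fix \<sigma> assume "\<sigma> \<in> spanning_fan P"
  then obtain F where F: "proper_face F" "\<sigma> = convex_cone hull F" using fan_iff by auto
  note V = polytope_vertices[OF face_polytope[OF F(1)]]
  show "\<exists>V\<subseteq>\<sigma>. finite V \<and> (\<forall>m. (\<forall>v\<in>V. 0 \<le> pair m v) \<longrightarrow> m \<in> dual_semigroup \<sigma>)"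
  proof (intro exI[of _ "vertices F"] conjI allI impI)
    show "vertices F \<subseteq> \<sigma>" unfolding F(2) using V(3) hull_subset[of F convex_cone] by blast
    show "finite (vertices F)" by (rule V(1))
    fix m assume m: "\<forall>v\<in>vertices F. 0 \<le> pair m v"
    have "convex hull (vertices F) \<subseteq> {v. (\<chi> i. real_of_int (m $ i)) \<bullet> v \<ge> 0}"
      by (rule hull_minimal) (use m in \<open>auto simp: pair_inner convex_halfspace_ge\<close>)
    then show "m \<in> dual_semigroup \<sigma>" unfolding F(2) dual_cone[OF F(1)] using V(2) by (auto simp: pair_inner)
  qed
qed

section \<open>Facets and full-dimensional cones\<close>

lemma facet_proper: "G \<in> facets P \<Longrightarrow> proper_face G"
  by (auto simp: facets_def facet_of_def)

lemma aff_dim_P: "aff_dim P = int CARD('n)"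
  using aff_dim_nonempty_interior[of P] int0 by auto

lemma facet_aff_dim: "G \<in> facets P \<Longrightarrow> aff_dim G = int CARD('n) - 1"
  using aff_dim_P by (simp add: facets_def facet_of_def)

lemma proper_face_subset_facet:
  assumes "proper_face F" obtains G where "G \<in> facets P" "F \<subseteq> G"
proof (cases "F = {}")
  case True
  have "0 < aff_dim P" using aff_dim_P by simp
  then show ?thesis using polytope_facet_exists[OF polytope] that True by (auto simp: facets_def)
next
  case False
  then show ?thesis
    using face_of_polyhedron_subset_facet[OF polytope_imp_polyhedron[OF polytope]] assms that
    by (auto simp: facets_def)
qed

lemma zero_notin_affine_hull:
  assumes "proper_face F" "A \<subseteq> F" shows "0 \<notin> affine hull A"
proof -
  obtain u where u: "u \<in> active F" using active_nonempty assms by blast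
  have "affine hull A \<subseteq> {y. (\<chi> i. real_of_int (u $ i)) \<bullet> y = - 1}"
    by (rule hull_minimal) (use u assms in \<open>auto simp: active_def pair_inner affine_hyperplane\<close>)
  then show ?thesis by auto
qed

lemma dim_in_face: "proper_face F \<Longrightarrow> A \<subseteq> F \<Longrightarrow> int (dim A) = aff_dim A + 1"
  using zero_notin_affine_hull dim_eq_aff_dim by blast

lemma span_facet:
  assumes "G \<in> facets P" shows "span G = UNIV"
proof -
  have "dim G = CARD('n)" using dim_in_face[OF facet_proper[OF assms] order_refl] facet_aff_dim[OF assms] by simp
  then show ?thesis using dim_eq_full[of G] by simp
qed

lemma complete_toric_fan_facets:
  "complete_toric_fan (spanning_fan P) ((\<lambda>G. convex_cone hull G) ` facets P)"
proof -
  interpret toric_fan "spanning_fan P" by (rule toric_fan_spanning_fan)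
  show ?thesis
  proof
    show "(\<lambda>G. convex_cone hull G) ` facets P \<subseteq> spanning_fan P" using facet_proper fan_iff by blast
  next
    fix \<tau> assume "\<tau> \<in> spanning_fan P"
    then obtain F where F: "proper_face F" "\<tau> = convex_cone hull F" using fan_iff by auto
    then obtain G where "G \<in> facets P" "F \<subseteq> G" using proper_face_subset_facet by blast
    then show "\<exists>\<sigma>\<in>(\<lambda>G. convex_cone hull G) ` facets P. \<tau> \<subseteq> \<sigma>"
      unfolding F(2) by (intro bexI[of _ "convex_cone hull G"] hull_mono) auto
  next
    fix \<sigma> assume "\<sigma> \<in> (\<lambda>G. convex_cone hull G) ` facets P"
    then show "0 \<in> \<sigma>" using convex_cone_hull_contains_0 by auto
  next
    fix \<sigma> m assume \<sigma>: "\<sigma> \<in> (\<lambda>G. convex_cone hull G) ` facets P" and m: "m \<in> dual_semigroup \<sigma>" "- m \<in> dual_semigroup \<sigma>"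
    obtain G where G: "G \<in> facets P" "\<sigma> = convex_cone hull G" using \<sigma> by auto
    have "pair m v = 0" if "v \<in> G" for v
      using m that unfolding G(2) dual_cone[OF facet_proper[OF G(1)]] by (force simp: pair_uminus)
    then have "pair m u = 0" for u using pair_span_eq_0[of G m u] span_facet[OF G(1)] by auto
    then show "m = 0" by (rule pair_eq_0_all)
  qed
qed

end

section \<open>The facet complexity bounds the Picard rank\<close>

context lattice_normals
begin

lemma facet_sequence_nth: "L \<in> facet_sequences P \<Longrightarrow> i < length L \<Longrightarrow> L ! i \<in> facets P"
  by (auto simp: facet_sequences_def dest: nth_mem)

lemma vertices_facet: "G \<in> facets P \<Longrightarrow> vertices G \<subseteq> G"
  using polytope_vertices(3) face_polytope facet_proper by blast

lemma seq_complexity_finite: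
  assumes "seq_complexity L \<noteq> \<infinity>"
  shows "\<And>i. i \<in> {1..<length L} \<Longrightarrow> seq_cost L i = 0 \<or> seq_cost L i = 1"
    "seq_complexity L = enat (card {i\<in>{1..<length L}. seq_cost L i = 1})"
proof -
  have fin: "seq_cost L i \<noteq> \<infinity>" if "i \<in> {1..<length L}" for i
  proof
    assume "seq_cost L i = \<infinity>"
    then have "seq_complexity L = \<infinity>"
      using that unfolding seq_complexity_def by (subst sum.remove[of _ i]) auto
    then show False using assms by simp
  qed
  then show 1: "seq_cost L i = 0 \<or> seq_cost L i = 1" if "i \<in> {1..<length L}" for i
    using fin[OF that] unfolding seq_cost_def by (simp split: if_splits)
  have "seq_complexity L = (\<Sum>i\<in>{1..<length L}. if seq_cost L i = 1 then 1 else 0)"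
    unfolding seq_complexity_def by (rule sum.cong) (use 1 in auto)
  also have "\<dots> = (\<Sum>i\<in>{i\<in>{1..<length L}. seq_cost L i = 1}. 1)"
    by (simp add: sum.If_cases Int_def)
  also have "\<dots> = enat (card {i\<in>{1..<length L}. seq_cost L i = 1})"
    by (simp add: of_nat_eq_enat)
  finally show "seq_complexity L = enat (card {i\<in>{1..<length L}. seq_cost L i = 1})" .
qed

text \<open>Since G lies in an affine hyperplane that avoids 0, the linear span of A has dimension
  one more than \<open>aff_dim A\<close>. It is everything in a step of cost 0. In a step of cost 1
  it is a hyperplane, which cannot contain all unit vectors; one outside it supplies the missing
  condition on m.\<close>

lemma common_vertices_determine:
  assumes G: "G \<in> facets P" and A: "A \<subseteq> G" and zero: "\<And>v. v \<in> A \<Longrightarrow> pair m v = 0"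
  shows "aff_dim A = int CARD('n) - 1 \<Longrightarrow> m = 0"
    "\<exists>k. aff_dim A = int CARD('n) - 2 \<longrightarrow> axis k 1 \<notin> span A"
    "aff_dim A = int CARD('n) - 2 \<Longrightarrow> axis k 1 \<notin> span A \<Longrightarrow> m $ k = 0 \<Longrightarrow> m = 0"
proof -
  have dimA: "int (dim A) = aff_dim A + 1" using dim_in_face[OF facet_proper[OF G] A] .
  have full: "m = 0" if "span C = UNIV" "\<And>v. v \<in> C \<Longrightarrow> pair m v = 0" for C
    by (rule pair_eq_0_all) (use pair_span_eq_0[of C m] that in auto)
  show "m = 0" if "aff_dim A = int CARD('n) - 1"
  proof (rule full[of A])
    show "span A = UNIV" using dimA that dim_eq_full[of A] by simp
  qed (rule zero)
  show "\<exists>k. aff_dim A = int CARD('n) - 2 \<longrightarrow> axis k 1 \<notin> span A"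
  proof (rule ccontr)
    assume "\<not> ?thesis"
    then have *: "aff_dim A = int CARD('n) - 2" "\<And>k. axis k 1 \<in> span A" by auto
    have "(Basis :: (real ^ 'n) set) \<subseteq> span A" using *(2) by (auto simp: Basis_vec_def)
    then have "span A = UNIV" by (metis span_Basis span_mono span_span top.extremum_uniqueI)
    then have "dim A = CARD('n)" using dim_eq_full[of A] by simp
    then show False using *(1) dimA by simp
  qed
  show "m = 0" if "aff_dim A = int CARD('n) - 2" "axis k 1 \<notin> span A" "m $ k = 0" for k
  proof (rule full[of "insert (axis k 1) A"])
    have "dim (insert (axis k 1 :: real ^ 'n) A) = CARD('n)" using that(1,2) dimA by (simp add: dim_insert)
    then show "span (insert (axis k 1) A) = UNIV" using dim_eq_full[of "insert (axis k 1 :: real ^ 'n) A"] by simp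
    show "pair m v = 0" if "v \<in> insert (axis k 1) A" for v
      using that zero \<open>m $ k = 0\<close> by (auto simp: pair_axis)
  qed
qed

lemma ex_axis_notin_span:
  assumes G: "G \<in> facets P" and A: "A \<subseteq> G" and "aff_dim A = int CARD('n) - 2"
  shows "\<exists>k. axis k 1 \<notin> span A"
  using common_vertices_determine(2)[OF G A, of 0] assms(3) by auto

lemma picard_rank_le_seq_complexity:
  assumes L: "L \<in> facet_sequences P"
  shows "picard_rank (spanning_fan P) \<le> seq_complexity L"
  unfolding picard_rank_def group_rank_def
proof (rule SUP_least, rule ccontr)
  let ?C = "\<lambda>G. convex_cone hull G"
  interpret complete_toric_fan "spanning_fan P" "?C ` facets P" by (rule complete_toric_fan_facets)
  fix B assume "B \<in> {B. finite B \<and> B \<subseteq> carrier (picard_group (spanning_fan P)) \<and> int_independent (picard_group (spanning_fan P)) B}"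
  then have B: "finite B" "B \<subseteq> carrier (picard_group (spanning_fan P))" "int_independent (picard_group (spanning_fan P)) B" by auto
  obtain \<mu> where compat: "\<forall>b\<in>B. \<forall>\<sigma>\<in>?C ` facets P. \<forall>\<sigma>'\<in>?C ` facets P. \<forall>v\<in>\<sigma> \<inter> \<sigma>'. pair (\<mu> b \<sigma>) v = pair (\<mu> b \<sigma>') v"
    and indep: "\<forall>c m. (\<forall>\<sigma>\<in>?C ` facets P. (\<Sum>b\<in>B. c b *s \<mu> b \<sigma>) = m) \<longrightarrow> (\<forall>b\<in>B. c b = 0)"
    using picard_independent[OF B] by (elim exE conjE)
  define \<nu> where "\<nu> b i = \<mu> b (?C (L ! i))" for b i
  define A where "A i = (\<Union>j\<le>i - 1. vertices (L ! j)) \<inter> vertices (L ! i)" for i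
  define I where "I = {i\<in>{1..<length L}. seq_cost L i = 1}"
  assume "\<not> enat (card B) \<le> seq_complexity L"
  then have lt: "seq_complexity L < enat (card B)" by simp
  then have fin: "seq_complexity L \<noteq> \<infinity>" by (metis enat_ord_simps(6))
  note cost = seq_complexity_finite[OF fin]
  have card: "card I < card B" using lt unfolding cost(2) I_def by simp
  have AG: "A i \<subseteq> L ! i" if "i < length L" for i
    using vertices_facet[OF facet_sequence_nth[OF L that]] by (auto simp: A_def)
  have "\<exists>k. axis k 1 \<notin> span (A i)" if "i \<in> I" for i
  proof (rule ex_axis_notin_span)
    show "L ! i \<in> facets P" "A i \<subseteq> L ! i" using that facet_sequence_nth[OF L] AG by (auto simp: I_def)
    show "aff_dim (A i) = int CARD('n) - 2"
      using that by (auto simp: I_def seq_cost_def seq_dim_def A_def split: if_splits)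
  qed
  then obtain k where k: "\<And>i. i \<in> I \<Longrightarrow> axis (k i) 1 \<notin> span (A i)" by metis
  have "finite I" by (simp add: I_def)
  \<comment> \<open>One equation per step of cost 1: in the coordinate \<open>k i\<close>, the
    combined data at step i and at step 0 shall agree.\<close>
  obtain c where c: "\<And>i. i \<in> I \<Longrightarrow> (\<Sum>b\<in>B. c b * (\<nu> b i $ k i - \<nu> b 0 $ k i)) = 0" "\<exists>b\<in>B. c b \<noteq> 0"
    using int_linear_system[OF \<open>finite I\<close> B(1) card, of "\<lambda>i b. \<nu> b i $ k i - \<nu> b 0 $ k i"] by blast
  define m where "m i = (\<Sum>b\<in>B. c b *s \<nu> b i)" for i
  have m_compat: "pair (m i) v = pair (m j) v" if "i < length L" "j < length L" "v \<in> L ! i" "v \<in> L ! j" for i j v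
    unfolding m_def pair_sum[OF B(1)] pair_scale
  proof (rule sum.cong[OF refl])
    fix b assume b: "b \<in> B"
    have "v \<in> ?C (L ! i) \<inter> ?C (L ! j)" using that(3,4) by (simp add: hull_inc)
    then have "pair (\<nu> b i) v = pair (\<nu> b j) v"
      unfolding \<nu>_def
      by (rule compat[rule_format, OF b imageI[OF facet_sequence_nth[OF L that(1)]] imageI[OF facet_sequence_nth[OF L that(2)]]])
    then show "real_of_int (c b) * pair (\<nu> b i) v = real_of_int (c b) * pair (\<nu> b j) v" by simp
  qed
  \<comment> \<open>By induction all earlier facets carry \<open>m 0\<close>, so
    \<open>m i - m 0\<close> vanishes on the vertices shared with them; in a step of cost 1 the
    choice of c also kills its coordinate \<open>k i\<close>.\<close>
  have m_eq: "m i = m 0" if "i < length L" for i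
    using that
  proof (induction i rule: less_induct)
    case (less i)
    show ?case
    proof (cases "i = 0")
      case False
      then have i: "i \<in> {1..<length L}" using less.prems by auto
      have G: "L ! i \<in> facets P" using facet_sequence_nth[OF L less.prems] .
      have zero: "pair (m i - m 0) v = 0" if v: "v \<in> A i" for v
      proof -
        obtain j where j: "j \<le> i - 1" "v \<in> vertices (L ! j)" using v by (auto simp: A_def)
        then have ji: "j < i" "j < length L" using i by auto
        have "v \<in> L ! j" using j(2) vertices_facet[OF facet_sequence_nth[OF L ji(2)]] by auto
        then have "pair (m i) v = pair (m j) v" using m_compat[OF less.prems ji(2)] v AG[OF less.prems] by auto
        then show ?thesis using less.IH[OF ji] by (simp add: pair_diff)
      qed
      have "m i - m 0 = 0"
      proof (cases "i \<in> I")
        case True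
        have "(m i - m 0) $ k i = (\<Sum>b\<in>B. c b * (\<nu> b i $ k i - \<nu> b 0 $ k i))"
          by (simp add: m_def right_diff_distrib sum_subtractf)
        then have "(m i - m 0) $ k i = 0" using c(1)[OF True] by simp
        moreover have "aff_dim (A i) = int CARD('n) - 2"
          using True by (auto simp: I_def seq_cost_def seq_dim_def A_def split: if_splits)
        ultimately show ?thesis
          using common_vertices_determine(3)[OF G AG[OF less.prems] zero] k[OF True] by blast
      next
        case False
        then have "seq_cost L i = 0" using cost(1)[OF i] i by (auto simp: I_def)
        then have "aff_dim (A i) = int CARD('n) - 1"
          by (auto simp: seq_cost_def seq_dim_def A_def split: if_splits)
        then show ?thesis using common_vertices_determine(1)[OF G AG[OF less.prems] zero] by blast
      qed
      then show ?thesis by simp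
    qed simp
  qed
  have "(\<Sum>b\<in>B. c b *s \<mu> b \<sigma>) = m 0" if \<sigma>: "\<sigma> \<in> ?C ` facets P" for \<sigma>
  proof -
    obtain G where G: "G \<in> set L" "\<sigma> = ?C G" using \<sigma> L by (auto simp: facet_sequences_def)
    obtain i where "i < length L" "L ! i = G" using G(1) by (auto simp: in_set_conv_nth)
    then have "i < length L" "\<sigma> = ?C (L ! i)" using G(2) by auto
    then show ?thesis using m_eq[of i] by (simp add: m_def \<nu>_def)
  qed
  then have "\<forall>b\<in>B. c b = 0" using indep[rule_format, of c "m 0"] by blast
  then show False using c(2) by blast
qed

section \<open>Facet sequences along ridges\<close>

lemma cone_cover: "\<exists>G\<in>facets P. z \<in> convex_cone hull G"
proof (cases "z = 0")
  case True
  then show ?thesis using proper_face_subset_facet[OF empty_proper_face] convex_cone_hull_contains_0 by metis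
next
  case False
  have "\<exists>u\<in>S. pair u z < 0"
  proof (rule ccontr)
    assume "\<not> ?thesis"
    then have "t *\<^sub>R z \<in> P" if "t \<ge> 0" for t
      using that by (subst P_eq) (auto simp: pair_linear not_less intro: order_trans[of "-1" 0])
    then show False using no_ray[OF False] by blast
  qed
  then obtain u1 where u1: "u1 \<in> S" "pair u1 z < 0" by blast
  \<comment> \<open>This is the gauge of P at z: dividing by it moves z to the boundary, into the
    face where a maximizing normal is active.\<close>
  define g where "g = Max ((\<lambda>u. - pair u z) ` S)"
  have "g \<in> (\<lambda>u. - pair u z) ` S" unfolding g_def by (rule Max_in) (use fin u1 in auto)
  then obtain u0 where u0: "u0 \<in> S" "g = - pair u0 z" by auto
  have ge: "- pair u z \<le> g" if "u \<in> S" for u unfolding g_def using fin that by simp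
  have g: "g > 0" using ge[OF u1(1)] u1(2) by simp
  define y where "y = (1 / g) *\<^sub>R z"
  have "- g \<le> pair u z" if "u \<in> S" for u using ge[OF that] by simp
  then have yP: "y \<in> P" using g by (subst P_eq) (auto simp: y_def pair_linear field_simps)
  have y0: "pair u0 y = - 1" using u0 g by (simp add: y_def pair_linear)
  define F where "F = P \<inter> {x. (\<chi> i. real_of_int (u0 $ i)) \<bullet> x = - 1}"
  have "F face_of P" unfolding F_def
    by (rule face_of_Int_supporting_hyperplane_ge)
      (use in_P u0 polytope polytope_imp_convex in \<open>auto simp: pair_inner[symmetric]\<close>)
  moreover have "0 \<notin> F" by (simp add: F_def)
  then have "F \<noteq> P" using zero_in_P by auto
  ultimately obtain G where G: "G \<in> facets P" "F \<subseteq> G" using proper_face_subset_facet by blast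
  have "y \<in> G" using G yP y0 by (auto simp: F_def pair_inner[symmetric])
  moreover have "z = g *\<^sub>R y" using g by (simp add: y_def)
  ultimately show ?thesis using G(1) cone_iff[OF facet_proper[OF G(1)], of z] g by blast
qed

lemma closed_cone: "proper_face F \<Longrightarrow> closed (convex_cone hull F)"
  using polyhedron_convex_cone_hull_polytope face_polytope polyhedron_imp_closed by blast

lemma cone_subset_span: "convex_cone hull F \<subseteq> span F"
  by (metis hull_minimal span_superset subspace_imp_convex_cone subspace_span)

lemma cone_not_negligible:
  assumes "G \<in> facets P" shows "\<not> negligible (convex_cone hull G)"
proof -
  let ?C = "convex_cone hull G"
  have "span ?C = UNIV" using span_facet[OF assms] span_mono[OF hull_subset[of G convex_cone]] by auto
  then have "dim ?C = CARD('n)" using dim_eq_full[of ?C] by simp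
  then have "aff_dim ?C = int CARD('n)" using aff_dim_zero[of ?C] by (simp add: hull_inc convex_cone_hull_contains_0)
  then have "interior ?C = rel_interior ?C" using interior_rel_interior_gen[of ?C] by simp
  moreover have "rel_interior ?C \<noteq> {}"
    using rel_interior_eq_empty[OF convex_convex_cone_hull, of G] convex_cone_hull_nonempty by blast
  ultimately show ?thesis using negligible_convex_interior[OF convex_convex_cone_hull, of G] by simp
qed

lemma negligible_UN_span:
  fixes F :: "'b \<Rightarrow> 'c \<Rightarrow> 'a::euclidean_space set"
  assumes "finite I" "finite J" "\<And>i j. i \<in> I \<Longrightarrow> j \<in> J \<Longrightarrow> dim (F i j) < DIM('a)"
  shows "negligible (\<Union>i\<in>I. \<Union>j\<in>J. span (F i j))"
proof -
  have "negligible (span (F i j))" if "i \<in> I" "j \<in> J" for i j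
    by (rule negligible_lowdim) (use assms(3)[OF that] in \<open>simp add: dim_span\<close>)
  then show ?thesis using assms(1,2) by (intro negligible_Union finite_imageI) auto
qed

text \<open>A generic segment from the cone of one facet to that of another leaves the cones of \<open>\<A>\<close> through a
  face of codimension one.\<close>

lemma exists_adjacent_facet:
  assumes \<A>: "\<A> \<subseteq> facets P" "\<A> \<noteq> {}" "\<A> \<noteq> facets P"
  shows "\<exists>G\<in>\<A>. \<exists>H\<in>facets P - \<A>. int CARD('n) - 2 \<le> aff_dim (G \<inter> H)"
proof (rule ccontr)
  assume contra: "\<not> ?thesis"
  let ?C = "\<lambda>G. convex_cone hull G"
  have finF: "finite (facets P)" unfolding facets_def by (rule finite_polytope_facets[OF polytope])
  have fin\<A>: "finite \<A>" "finite (facets P - \<A>)" using \<A> finF finite_subset by auto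
  \<comment> \<open>If no two such facets meet in a ridge, the spans of the intersections have
    codimension at least 2 and stay negligible after one more vector is added.\<close>
  have dim: "dim (G \<inter> H) + 1 < CARD('n)" if "G \<in> \<A>" "H \<in> facets P - \<A>" for G H
  proof -
    have "G \<in> facets P" using that \<A> by auto
    then have "int (dim (G \<inter> H)) = aff_dim (G \<inter> H) + 1" by (intro dim_in_face[OF facet_proper]) auto
    moreover have "aff_dim (G \<inter> H) < int CARD('n) - 2" using contra that by force
    ultimately show ?thesis by simp
  qed
  obtain A B where A: "A \<in> \<A>" and B: "B \<in> facets P - \<A>" using \<A> by blast
  define W where "W = (\<Union>G\<in>\<A>. \<Union>H\<in>facets P - \<A>. span (G \<inter> H))"
  have negl_W: "negligible W" unfolding W_def
    using dim by (intro negligible_UN_span fin\<A>) fastforce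
  have "\<not> ?C A \<subseteq> W" using cone_not_negligible[of A] A \<A> negligible_subset[OF negl_W] by blast
  then obtain x where x: "x \<in> ?C A" "x \<notin> W" by blast
  \<comment> \<open>The start x avoids the spans themselves; an end point y outside their joins with
    x keeps the rest of the segment away from them as well.\<close>
  define Y where "Y = (\<Union>G\<in>\<A>. \<Union>H\<in>facets P - \<A>. span (insert x (G \<inter> H)))"
  have negl_Y: "negligible Y" unfolding Y_def
    using dim by (intro negligible_UN_span fin\<A>) (fastforce simp: dim_insert)
  have "\<not> ?C B \<subseteq> Y" using cone_not_negligible[of B] B negligible_subset[OF negl_Y] by blast
  then obtain y where y: "y \<in> ?C B" "y \<notin> Y" by blast
  define p where "p t = (1 - t) *\<^sub>R x + t *\<^sub>R y" for t :: real
  have cont: "continuous_on UNIV p" unfolding p_def by (intro continuous_intros)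
  define K1 where "K1 = (\<Union>G\<in>\<A>. ?C G)"
  define K2 where "K2 = (\<Union>H\<in>facets P - \<A>. ?C H)"
  have cl: "closed K1" "closed K2"
    unfolding K1_def K2_def using fin\<A> \<A> facet_proper closed_cone by (intro closed_UN; blast)+
  have cover: "z \<in> K1 \<or> z \<in> K2" for z using cone_cover[of z] by (auto simp: K1_def K2_def)
  have span_Int: "z \<in> span (G \<inter> H)" if "G \<in> \<A>" "H \<in> facets P - \<A>" "z \<in> ?C G" "z \<in> ?C H" for z G H
    using cone_Int[OF facet_proper facet_proper, of G H] that \<A> cone_subset_span[of "G \<inter> H"] by blast
  define T where "T = {0..1} \<inter> p -` K1"
  have "closed (p -` K1)" using cl(1) cont by (metis closed_vimage continuous_on_eq_continuous_within)
  then have "compact T" unfolding T_def by (intro compact_Int_closed compact_Icc)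
  moreover have "0 \<in> T" using x A by (auto simp: T_def p_def K1_def)
  \<comment> \<open>The last parameter at which the segment is in a cone of \<A>.\<close>
  ultimately obtain t where t: "t \<in> T" "\<And>s. s \<in> T \<Longrightarrow> s \<le> t"
    using compact_attains_sup[of T] by auto
  obtain G where G: "G \<in> \<A>" "p t \<in> ?C G" using t(1) by (auto simp: T_def K1_def)
  have "1 \<notin> T"
  proof
    assume "1 \<in> T"
    then obtain G where "G \<in> \<A>" "y \<in> ?C G" by (auto simp: T_def K1_def p_def)
    then have "y \<in> span (insert x (G \<inter> B))" using span_Int[of G B y] B y(1) span_mono[of "G \<inter> B" "insert x (G \<inter> B)"] by blast
    then show False using y(2) \<open>G \<in> \<A>\<close> B by (auto simp: Y_def)
  qed
  then have t1: "0 \<le> t" "t < 1" using t(1) by (auto simp: T_def less_le)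
  \<comment> \<open>After t the segment lies in the other cones; as these are closed, the point at t
    belongs to both unions.\<close>
  have "{t<..1} \<subseteq> p -` K2"
  proof
    fix s assume s: "s \<in> {t<..1}"
    then have "s \<notin> T" using t(2)[of s] by auto
    then show "s \<in> p -` K2" using s t1 cover[of "p s"] by (auto simp: T_def)
  qed
  moreover have "closed (p -` K2)" using cl(2) cont by (metis closed_vimage continuous_on_eq_continuous_within)
  ultimately have "closure {t<..1} \<subseteq> p -` K2" by (rule closure_minimal)
  moreover have "t \<in> closure {t<..1}" using t1 by simp
  ultimately have "p t \<in> K2" by auto
  then obtain H where H: "H \<in> facets P - \<A>" "p t \<in> ?C H" by (auto simp: K2_def)
  have pt: "p t \<in> span (G \<inter> H)" using span_Int[OF G(1) H(1) G(2) H(2)] .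
  show False
  proof (cases "t = 0")
    case True
    then have "x \<in> W" using pt G(1) H(1) by (auto simp: W_def p_def)
    then show False using x(2) by simp
  next
    case False
    have "p t \<in> span (insert x (G \<inter> H))" using pt span_mono[of "G \<inter> H" "insert x (G \<inter> H)"] by blast
    then have "(1 / t) *\<^sub>R (p t - (1 - t) *\<^sub>R x) \<in> span (insert x (G \<inter> H))"
      by (intro span_scale span_diff) (auto intro: span_base)
    moreover have "(1 / t) *\<^sub>R (p t - (1 - t) *\<^sub>R x) = y" using False by (simp add: p_def)
    ultimately have "y \<in> Y" using G(1) H(1) by (auto simp: Y_def)
    then show False using y(2) by simp
  qed
qed

text \<open>The vertices of a common face are vertices of both facets, so the shared vertices
  affinely span at least the ridge; being contained in H, they span at most its affine hull.\<close>

lemma seq_dim_append_ridge: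
  assumes "set L \<subseteq> facets P" "H \<in> facets P" "G \<in> set L" "int CARD('n) - 2 \<le> aff_dim (G \<inter> H)"
  shows "int CARD('n) - 2 \<le> seq_dim (L @ [H]) (length L)" "seq_dim (L @ [H]) (length L) \<le> int CARD('n) - 1"
proof -
  let ?A = "(\<Union>j\<le>length L - 1. vertices ((L @ [H]) ! j)) \<inter> vertices H"
  have A: "seq_dim (L @ [H]) (length L) = aff_dim ?A" by (simp add: seq_dim_def)
  have G: "G \<in> facets P" using assms by auto
  have GH: "proper_face (G \<inter> H)" using proper_face_Int[OF facet_proper[OF G] facet_proper[OF assms(2)]] .
  obtain j where j: "j < length L" "L ! j = G" using assms(3) by (auto simp: in_set_conv_nth)
  have "vertices (G \<inter> H) \<subseteq> vertices G \<inter> vertices H"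
    using extreme_point_of_face[of "G \<inter> H" P] extreme_point_of_face[of G P] extreme_point_of_face[of H P]
      GH facet_proper[OF G] facet_proper[OF assms(2)] by (auto simp: vertices_def)
  also have "\<dots> \<subseteq> ?A" using j by (force simp: nth_append)
  finally have "aff_dim (vertices (G \<inter> H)) \<le> aff_dim ?A" by (rule aff_dim_subset)
  then have "aff_dim (G \<inter> H) \<le> aff_dim ?A"
    using aff_dim_convex_hull[of "vertices (G \<inter> H)"] polytope_vertices(2)[OF face_polytope[OF GH]] by simp
  then show "int CARD('n) - 2 \<le> seq_dim (L @ [H]) (length L)" using A assms(4) by simp
  have "?A \<subseteq> H" using vertices_facet[OF assms(2)] by auto
  then show "seq_dim (L @ [H]) (length L) \<le> int CARD('n) - 1"
    using A aff_dim_subset[of ?A H] facet_aff_dim[OF assms(2)] by simp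
qed

lemma seq_dim_append:
  assumes "i < length L" shows "seq_dim (L @ [H]) i = seq_dim L i"
proof -
  have "(\<Union>j\<le>i - 1. vertices ((L @ [H]) ! j)) = (\<Union>j\<le>i - 1. vertices (L ! j))"
    by (rule SUP_cong) (use assms in \<open>auto simp: nth_append\<close>)
  then show ?thesis using assms by (simp add: seq_dim_def nth_append)
qed

text \<open>As long as facets are missing, one of them meets an already listed facet in codimension
  one of the boundary and can be appended at cost at most 1.\<close>

lemma ridge_sequence:
  assumes "1 \<le> k" "k \<le> card (facets P)"
  shows "\<exists>L. length L = k \<and> distinct L \<and> set L \<subseteq> facets P \<and> (\<forall>i\<in>{1..<length L}. seq_cost L i \<le> 1)"
  using assms
proof (induction k rule: nat_induct_at_least)
  case base
  obtain G where "G \<in> facets P" using proper_face_subset_facet[OF empty_proper_face] by blast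
  then show ?case by (intro exI[of _ "[G]"]) auto
next
  case (Suc k)
  obtain L where L: "length L = k" "distinct L" "set L \<subseteq> facets P" "\<And>i. i \<in> {1..<length L} \<Longrightarrow> seq_cost L i \<le> 1"
    using Suc by auto
  have "set L \<noteq> facets P" using L(1,2) Suc.prems distinct_card[of L] by auto
  moreover have "set L \<noteq> {}" using L(1) Suc.hyps by auto
  ultimately obtain G H where GH: "G \<in> set L" "H \<in> facets P" "H \<notin> set L" "int CARD('n) - 2 \<le> aff_dim (G \<inter> H)"
    using exists_adjacent_facet[OF L(3)] by blast
  have "seq_cost (L @ [H]) i \<le> 1" if "i \<in> {1..<length (L @ [H])}" for i
  proof (cases "i < length L")
    case True
    have "seq_cost (L @ [H]) i = seq_cost L i"
      unfolding seq_cost_def seq_dim_append[OF True] ..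
    then show ?thesis using L(4)[of i] that True by auto
  next
    case False
    then have "i = length L" using that by auto
    then show ?thesis using seq_dim_append_ridge[OF L(3) GH(2,1,4)] by (auto simp: seq_cost_def)
  qed
  then show ?case using L GH by (intro exI[of _ "L @ [H]"]) auto
qed

lemma facet_complexity_le: "facet_complexity P \<le> enat (card (facets P) - 1)"
proof -
  have finF: "finite (facets P)" unfolding facets_def by (rule finite_polytope_facets[OF polytope])
  obtain G where "G \<in> facets P" using proper_face_subset_facet[OF empty_proper_face] by blast
  then have "1 \<le> card (facets P)" using finF by (auto simp: Suc_le_eq card_gt_0_iff)
  then obtain L where L: "length L = card (facets P)" "distinct L" "set L \<subseteq> facets P" "\<And>i. i \<in> {1..<length L} \<Longrightarrow> seq_cost L i \<le> 1"
    using ridge_sequence[of "card (facets P)"] by auto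
  have "set L = facets P" using L finF by (metis card_subset_eq distinct_card)
  then have "L \<in> facet_sequences P" using L by (simp add: facet_sequences_def)
  then have "facet_complexity P \<le> seq_complexity L" unfolding facet_complexity_def by (rule INF_lower)
  \<comment> \<open>The facet at index 0 carries no cost, which accounts for the subtracted
    1.\<close>
  also have "\<dots> \<le> (\<Sum>i = 1..<length L. 1)" unfolding seq_complexity_def by (rule sum_mono) (rule L(4))
  also have "\<dots> = enat (card (facets P) - 1)" by (simp add: of_nat_eq_enat L(1))
  finally show ?thesis .
qed

end

theorem theorem1p2:
  fixes P :: "(real ^ 'n) set"
  assumes "reflexive P"
  shows "picard_rank (spanning_fan P) \<le> facet_complexity P
    \<and> facet_complexity P \<le> enat (card (facets P) - 1)"
proof -
  obtain S where "lattice_normals P S" using reflexive_lattice_normals[OF assms] by blast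
  then interpret lattice_normals P S .
  have "picard_rank (spanning_fan P) \<le> facet_complexity P"
    unfolding facet_complexity_def by (rule INF_greatest) (rule picard_rank_le_seq_complexity)
  then show ?thesis using facet_complexity_le by simp
qed

end
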